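(* Let $0<T\le\infty$ and $\alpha,\beta>0$. Then, for all $f,g,h\in\mathcal{F}_T$ with $f^\#,g^\#,h^\#\in L^\infty([0,T),\mathcal{M}_{\alpha,\beta})$, the following bounds hold for any $t\in[0,T)$: for the binary operators, $$\int_0^t|L_2^\#(f,g)(\tau)|\,d\tau,\ \int_0^t|G_2^\#(f,g)(\tau)|\,d\tau\ \le\ K_\beta\alpha^{-1/2}M_{\alpha,\beta}\,|||f^\#|||_\infty|||g^\#|||_\infty;$$ for the ternary operators, $$\int_0^t|L_3^\#(f,g,h)(\tau)|\,d\tau,\ \int_0^t|G_3^\#(f,g,h)(\tau)|\,d\tau\ \le\ K_\beta\alpha^{-1/2}M_{\alpha,\beta}\,|||f^\#|||_\infty|||g^\#|||_\infty|||h^\#|||_\infty;$$ for the mixed operators, $$\int_0^t|L^\#(f,g,h)(\tau)|\,d\tau,\ \int_0^t|G^\#(f,g,h)(\tau)|\,d\tau\ \le\ K_\beta\alpha^{-1/2}M_{\alpha,\beta}\,|||f^\#|||_\infty|||g^\#|||_\infty\,(1+|||h^\#|||_\infty);$$ where $$K_\beta=C_d\Big[\|b_2\|_{L^1(\mathbb{S}^{d-1})}\Big(\beta^{-d/2}+\frac{1}{d+\gamma_2-1}\Big)+\|b_3\|_{L^1(\mathbb{S}^{2d-1})}\Big(\beta^{-d}+\frac{1}{2d+\gamma_3-1}\Big)\Big]$$ and $C_d$ is an appropriate constant depending on the dimension $d$.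
   Context: Collision kernels. Fix $d\ge2$, $\gamma_2\in(-d+1,1]$, $\gamma_3\in(-2d+1,1]$. Let $b_2:[-1,1]\to[0,\infty)$ be measurable, even, with $\|b_2\|_{L^1(\mathbb{S}^{d-1})}:=|\mathbb{S}^{d-2}|\int_{-1}^1 b_2(z)(1-z^2)^{\frac{d-3}{2}}dz<\infty$ (this equals $\int_{\mathbb{S}^{d-1}}b_2(e\cdot\omega)\,d\omega$ for any unit vector $e$). Let $b_3:[-1,1]\times[-\frac12,\frac12]\to[0,\infty)$ be measurable, with $b_3(-z,w)=b_3(z,w)$ and $\|b_3\|_{L^1(\mathbb{S}^{2d-1})}:=\sup_{\boldsymbol\nu\in\mathbb{E}^{2d-1}}\int_{\mathbb{S}^{2d-1}}b_3(\boldsymbol\nu\cdot\boldsymbol\omega,\omega_1\cdot\omega_2)\,d\boldsymbol\omega<\infty$, where $\boldsymbol\omega=(\omega_1,\omega_2)\in\mathbb{S}^{2d-1}\subset\mathbb{R}^d\times\mathbb{R}^d$ and $\mathbb{E}^{2d-1}=\{(\nu_1,\nu_2)\in\mathbb{R}^{2d}:|\nu_1|^2+|\nu_2|^2+|\nu_1-\nu_2|^2=1\}$. The functions $b_2,b_3$ are referred to as the binary and ternary angular transition probability densities; at least one of them is not trivially zero, but one of the two may be zero. Binary: for $v,v_1\in\mathbb{R}^d$, $\omega\in\mathbb{S}^{d-1}$, put $u=v_1-v$, $\hat u=u/|u|$, $B_2(u,\omega)=|u|^{\gamma_2}b_2(\hat u\cdot\omega)$, $v'=v+(\omega\cdot u)\omega$,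 $v_1'=v_1-(\omega\cdot u)\omega$. Ternary: for $v,v_1,v_2\in\mathbb{R}^d$, $\boldsymbol\omega=(\omega_1,\omega_2)\in\mathbb{S}^{2d-1}$, put $\boldsymbol u=(v_1-v,v_2-v)\in\mathbb{R}^{2d}$, $|\widetilde{\boldsymbol u}|=\sqrt{|v-v_1|^2+|v-v_2|^2+|v_1-v_2|^2}$, $\bar{\boldsymbol u}=\boldsymbol u/|\widetilde{\boldsymbol u}|$, $B_3(\boldsymbol u,\boldsymbol\omega)=|\widetilde{\boldsymbol u}|^{\gamma_3}b_3(\bar{\boldsymbol u}\cdot\boldsymbol\omega,\omega_1\cdot\omega_2)$, and with $c=\frac{\omega_1\cdot(v_1-v)+\omega_2\cdot(v_2-v)}{1+\omega_1\cdot\omega_2}$: $v^*=v+c(\omega_1+\omega_2)$, $v_1^*=v_1-c\,\omega_1$, $v_2^*=v_2-c\,\omega_2$. Operators (functions of $(t,x,v)$; $t,x$ suppressed): $G_2(f,g)(v)=\int_{\mathbb{S}^{d-1}\times\mathbb{R}^d}B_2 f(v')g(v_1')\,d\omega dv_1$, $L_2(f,g)(v)=\int_{\mathbb{S}^{d-1}\times\mathbb{R}^d} B_2 f(v)g(v_1)\,d\omega dv_1$, $G_3(f,g,h)(v)=\int_{\mathbb{S}^{2d-1}\times\mathbb{R}^{2d}}B_3 f(v^* )g(v_1^* )h(v_2^* )\,d\boldsymbol\omega dv_1dv_2$, $L_3(f,g,h)(v)=\int_{\mathbb{S}^{2d-1}\times\mathbb{R}^{2d}}B_3 f(v)g(v_1)h(v_2)\,d\boldsymbol\omega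 dv_1dv_2$; $G(f,g,h)=G_2(f,g)+G_3(f,g,h)$, $L(f,g,h)=L_2(f,g)+L_3(f,g,h)$. Function spaces. $F_{x,v}$: measurable functions $\mathbb{R}^d\times\mathbb{R}^d\to\overline{\mathbb{R}}$; (in)equalities between functions of $(x,v)$ are understood for a.e. $(x,v)\in\mathbb{R}^d\times\mathbb{R}^d$. $M_{\alpha,\beta}(x,v)=e^{-\alpha|x|^2-\beta|v|^2}$, $\|f\|_{\mathcal{M}_{\alpha,\beta}}=\|fM_{\alpha,\beta}^{-1}\|_{L^\infty(\mathbb{R}^d\times\mathbb{R}^d)}$, $\mathcal{M}_{\alpha,\beta}=\{f\in F_{x,v}:\|f\|_{\mathcal{M}_{\alpha,\beta}}<\infty\}$. $\mathcal{F}_T=\{f:[0,T)\to F_{x,v}\}$, $|||f|||_\infty=\sup_{t\in[0,T)}\|f(t)\|_{\mathcal{M}_{\alpha,\beta}}$ (supremum over all $t$), $L^\infty([0,T),\mathcal{M}_{\alpha,\beta})=\{f\in\mathcal{F}_T:|||f|||_\infty<\infty\}$. Transport. For $f\in\mathcal{F}_T$, $f^\#(t,x,v)=f(t,x+tv,v)$; for each operator above, a superscript $\#$ denotes the transported operator, e.g. $L_2^\#(f,g)=(L_2(f,g))^\#$, $G_3^\#(f,g,h)=(G_3(f,g,h))^\#$.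
   Formalization: The functions f, g, h are additionally assumed jointly (Lebesgue) measurable in (t,x,v); without this the time integrals of the transported operators need not be defined, e.g. f^#(t)=1_E(t)M with E non-measurable. *)

theory Defs
  imports "HOL-Analysis.Analysis" "HOL-Probability.Essential_Supremum"
begin

text \<open>The space \<open>\<real>\<^sup>d\<close> is \<^typ>\<open>real ^ 'n\<close> with \<open>d = CARD('n)\<close>; the product type
  \<^typ>\<open>(real ^ 'n) \<times> (real ^ 'n)\<close> carries the Euclidean norm and inner product of \<open>\<real>\<^sup>2\<^sup>d\<close>.
  \<open>Measurable\<close> means Lebesgue measurable throughout.\<close>

type_synonym 'n vec2 = "(real ^ 'n) \<times> (real ^ 'n)"

type_synonym 'n evolution = "real \<Rightarrow> 'n vec2 \<Rightarrow> ereal"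


section \<open>Integration\<close>

text \<open>Surface measure on the unit sphere, by polar coordinates:
  \<open>\<sigma>(A) = D \<cdot> |{r\<omega> : 0 < r < 1, \<omega> \<in> A}|\<close>, where \<open>D\<close> is the dimension of the ambient space.\<close>

definition sphere_measure :: "'a::euclidean_space measure" where
  "sphere_measure = scale_measure (of_nat DIM('a))
     (distr (restrict_space lborel (ball 0 1 - {0})) (restrict_space borel (sphere 0 1))
        (\<lambda>x. x /\<^sub>R norm x))"

text \<open>\<open>|S\<^sup>n\<^sup>-\<^sup>1| = n |B\<^sup>n|\<close>, as a function of the ambient dimension \<open>n\<close>; in particular
  \<open>|S\<^sup>0| = sphere_area 1 = 2\<close>.\<close>

definition sphere_area :: "nat \<Rightarrow> real" where
  "sphere_area n = real n * unit_ball_vol (real n)"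

text \<open>Integral of an extended-real function as the integral of its positive part minus that of
  its negative part. Since \<^const>\<open>nn_integral\<close> is unchanged by completion of the measure, this is
  also the right value for integrands that are measurable only for the completed measure.\<close>

definition ereal_integral :: "'a measure \<Rightarrow> ('a \<Rightarrow> ereal) \<Rightarrow> ereal" where
  "ereal_integral M F =
     enn2ereal (\<integral>\<^sup>+ x. e2ennreal (F x) \<partial>M) - enn2ereal (\<integral>\<^sup>+ x. e2ennreal (- F x) \<partial>M)"


section \<open>Angular transition probability densities\<close>

definition b2_norm :: "nat \<Rightarrow> (real \<Rightarrow> real) \<Rightarrow> ennreal" where
  "b2_norm d b2 = ennreal (sphere_area (d - 1)) *
     (\<integral>\<^sup>+ z\<in>{-1..1}. ennreal (b2 z * (1 - z\<^sup>2) powr ((real d - 3) / 2)) \<partial>lborel)"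

definition ellipsoid :: "('n::finite) vec2 set" where
  "ellipsoid = {(\<nu>1, \<nu>2). (norm \<nu>1)\<^sup>2 + (norm \<nu>2)\<^sup>2 + (norm (\<nu>1 - \<nu>2))\<^sup>2 = 1}"

definition b3_norm :: "('n::finite) itself \<Rightarrow> (real \<Rightarrow> real \<Rightarrow> real) \<Rightarrow> ennreal" where
  "b3_norm _ b3 = (SUP \<nu>\<in>(ellipsoid :: 'n vec2 set).
     \<integral>\<^sup>+ \<omega>. ennreal (b3 (\<nu> \<bullet> \<omega>) (fst \<omega> \<bullet> snd \<omega>)) \<partial>sphere_measure)"

definition binary_density :: "nat \<Rightarrow> (real \<Rightarrow> real) \<Rightarrow> bool" where
  "binary_density d b2 \<longleftrightarrow>
     b2 \<in> borel_measurable (lebesgue_on {-1..1}) \<and>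
     (\<forall>z\<in>{-1..1}. 0 \<le> b2 z \<and> b2 (- z) = b2 z) \<and>
     b2_norm d b2 < \<infinity>"

definition ternary_density :: "('n::finite) itself \<Rightarrow> (real \<Rightarrow> real \<Rightarrow> real) \<Rightarrow> bool" where
  "ternary_density n b3 \<longleftrightarrow>
     (\<lambda>(z, w). b3 z w) \<in> borel_measurable (lebesgue_on ({-1..1} \<times> {-1/2..1/2})) \<and>
     (\<forall>z\<in>{-1..1}. \<forall>w\<in>{-1/2..1/2}. 0 \<le> b3 z w \<and> b3 (- z) w = b3 z w) \<and>
     b3_norm n b3 < \<infinity>"

definition collision_data ::
  "('n::finite) itself \<Rightarrow> real \<Rightarrow> real \<Rightarrow> (real \<Rightarrow> real) \<Rightarrow> (real \<Rightarrow> real \<Rightarrow> real) \<Rightarrow> bool" where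
  "collision_data n \<gamma>2 \<gamma>3 b2 b3 \<longleftrightarrow>
     \<gamma>2 \<in> {- real CARD('n) + 1 <.. 1} \<and> \<gamma>3 \<in> {- 2 * real CARD('n) + 1 <.. 1} \<and>
     binary_density CARD('n) b2 \<and> ternary_density n b3 \<and>
     ((\<exists>z\<in>{-1..1}. b2 z \<noteq> 0) \<or> (\<exists>z\<in>{-1..1}. \<exists>w\<in>{-1/2..1/2}. b3 z w \<noteq> 0))"


section \<open>Collision operators\<close>

definition B2 :: "real \<Rightarrow> (real \<Rightarrow> real) \<Rightarrow> real ^ ('n::finite) \<Rightarrow> real ^ 'n \<Rightarrow> real" where
  "B2 \<gamma>2 b2 u \<omega> = norm u powr \<gamma>2 * b2 ((u /\<^sub>R norm u) \<bullet> \<omega>)"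

definition utilde_norm :: "('n::finite) vec2 \<Rightarrow> real" where
  "utilde_norm u =
     sqrt ((norm (fst u))\<^sup>2 + (norm (snd u))\<^sup>2 + (norm (fst u - snd u))\<^sup>2)"

definition B3 ::
  "real \<Rightarrow> (real \<Rightarrow> real \<Rightarrow> real) \<Rightarrow> ('n::finite) vec2 \<Rightarrow> 'n vec2 \<Rightarrow> real" where
  "B3 \<gamma>3 b3 u \<omega> =
     utilde_norm u powr \<gamma>3 * b3 ((u /\<^sub>R utilde_norm u) \<bullet> \<omega>) (fst \<omega> \<bullet> snd \<omega>)"

definition ternary_c ::
  "('n::finite) vec2 \<Rightarrow> real ^ 'n \<Rightarrow> real ^ 'n \<Rightarrow> real ^ 'n \<Rightarrow> real" where
  "ternary_c \<omega> v v1 v2 =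
     (fst \<omega> \<bullet> (v1 - v) + snd \<omega> \<bullet> (v2 - v)) / (1 + fst \<omega> \<bullet> snd \<omega>)"

definition G2 ::
  "real \<Rightarrow> (real \<Rightarrow> real) \<Rightarrow> ('n::finite) evolution \<Rightarrow> 'n evolution \<Rightarrow> 'n evolution" where
  "G2 \<gamma>2 b2 f g = (\<lambda>t (x, v). ereal_integral (sphere_measure \<Otimes>\<^sub>M lborel)
     (\<lambda>(\<omega>, v1). ereal (B2 \<gamma>2 b2 (v1 - v) \<omega>)
        * f t (x, v + (\<omega> \<bullet> (v1 - v)) *\<^sub>R \<omega>)
        * g t (x, v1 - (\<omega> \<bullet> (v1 - v)) *\<^sub>R \<omega>)))"

definition L2 ::
  "real \<Rightarrow> (real \<Rightarrow> real) \<Rightarrow> ('n::finite) evolution \<Rightarrow> 'n evolution \<Rightarrow> 'n evolution" where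
  "L2 \<gamma>2 b2 f g = (\<lambda>t (x, v). ereal_integral (sphere_measure \<Otimes>\<^sub>M lborel)
     (\<lambda>(\<omega>, v1). ereal (B2 \<gamma>2 b2 (v1 - v) \<omega>) * f t (x, v) * g t (x, v1)))"

definition G3 ::
  "real \<Rightarrow> (real \<Rightarrow> real \<Rightarrow> real) \<Rightarrow>
    ('n::finite) evolution \<Rightarrow> 'n evolution \<Rightarrow> 'n evolution \<Rightarrow> 'n evolution" where
  "G3 \<gamma>3 b3 f g h = (\<lambda>t (x, v). ereal_integral (sphere_measure \<Otimes>\<^sub>M lborel)
     (\<lambda>(\<omega>, (v1, v2)). ereal (B3 \<gamma>3 b3 (v1 - v, v2 - v) \<omega>)
        * f t (x, v + ternary_c \<omega> v v1 v2 *\<^sub>R (fst \<omega> + snd \<omega>))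
        * g t (x, v1 - ternary_c \<omega> v v1 v2 *\<^sub>R fst \<omega>)
        * h t (x, v2 - ternary_c \<omega> v v1 v2 *\<^sub>R snd \<omega>)))"

definition L3 ::
  "real \<Rightarrow> (real \<Rightarrow> real \<Rightarrow> real) \<Rightarrow>
    ('n::finite) evolution \<Rightarrow> 'n evolution \<Rightarrow> 'n evolution \<Rightarrow> 'n evolution" where
  "L3 \<gamma>3 b3 f g h = (\<lambda>t (x, v). ereal_integral (sphere_measure \<Otimes>\<^sub>M lborel)
     (\<lambda>(\<omega>, (v1, v2)). ereal (B3 \<gamma>3 b3 (v1 - v, v2 - v) \<omega>)
        * f t (x, v) * g t (x, v1) * h t (x, v2)))"

definition G_mixed ::
  "real \<Rightarrow> real \<Rightarrow> (real \<Rightarrow> real) \<Rightarrow> (real \<Rightarrow> real \<Rightarrow> real) \<Rightarrow>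
    ('n::finite) evolution \<Rightarrow> 'n evolution \<Rightarrow> 'n evolution \<Rightarrow> 'n evolution" where
  "G_mixed \<gamma>2 \<gamma>3 b2 b3 f g h = (\<lambda>t p. G2 \<gamma>2 b2 f g t p + G3 \<gamma>3 b3 f g h t p)"

definition L_mixed ::
  "real \<Rightarrow> real \<Rightarrow> (real \<Rightarrow> real) \<Rightarrow> (real \<Rightarrow> real \<Rightarrow> real) \<Rightarrow>
    ('n::finite) evolution \<Rightarrow> 'n evolution \<Rightarrow> 'n evolution \<Rightarrow> 'n evolution" where
  "L_mixed \<gamma>2 \<gamma>3 b2 b3 f g h = (\<lambda>t p. L2 \<gamma>2 b2 f g t p + L3 \<gamma>3 b3 f g h t p)"

definition transport :: "('n::finite) evolution \<Rightarrow> 'n evolution" where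
  "transport f = (\<lambda>t (x, v). f t (x + t *\<^sub>R v, v))"


section \<open>Function spaces\<close>

definition F_xv :: "(('n::finite) vec2 \<Rightarrow> ereal) set" where
  "F_xv = borel_measurable lebesgue"

definition maxwellian :: "real \<Rightarrow> real \<Rightarrow> ('n::finite) vec2 \<Rightarrow> real" where
  "maxwellian \<alpha> \<beta> = (\<lambda>(x, v). exp (- \<alpha> * (norm x)\<^sup>2 - \<beta> * (norm v)\<^sup>2))"

definition M_norm :: "real \<Rightarrow> real \<Rightarrow> (('n::finite) vec2 \<Rightarrow> ereal) \<Rightarrow> ennreal" where
  "M_norm \<alpha> \<beta> f =
     esssup lebesgue (\<lambda>p. e2ennreal \<bar>f p * ereal (inverse (maxwellian \<alpha> \<beta> p))\<bar>)"

definition time_interval :: "ereal \<Rightarrow> real set" where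
  "time_interval T = {t. 0 \<le> t \<and> ereal t < T}"

definition F_T :: "ereal \<Rightarrow> ('n::finite) evolution set" where
  "F_T T = {f. \<forall>t\<in>time_interval T. f t \<in> F_xv}"

definition sup_norm :: "ereal \<Rightarrow> real \<Rightarrow> real \<Rightarrow> ('n::finite) evolution \<Rightarrow> ennreal" where
  "sup_norm T \<alpha> \<beta> f = (SUP t\<in>time_interval T. M_norm \<alpha> \<beta> (f t))"

definition Linf_M :: "ereal \<Rightarrow> real \<Rightarrow> real \<Rightarrow> ('n::finite) evolution set" where
  "Linf_M T \<alpha> \<beta> = {f \<in> F_T T. sup_norm T \<alpha> \<beta> f < \<infinity>}"

text \<open>Membership in \<^const>\<open>F_T\<close> says nothing about the dependence on \<open>t\<close>. For the time integrals
  of the transported operators to make sense, functions must be jointly measurable in \<open>(t, x, v)\<close>.\<close>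

definition jointly_measurable :: "ereal \<Rightarrow> ('n::finite) evolution \<Rightarrow> bool" where
  "jointly_measurable T f \<longleftrightarrow>
     (\<lambda>(t, p). f t p) \<in> borel_measurable (lebesgue_on (time_interval T \<times> UNIV))"

definition time_integral :: "real \<Rightarrow> ('n::finite) evolution \<Rightarrow> 'n vec2 \<Rightarrow> ennreal" where
  "time_integral t F p = (\<integral>\<^sup>+ \<tau>\<in>{0..t}. e2ennreal \<bar>F \<tau> p\<bar> \<partial>lborel)"

definition K_const ::
  "('n::finite) itself \<Rightarrow> real \<Rightarrow> real \<Rightarrow> real \<Rightarrow> (real \<Rightarrow> real) \<Rightarrow> (real \<Rightarrow> real \<Rightarrow> real) \<Rightarrow>
    real \<Rightarrow> ennreal" where
  "K_const n C \<gamma>2 \<gamma>3 b2 b3 \<beta> = ennreal C *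
     (b2_norm CARD('n) b2 *
        ennreal (\<beta> powr (- real CARD('n) / 2) + 1 / (real CARD('n) + \<gamma>2 - 1)) +
      b3_norm n b3 *
        ennreal (\<beta> powr (- real CARD('n)) + 1 / (2 * real CARD('n) + \<gamma>3 - 1)))"

end

theory Submission
  imports Defs "HOL-Probability.Distributions"
begin

text \<open>The function \<open>f\<^sup>#\<close> being bounded by a multiple of \<open>M\<^sub>\<alpha>\<^sub>,\<^sub>\<beta>\<close> means that \<open>|f(\<tau>, y, v)|\<close> is bounded by a
  multiple of \<open>M\<^sub>\<alpha>\<^sub>,\<^sub>\<beta>(y - \<tau>v, v)\<close>. In any of the four operators at time \<open>\<tau>\<close> and at the point
  \<open>(y, v) = (x + \<tau>v, v)\<close>, the integrand is therefore at most a multiple of the kernel times a product of such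
  Maxwellians, one per particle. The exponent of that product is a combination of \<open>\<Sum>|v\<^sub>i|\<^sup>2\<close> and \<open>\<Sum>|y - \<tau>v\<^sub>i|\<^sup>2\<close>, which
  depend on the velocities through the total momentum and the total energy only. These are conserved
  in a collision, so gain and loss terms have the same majorant: with \<open>w\<close> the velocities of the
  other particles, \<open>a\<close> the velocity \<open>v\<close> repeated as often, \<open>X\<close> the position \<open>x\<close> repeated as often,
  it is \<open>M\<^sub>\<alpha>\<^sub>,\<^sub>\<beta>(x, v)\<close> times \<open>exp(-\<alpha>|X - \<tau>(w - a)|\<^sup>2 - \<beta>|w|\<^sup>2)\<close>
  (\<open>maxwellian_binary_conserved\<close>, \<open>maxwellian_ternary_conserved\<close>).

  The angular integral of the kernel is at most a constant times the norm of \<open>b\<^sub>2\<close> or \<open>b\<^sub>3\<close> times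
  \<open>|w - a|\<^sup>\<gamma>\<close> (\<open>nn_integral_B2_le\<close>, \<open>nn_integral_B3_le\<close>). The time integral comes next and is where free
  transport helps: \<open>\<tau> \<mapsto> X - \<tau>(w - a)\<close> runs through a line with speed \<open>|w - a|\<close>, so the Gaussian in \<open>\<alpha>\<close>
  integrates to at most \<open>(\<pi>/\<alpha>)\<^sup>1\<^sup>/\<^sup>2 / |w - a|\<close>, uniformly in \<open>X\<close>. What remains is the integral of
  \<open>|w - a|\<^sup>\<gamma>\<^sup>-\<^sup>1 exp(-\<beta>|w|\<^sup>2)\<close> over \<open>w\<close> in dimension \<open>D = d\<close> or \<open>D = 2d\<close>, where \<open>-D < \<gamma> - 1 \<le> 0\<close>. The
  unit ball around \<open>a\<close> contributes a multiple of \<open>1/(D + \<gamma> - 1)\<close> and its complement at most the full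
  Gaussian integral, a multiple of \<open>\<beta>\<^sup>-\<^sup>D\<^sup>/\<^sup>2\<close> (\<open>nn_integral_spacetime_gaussian_le\<close>).

  Three technical points need care. The integrands are only Lebesgue measurable at best, and
  \<^const>\<open>nn_integral\<close> of a non-measurable function is a lower integral; for upper bounds this is
  harmless, since monotonicity and the inequalities in place of homogeneity and Fubini persist. The
  bounds on \<open>f\<close>, \<open>g\<close>, \<open>h\<close> hold only almost everywhere but are used at post-collisional velocities;
  they survive because a collision with a fixed angle is a linear bijection of velocity space
  (\<open>AE_along_collision\<close>). Finally the norm of \<open>b\<^sub>2\<close> is a one-dimensional integral, which is compared
  with the integral over the sphere by slicing the ball along an axis (\<open>nn_integral_ball_direction_le\<close>).\<close>

section \<open>Gaussian and power integrals in Euclidean space\<close>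

lemma nn_integral_gaussian:
  fixes a c :: real
  assumes "0 < a"
  shows "(\<integral>\<^sup>+ s. ennreal (exp (- a * (s - c)\<^sup>2)) \<partial>lborel) = ennreal (sqrt (pi / a))"
proof -
  define \<sigma> where "\<sigma> = sqrt (1 / (2 * a))"
  have s: "0 < \<sigma>" "2 * \<sigma>\<^sup>2 = 1 / a" using assms by (auto simp: \<sigma>_def)
  interpret N: prob_space "density lborel (normal_density c \<sigma>)"
    using s by (intro prob_space_normal_density) auto
  have "(\<integral>\<^sup>+ s. ennreal (normal_density c \<sigma> s) \<partial>lborel) = 1"
    using N.emeasure_space_1 by (simp add: emeasure_density)
  moreover have "exp (- a * (s - c)\<^sup>2) = sqrt (pi / a) * normal_density c \<sigma> s" for s
  proof -
    have "2 * pi * \<sigma>\<^sup>2 = pi / a" using s(2) by (metis mult.assoc mult.commute times_divide_eq_right mult.right_neutral)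
    moreover have "(s - c)\<^sup>2 / (2 * \<sigma>\<^sup>2) = a * (s - c)\<^sup>2" using s(2) by simp
    ultimately show ?thesis using assms
      by (simp add: normal_density_def)
  qed
  ultimately show ?thesis
    using assms by (simp add: ennreal_mult nn_integral_cmult)
qed

lemma nn_integral_gaussian_euclidean:
  assumes "0 < \<beta>"
  shows "(\<integral>\<^sup>+ w. ennreal (exp (- \<beta> * (norm w)\<^sup>2)) \<partial>(lborel :: 'w::euclidean_space measure))
    = ennreal (sqrt pi ^ DIM('w) * \<beta> powr (- real DIM('w) / 2))"
proof -
  have "(norm w)\<^sup>2 = (\<Sum>b\<in>Basis. (w \<bullet> b)\<^sup>2)" for w :: 'w
    unfolding power2_norm_eq_inner by (subst euclidean_inner) (simp add: power2_eq_square)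
  then have "ennreal (exp (- \<beta> * (norm w)\<^sup>2)) = (\<Prod>b\<in>Basis. ennreal (exp (- \<beta> * (w \<bullet> b - 0)\<^sup>2)))"
    for w :: 'w
    by (simp add: sum_distrib_left exp_sum prod_ennreal flip: sum_negf)
  then have "(\<integral>\<^sup>+ w. ennreal (exp (- \<beta> * (norm w)\<^sup>2)) \<partial>(lborel :: 'w measure))
    = (\<Prod>b\<in>(Basis :: 'w set). \<integral>\<^sup>+ s. ennreal (exp (- \<beta> * (s - 0)\<^sup>2)) \<partial>lborel)"
    by (simp only:) (rule nn_integral_lborel_prod; simp)
  also have "\<dots> = ennreal (sqrt (pi / \<beta>) ^ DIM('w))"
    using assms by (subst nn_integral_gaussian) (auto simp: prod_constant ennreal_power)
  also have "sqrt (pi / \<beta>) = sqrt pi * \<beta> powr (- (1 / 2))"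
  proof -
    have "\<beta> powr (- (1 / 2)) = inverse (sqrt \<beta>)"
      using assms by (metis powr_minus powr_half_sqrt less_imp_le)
    then show ?thesis by (metis real_sqrt_divide divide_inverse)
  qed
  also have "(sqrt pi * \<beta> powr (- (1 / 2))) ^ DIM('w)
      = sqrt pi ^ DIM('w) * (\<beta> powr (- (1 / 2))) ^ DIM('w)"
    by (rule power_mult_distrib)
  also have "(\<beta> powr (- (1 / 2))) ^ DIM('w) = \<beta> powr (- real DIM('w) / 2)"
    using assms by (subst powr_realpow[symmetric], simp, subst powr_powr) simp
  finally show ?thesis .
qed

text \<open>Instead of polar coordinates, a power of the radius is dominated by an average over radii \<open>q\<close>
  comparable to it; after exchanging the integrals only volumes of balls are needed. On \<open>{r..2r}\<close>
  the integrand is at least its value at \<open>2r\<close>, and the interval has length \<open>r\<close>, whence the constant.\<close>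

lemma powr_le_nn_integral_dyadic:
  fixes s r :: real
  assumes "0 \<le> r" "s \<le> 0"
  shows "ennreal (r powr s) \<le> ennreal (2 powr (1 - s)) *
    (\<integral>\<^sup>+ q. ennreal (q powr (s - 1)) * indicator {r..2 * r} q \<partial>lborel)"
proof (cases "r = 0")
  case False
  then have r: "0 < r" using assms by simp
  have "r powr s = 2 powr (1 - s) * ((2 * r) powr (s - 1) * r)"
    using r by (simp add: powr_mult powr_diff)
  then have "ennreal (r powr s) = ennreal (2 powr (1 - s)) * (ennreal ((2 * r) powr (s - 1)) * emeasure lborel {r..2 * r})"
    using r by (simp add: ennreal_mult)
  also have "ennreal ((2 * r) powr (s - 1)) * emeasure lborel {r..2 * r}
     = (\<integral>\<^sup>+ q. ennreal ((2 * r) powr (s - 1)) * indicator {r..2 * r} q \<partial>lborel)"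
    by (simp add: nn_integral_cmult_indicator)
  also have "\<dots> \<le> (\<integral>\<^sup>+ q. ennreal (q powr (s - 1)) * indicator {r..2 * r} q \<partial>lborel)"
    using r assms
    by (intro nn_integral_mono) (auto split: split_indicator intro!: ennreal_leI powr_mono2')
  finally show ?thesis by (simp add: mult_left_mono)
qed simp

lemma nn_integral_powr_from_0:
  fixes a c :: real
  assumes "- 1 < a" "0 \<le> c"
  shows "(\<integral>\<^sup>+ q. ennreal (q powr a) * indicator {0..c} q \<partial>lborel) = ennreal (c powr (a + 1) / (a + 1))"
proof -
  have "((\<lambda>q. if q \<in> {0..c} then q powr a else 0) has_integral (c powr (a + 1) / (a + 1))) UNIV"
    using has_integral_powr_from_0[OF assms] by (subst has_integral_restrict_UNIV)
  then have "((\<lambda>q. q powr a * indicator {0..c} q) has_integral (c powr (a + 1) / (a + 1))) UNIV"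
    by (rule has_integral_eq[rotated]) (auto simp: indicator_def)
  then have "(\<integral>\<^sup>+ q. ennreal (q powr a * indicator {0..c} q) \<partial>lborel) = ennreal (c powr (a + 1) / (a + 1))"
    by (intro nn_integral_has_integral_lborel) auto
  then show ?thesis
    by (simp add: ennreal_mult ennreal_indicator)
qed

text \<open>Exchanging the integral over \<open>u\<close> with that over the radius \<open>q\<close> leaves the integral over \<open>q \<in> {0..2}\<close> of
  \<open>q\<^sup>s\<^sup>-\<^sup>1\<close> times the volume of a ball of radius \<open>q\<close>, that is, of a multiple of \<open>q\<^sup>D\<^sup>+\<^sup>s\<^sup>-\<^sup>1\<close>.\<close>

lemma nn_integral_norm_powr_unit_cball:
  assumes "- real DIM('w) < s" "s \<le> 0"
  shows "(\<integral>\<^sup>+ u. ennreal (norm u powr s) * indicator (cball 0 1) u \<partial>(lborel :: 'w::euclidean_space measure))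
    \<le> ennreal (2 powr (1 + 2 * real DIM('w)) * unit_ball_vol (real DIM('w)) / (real DIM('w) + s))"
proof -
  define D where "D = real DIM('w)"
  define V where "V = unit_ball_vol D"
  have D: "0 < D + s" "0 \<le> D" "0 \<le> V" using assms by (auto simp: D_def V_def)
  let ?c = "ennreal (2 powr (1 - s))"
  have "(\<integral>\<^sup>+ u. ennreal (norm u powr s) * indicator (cball 0 1) u \<partial>(lborel :: 'w measure))
    \<le> (\<integral>\<^sup>+ u. ?c * (\<integral>\<^sup>+ q. ennreal (q powr (s - 1)) * indicator {norm u..2 * norm u} q \<partial>lborel)
         * indicator (cball 0 1) u \<partial>(lborel :: 'w measure))"
    using assms by (intro nn_integral_mono mult_right_mono powr_le_nn_integral_dyadic) auto
  also have "\<dots> \<le> (\<integral>\<^sup>+ u. ?c * (\<integral>\<^sup>+ q. ennreal (q powr (s - 1)) * indicator {0..2} q * indicator (cball 0 q) u \<partial>lborel)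
         \<partial>(lborel :: 'w measure))"
    by (intro nn_integral_mono) (auto split: split_indicator intro!: mult_left_mono nn_integral_mono)
  also have "\<dots> = ?c * (\<integral>\<^sup>+ u. (\<integral>\<^sup>+ q. ennreal (q powr (s - 1)) * indicator {0..2} q * indicator {p. norm (snd p) \<le> fst p} (q, u) \<partial>lborel)
         \<partial>(lborel :: 'w measure))"
    by (subst nn_integral_cmult[symmetric]) (auto simp: indicator_def)
  also have "\<dots> = ?c * (\<integral>\<^sup>+ q. (\<integral>\<^sup>+ u. ennreal (q powr (s - 1)) * indicator {0..2} q * indicator {p. norm (snd p) \<le> fst p} (q, u) \<partial>(lborel :: 'w measure))
         \<partial>lborel)"
    by (subst lborel_pair.Fubini') auto
  also have "\<dots> = ?c * (\<integral>\<^sup>+ q. ennreal (q powr (s - 1)) * indicator {0..2} q * emeasure lborel (cball (0::'w) q) \<partial>lborel)"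
  proof -
    have "indicator {p. norm (snd p) \<le> fst p} (q, u) = (indicator (cball 0 q) u :: ennreal)" for q and u :: 'w
      by (auto simp: indicator_def)
    then show ?thesis by (simp add: nn_integral_cmult_indicator)
  qed
  also have "\<dots> = ?c * (\<integral>\<^sup>+ q. ennreal V * (ennreal (q powr (D + s - 1)) * indicator {0..2} q) \<partial>lborel)"
  proof -
    have "ennreal (q powr (s - 1)) * indicator {0..2} q * emeasure lborel (cball (0::'w) q)
      = ennreal V * (ennreal (q powr (D + s - 1)) * indicator {0..2} q)" for q
    proof (cases "0 < q \<and> q \<le> 2")
      case True
      then have "q powr (D + s - 1) = q powr (s - 1) * q ^ DIM('w)"
        unfolding D_def by (subst powr_realpow[symmetric], simp, subst powr_add[symmetric]) (simp add: algebra_simps)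
      then show ?thesis using True D
        by (simp add: emeasure_cball V_def D_def ennreal_mult' mult_ac)
    next
      case False
      then show ?thesis by (cases "q = 0") (auto simp: indicator_def)
    qed
    then show ?thesis by simp
  qed
  also have "\<dots> = ?c * (ennreal V * ennreal (2 powr (D + s) / (D + s)))"
    using D by (simp add: nn_integral_cmult nn_integral_powr_from_0)
  also have "\<dots> = ennreal (2 powr (1 + D) * V / (D + s))"
  proof -
    have "2 powr (1 - s) * (V * (2 powr (D + s) / (D + s))) = (2 powr (1 - s) * 2 powr (D + s)) * V / (D + s)"
      by simp
    also have "2 powr (1 - s) * 2 powr (D + s) = 2 powr (1 + D)"
      by (subst powr_add[symmetric]) simp
    finally show ?thesis
      using D by (simp add: ennreal_mult[symmetric])
  qed
  also have "\<dots> \<le> ennreal (2 powr (1 + 2 * D) * V / (D + s))"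
    using D by (intro ennreal_leI divide_right_mono mult_right_mono powr_mono) auto
  finally show ?thesis by (simp add: D_def V_def)
qed

lemma nn_integral_lborel_shift:
  fixes a :: "'w::euclidean_space"
  assumes [measurable]: "f \<in> borel_measurable borel"
  shows "(\<integral>\<^sup>+ w. f (w - a) \<partial>lborel) = (\<integral>\<^sup>+ w. f w \<partial>lborel)"
proof -
  have "(\<integral>\<^sup>+ w. f w \<partial>lborel) = (\<integral>\<^sup>+ w. f w \<partial>distr lborel borel ((+) (- a)))"
    by (simp add: lborel_distr_plus)
  also have "\<dots> = (\<integral>\<^sup>+ w. f (- a + w) \<partial>lborel)"
    by (rule nn_integral_distr) auto
  finally show ?thesis by simp
qed

text \<open>Inside the unit ball around \<open>a\<close> the Gaussian is at most \<open>1\<close>; outside, the power is at most \<open>1\<close>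
  because its exponent is not positive.\<close>

lemma nn_integral_gaussian_norm_powr_le:
  "\<exists>C>0. \<forall>s \<beta>. \<forall>a :: 'w::euclidean_space. - real DIM('w) < s \<longrightarrow> s \<le> 0 \<longrightarrow> 0 < \<beta> \<longrightarrow>
     (\<integral>\<^sup>+ w. ennreal (norm (w - a) powr s * exp (- \<beta> * (norm w)\<^sup>2)) \<partial>lborel)
       \<le> ennreal (C * (\<beta> powr (- real DIM('w) / 2) + 1 / (real DIM('w) + s)))"
proof -
  define D where "D = real DIM('w)"
  define C where "C = sqrt pi ^ DIM('w) + 2 powr (1 + 2 * D) * unit_ball_vol D"
  have V: "0 \<le> unit_ball_vol D" by (simp add: D_def)
  show ?thesis
  proof (intro exI[of _ C] conjI allI impI)
    show "0 < C" using V by (auto simp: C_def intro!: add_pos_nonneg)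
    fix s \<beta> :: real and a :: 'w
    assume s: "- real DIM('w) < s" "s \<le> 0" and \<beta>: "0 < \<beta>"
    have "norm (w - a) powr s * exp (- \<beta> * (norm w)\<^sup>2)
        \<le> norm (w - a) powr s * indicator (cball 0 1) (w - a) + exp (- \<beta> * (norm w)\<^sup>2)" for w :: 'w
    proof (cases "norm (w - a) \<le> 1")
      case True
      have "norm (w - a) powr s * exp (- \<beta> * (norm w)\<^sup>2) \<le> norm (w - a) powr s * 1"
        using \<beta> by (intro mult_left_mono) auto
      then show ?thesis using True by (simp add: indicator_def add_increasing2)
    next
      case False
      then have "norm (w - a) powr s \<le> 1"
        using s powr_mono2'[of s 1 "norm (w - a)"] by simp
      then have "norm (w - a) powr s * exp (- \<beta> * (norm w)\<^sup>2) \<le> 1 * exp (- \<beta> * (norm w)\<^sup>2)"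
        by (intro mult_right_mono) auto
      then show ?thesis using False by (simp add: indicator_def)
    qed
    then have "(\<integral>\<^sup>+ w. ennreal (norm (w - a) powr s * exp (- \<beta> * (norm w)\<^sup>2)) \<partial>lborel)
      \<le> (\<integral>\<^sup>+ w. ennreal (norm (w - a) powr s) * indicator (cball 0 1) (w - a)
            + ennreal (exp (- \<beta> * (norm w)\<^sup>2)) \<partial>lborel)"
      by (intro nn_integral_mono)
        (simp add: ennreal_indicator[symmetric] ennreal_mult[symmetric] ennreal_plus[symmetric] ennreal_leI
          del: ennreal_plus)
    also have "\<dots> = (\<integral>\<^sup>+ w. ennreal (norm (w - a) powr s) * indicator (cball 0 1) (w - a) \<partial>lborel)
        + (\<integral>\<^sup>+ w. ennreal (exp (- \<beta> * (norm w)\<^sup>2)) \<partial>(lborel :: 'w measure))"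
    proof (rule nn_integral_add)
      have "(\<lambda>w. indicator (cball 0 1) (w - a) :: ennreal) \<in> borel_measurable lborel"
        by (rule measurable_compose[where N = borel and f = "\<lambda>w. w - a"]) (auto intro!: borel_measurable_indicator)
      then show "(\<lambda>w. ennreal (norm (w - a) powr s) * indicator (cball 0 1) (w - a)) \<in> borel_measurable lborel"
        by (intro borel_measurable_times_ennreal) auto
    qed auto
    also have "(\<integral>\<^sup>+ w. ennreal (norm (w - a) powr s) * indicator (cball 0 1) (w - a) \<partial>lborel)
        = (\<integral>\<^sup>+ w. ennreal (norm w powr s) * indicator (cball 0 1) w \<partial>(lborel :: 'w measure))"
      by (rule nn_integral_lborel_shift, intro borel_measurable_times_ennreal borel_measurable_indicator) auto
    also have "\<dots> \<le> ennreal (2 powr (1 + 2 * D) * unit_ball_vol D / (D + s))"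
      using nn_integral_norm_powr_unit_cball[OF s] by (simp add: D_def)
    also note nn_integral_gaussian_euclidean[OF \<beta>, where 'w = 'w]
    also have "ennreal (2 powr (1 + 2 * D) * unit_ball_vol D / (D + s))
        + ennreal (sqrt pi ^ DIM('w) * \<beta> powr (- real DIM('w) / 2))
      = ennreal (2 powr (1 + 2 * D) * unit_ball_vol D / (D + s)
        + sqrt pi ^ DIM('w) * \<beta> powr (- real DIM('w) / 2))"
      using s V by (intro ennreal_plus[symmetric]) (auto simp: D_def)
    also have "\<dots> \<le> ennreal (C * (\<beta> powr (- real DIM('w) / 2) + 1 / (real DIM('w) + s)))"
    proof (rule ennreal_leI)
      let ?p = "\<beta> powr (- real DIM('w) / 2)" and ?q = "1 / (real DIM('w) + s)"
        and ?A = "sqrt pi ^ DIM('w)" and ?B = "2 powr (1 + 2 * D) * unit_ball_vol D"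
      have "0 \<le> ?A * ?q" "0 \<le> ?B * ?p" using s V by auto
      then have "?B * ?q + ?A * ?p \<le> C * (?p + ?q)"
        unfolding C_def by (simp only: distrib_left distrib_right)
      then show "?B / (D + s) + ?A * ?p \<le> C * (?p + ?q)" by (simp add: D_def)
    qed
    finally show "(\<integral>\<^sup>+ w. ennreal (norm (w - a) powr s * exp (- \<beta> * (norm w)\<^sup>2)) \<partial>lborel)
       \<le> ennreal (C * (\<beta> powr (- real DIM('w) / 2) + 1 / (real DIM('w) + s)))"
      by (simp add: add_right_mono)
  qed
qed

text \<open>By Cauchy--Schwarz, \<open>|X - \<tau>u|\<close> is at least \<open>|u|\<close> times the distance of \<open>\<tau>\<close> to the time \<open>c\<close> of closest
  approach to the origin, so the position \<open>X\<close> can only help.\<close>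

lemma nn_integral_gaussian_line_le:
  fixes X u :: "'w::euclidean_space"
  assumes "0 < \<alpha>" "u \<noteq> 0"
  shows "(\<integral>\<^sup>+ \<tau>. ennreal (exp (- \<alpha> * (norm (X - \<tau> *\<^sub>R u))\<^sup>2)) \<partial>lborel)
    \<le> ennreal (sqrt pi * \<alpha> powr (- 1 / 2) / norm u)"
proof -
  define c where "c = (X \<bullet> u) / (norm u)\<^sup>2"
  have le: "(norm u)\<^sup>2 * (\<tau> - c)\<^sup>2 \<le> (norm (X - \<tau> *\<^sub>R u))\<^sup>2" for \<tau>
  proof -
    have "(X \<bullet> u)\<^sup>2 \<le> (norm X)\<^sup>2 * (norm u)\<^sup>2"
      using Cauchy_Schwarz_ineq[of X u] by (simp add: power2_norm_eq_inner)
    then have "(X \<bullet> u)\<^sup>2 / (norm u)\<^sup>2 \<le> (norm X)\<^sup>2"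
      using assms by (simp add: divide_le_eq)
    moreover have "(norm (X - \<tau> *\<^sub>R u))\<^sup>2 = (norm X)\<^sup>2 - 2 * \<tau> * (X \<bullet> u) + \<tau>\<^sup>2 * (norm u)\<^sup>2"
      unfolding power2_norm_eq_inner by (simp add: inner_commute power2_eq_square algebra_simps)
    moreover have "(norm u)\<^sup>2 * (\<tau> - c)\<^sup>2 = (X \<bullet> u)\<^sup>2 / (norm u)\<^sup>2 - 2 * \<tau> * (X \<bullet> u) + \<tau>\<^sup>2 * (norm u)\<^sup>2"
      using assms unfolding c_def by (simp add: field_simps power2_eq_square)
    ultimately show ?thesis by simp
  qed
  have "(\<integral>\<^sup>+ \<tau>. ennreal (exp (- \<alpha> * (norm (X - \<tau> *\<^sub>R u))\<^sup>2)) \<partial>lborel)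
    \<le> (\<integral>\<^sup>+ \<tau>. ennreal (exp (- (\<alpha> * (norm u)\<^sup>2) * (\<tau> - c)\<^sup>2)) \<partial>lborel)"
    using le assms by (intro nn_integral_mono ennreal_leI) (simp add: mult.assoc)
  also have "\<dots> = ennreal (sqrt (pi / (\<alpha> * (norm u)\<^sup>2)))"
    using assms by (intro nn_integral_gaussian) auto
  also have "sqrt (pi / (\<alpha> * (norm u)\<^sup>2)) = sqrt pi * \<alpha> powr (- 1 / 2) / norm u"
  proof -
    have "\<alpha> powr (- 1 / 2) = inverse (sqrt \<alpha>)"
      using assms powr_minus[of \<alpha> "1 / 2"] powr_half_sqrt[of \<alpha>] by simp
    moreover have "sqrt (pi / (\<alpha> * (norm u)\<^sup>2)) = sqrt pi * inverse (sqrt \<alpha>) / norm u"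
      by (simp add: real_sqrt_divide real_sqrt_mult inverse_eq_divide)
    ultimately show ?thesis by (simp only:)
  qed
  finally show ?thesis .
qed


text \<open>The dispersive estimate: integrating over time first costs one power of the relative velocity
  \<open>w - a\<close> and gains the factor \<open>\<alpha>\<^sup>-\<^sup>1\<^sup>/\<^sup>2\<close>. Uniformity in
  \<open>X\<close> and \<open>a\<close> allows its use at every phase point.\<close>

lemma nn_integral_spacetime_gaussian_le:
  "\<exists>C>0. \<forall>\<alpha> \<beta> \<gamma>. \<forall>X a :: 'w::euclidean_space. 0 < \<alpha> \<longrightarrow> 0 < \<beta> \<longrightarrow> - real DIM('w) + 1 < \<gamma> \<longrightarrow> \<gamma> \<le> 1 \<longrightarrow>
     (\<integral>\<^sup>+ \<tau>. \<integral>\<^sup>+ w. ennreal (norm (w - a) powr \<gamma> *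
         exp (- \<alpha> * (norm (X - \<tau> *\<^sub>R (w - a)))\<^sup>2 - \<beta> * (norm w)\<^sup>2)) \<partial>lborel \<partial>lborel)
     \<le> ennreal C * ennreal (\<beta> powr (- real DIM('w) / 2) + 1 / (real DIM('w) + \<gamma> - 1))
        * ennreal (\<alpha> powr (- 1 / 2))"
proof -
  obtain C where C: "0 < C" and bound: "\<And>s \<beta> (a :: 'w). - real DIM('w) < s \<Longrightarrow> s \<le> 0 \<Longrightarrow> 0 < \<beta> \<Longrightarrow>
     (\<integral>\<^sup>+ w. ennreal (norm (w - a) powr s * exp (- \<beta> * (norm w)\<^sup>2)) \<partial>lborel)
       \<le> ennreal (C * (\<beta> powr (- real DIM('w) / 2) + 1 / (real DIM('w) + s)))"
    using nn_integral_gaussian_norm_powr_le[where 'w = 'w] by blast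
  show ?thesis
  proof (intro exI[of _ "sqrt pi * C"] conjI allI impI)
    show "0 < sqrt pi * C" using C by simp
    fix \<alpha> \<beta> \<gamma> :: real and X a :: 'w
    assume \<alpha>: "0 < \<alpha>" and \<beta>: "0 < \<beta>" and \<gamma>: "- real DIM('w) + 1 < \<gamma>" "\<gamma> \<le> 1"
    let ?g = "\<lambda>w. norm (w - a) powr \<gamma> * exp (- \<beta> * (norm w)\<^sup>2)"
    let ?e = "\<lambda>\<tau> w. exp (- \<alpha> * (norm (X - \<tau> *\<^sub>R (w - a)))\<^sup>2)"
    let ?k = "sqrt pi * \<alpha> powr (- 1 / 2)"
    have "(\<integral>\<^sup>+ \<tau>. \<integral>\<^sup>+ w. ennreal (norm (w - a) powr \<gamma> *
         exp (- \<alpha> * (norm (X - \<tau> *\<^sub>R (w - a)))\<^sup>2 - \<beta> * (norm w)\<^sup>2)) \<partial>lborel \<partial>lborel)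
      = (\<integral>\<^sup>+ \<tau>. \<integral>\<^sup>+ w. ennreal (?g w) * ennreal (?e \<tau> w) \<partial>lborel \<partial>lborel)"
      by (intro nn_integral_cong) (simp add: ennreal_mult[symmetric] exp_diff exp_minus divide_inverse mult_ac)
    also have "\<dots> = (\<integral>\<^sup>+ w. \<integral>\<^sup>+ \<tau>. ennreal (?g w) * ennreal (?e \<tau> w) \<partial>lborel \<partial>lborel)"
      by (rule lborel_pair.Fubini') measurable
    also have "\<dots> \<le> (\<integral>\<^sup>+ w. ennreal ?k * ennreal (norm (w - a) powr (\<gamma> - 1) * exp (- \<beta> * (norm w)\<^sup>2)) \<partial>lborel)"
    proof (rule nn_integral_mono)
      fix w
      show "(\<integral>\<^sup>+ \<tau>. ennreal (?g w) * ennreal (?e \<tau> w) \<partial>lborel)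
        \<le> ennreal ?k * ennreal (norm (w - a) powr (\<gamma> - 1) * exp (- \<beta> * (norm w)\<^sup>2))"
      \<comment> \<open>For \<open>w = a\<close> both sides vanish, as \<open>0 powr \<gamma> = 0\<close>.\<close>
      proof (cases "w = a")
        case False
        have "(\<integral>\<^sup>+ \<tau>. ennreal (?g w) * ennreal (?e \<tau> w) \<partial>lborel)
          = ennreal (?g w) * (\<integral>\<^sup>+ \<tau>. ennreal (?e \<tau> w) \<partial>lborel)"
          by (rule nn_integral_cmult) measurable
        also have "\<dots> \<le> ennreal (?g w) * ennreal (?k / norm (w - a))"
          using \<alpha> False by (intro mult_left_mono nn_integral_gaussian_line_le) auto
        also have "\<dots> = ennreal (?g w * (?k / norm (w - a)))"
          by (rule ennreal_mult[symmetric]) auto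
        also have "?g w * (?k / norm (w - a)) = ?k * (norm (w - a) powr (\<gamma> - 1) * exp (- \<beta> * (norm w)\<^sup>2))"
          using False by (simp add: powr_diff)
        finally show ?thesis by (simp add: ennreal_mult)
      qed simp
    qed
    also have "\<dots> = ennreal ?k * (\<integral>\<^sup>+ w. ennreal (norm (w - a) powr (\<gamma> - 1) * exp (- \<beta> * (norm w)\<^sup>2)) \<partial>lborel)"
      by (rule nn_integral_cmult) measurable
    also have "\<dots> \<le> ennreal ?k * ennreal (C * (\<beta> powr (- real DIM('w) / 2) + 1 / (real DIM('w) + (\<gamma> - 1))))"
      using \<gamma> \<beta> by (intro mult_left_mono bound) auto
    also have "\<dots> = ennreal (sqrt pi * C) * ennreal (\<beta> powr (- real DIM('w) / 2) + 1 / (real DIM('w) + \<gamma> - 1))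
        * ennreal (\<alpha> powr (- 1 / 2))"
      using \<gamma> C by (simp add: ennreal_mult[symmetric] algebra_simps)
    finally show "(\<integral>\<^sup>+ \<tau>. \<integral>\<^sup>+ w. ennreal (norm (w - a) powr \<gamma> *
         exp (- \<alpha> * (norm (X - \<tau> *\<^sub>R (w - a)))\<^sup>2 - \<beta> * (norm w)\<^sup>2)) \<partial>lborel \<partial>lborel)
     \<le> ennreal (sqrt pi * C) * ennreal (\<beta> powr (- real DIM('w) / 2) + 1 / (real DIM('w) + \<gamma> - 1))
        * ennreal (\<alpha> powr (- 1 / 2))" .
  qed
qed

section \<open>Upper bounds for lower integrals\<close>

text \<open>At an arbitrary function, \<^const>\<open>nn_integral\<close> is the supremum of the integrals of its measurable
  minorants. Bounding one minorant at a time turns the rules for measurable functions into upper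
  bounds that hold in general, although the corresponding equations fail.\<close>

lemma nn_integral_le_if_measurable_minorants_le:
  assumes "\<And>g. g \<in> borel_measurable M \<Longrightarrow> (\<And>x. g x \<le> F x) \<Longrightarrow> integral\<^sup>N M g \<le> K"
  shows "integral\<^sup>N M F \<le> K"
  unfolding nn_integral_def[of M F]
proof (rule SUP_least, clarify)
  fix g assume g: "simple_function M g" "g \<le> F"
  then have "integral\<^sup>N M g \<le> K"
    by (intro assms borel_measurable_simple_function) (auto simp: le_fun_def)
  then show "integral\<^sup>S M g \<le> K"
    using g by (simp add: nn_integral_eq_simple_integral)
qed

lemma nn_integral_cmult_le:
  fixes c :: ennreal
  assumes "c < top"
  shows "(\<integral>\<^sup>+ x. c * F x \<partial>M) \<le> c * integral\<^sup>N M F"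
proof (cases "c = 0")
  case False
  have c: "inverse c * c = 1" using assms False
    by (metis ennreal_inverse_mult mult.commute ennreal_divide_self divide_ennreal_def top.not_eq_extremum)
  show ?thesis
  proof (rule nn_integral_le_if_measurable_minorants_le)
    fix g assume g[measurable]: "g \<in> borel_measurable M" and le: "\<And>x. g x \<le> c * F x"
    have "inverse c * g x \<le> F x" for x
      using mult_left_mono[OF le[of x], of "inverse c"] c by (simp flip: mult.assoc)
    then have "(\<integral>\<^sup>+ x. inverse c * g x \<partial>M) \<le> integral\<^sup>N M F"
      by (intro nn_integral_mono) auto
    then have "c * (inverse c * integral\<^sup>N M g) \<le> c * integral\<^sup>N M F"
      by (intro mult_left_mono) (auto simp: nn_integral_cmult)
    then show "integral\<^sup>N M g \<le> c * integral\<^sup>N M F"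
      using c by (metis mult.assoc mult.commute mult.left_neutral)
  qed
qed simp

lemma (in pair_sigma_finite) nn_integral_pair_le_iterated:
  "(\<integral>\<^sup>+ z. F z \<partial>(M1 \<Otimes>\<^sub>M M2)) \<le> (\<integral>\<^sup>+ y. \<integral>\<^sup>+ x. F (x, y) \<partial>M1 \<partial>M2)"
proof (rule nn_integral_le_if_measurable_minorants_le)
  fix g assume g: "g \<in> borel_measurable (M1 \<Otimes>\<^sub>M M2)" and le: "\<And>z. g z \<le> F z"
  show "integral\<^sup>N (M1 \<Otimes>\<^sub>M M2) g \<le> (\<integral>\<^sup>+ y. \<integral>\<^sup>+ x. F (x, y) \<partial>M1 \<partial>M2)"
    unfolding nn_integral_snd[OF g, symmetric] using le by (intro nn_integral_mono)
qed

lemma e2ennreal_abs_ereal_integral_le: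
  assumes "AE z in M. e2ennreal \<bar>F z\<bar> \<le> G z"
  shows "e2ennreal \<bar>ereal_integral M F\<bar> \<le> integral\<^sup>N M G"
proof -
  define K where "K = integral\<^sup>N M G"
  define a where "a = (\<integral>\<^sup>+ x. e2ennreal (F x) \<partial>M)"
  define b where "b = (\<integral>\<^sup>+ x. e2ennreal (- F x) \<partial>M)"
  have "e2ennreal (F z) \<le> e2ennreal \<bar>F z\<bar>" "e2ennreal (- F z) \<le> e2ennreal \<bar>F z\<bar>" for z
    by (intro e2ennreal_mono; cases "F z"; simp)+
  then have ab: "a \<le> K" "b \<le> K"
    unfolding a_def b_def K_def using assms
    by (auto intro!: nn_integral_mono_AE elim!: eventually_mono intro: order_trans)
  have "e2ennreal \<bar>enn2ereal a - enn2ereal b\<bar> \<le> K"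
  proof (cases "K = top")
    case False
    with ab have "a < top" "b < top" by (auto simp: top.not_eq_extremum intro: le_less_trans)
    then obtain x y where xy: "a = ennreal x" "b = ennreal y" "0 \<le> x" "0 \<le> y"
      by (metis ennreal_cases less_irrefl)
    from False obtain k where k: "K = ennreal k" "0 \<le> k" by (metis ennreal_cases)
    show ?thesis using ab xy k by (auto simp: enn2ereal_ennreal abs_real_def intro!: ennreal_leI)
  qed simp
  then show ?thesis by (simp add: ereal_integral_def a_def b_def K_def)
qed

text \<open>The common shape of all collision operators: \<open>k u \<omega>\<close> is the kernel at relative velocity
  \<open>u = w - a\<close>, and the remaining factors are bounded by a function \<open>\<Gamma>\<close> of \<open>w\<close> that does not involve the
  angle, so that the kernel can be integrated over the angle separately.\<close>

lemma collision_integral_le: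
  fixes S :: "'o measure" and k :: "'w::euclidean_space \<Rightarrow> 'o \<Rightarrow> ennreal"
  assumes S: "sigma_finite_measure S"
    and kernel: "\<And>u. (\<integral>\<^sup>+ \<omega>. k u \<omega> \<partial>S) \<le> \<kappa> * ennreal (norm u powr \<gamma>)"
    and F: "AE z in S \<Otimes>\<^sub>M lborel. e2ennreal \<bar>F z\<bar> \<le> \<Lambda> * ennreal (\<Gamma> (snd z)) * k (snd z - a) (fst z)"
    and \<Gamma>[measurable]: "\<Gamma> \<in> borel_measurable borel" and \<Gamma>_nonneg: "\<And>w. 0 \<le> \<Gamma> w" and \<Lambda>: "\<Lambda> < top"
  shows "e2ennreal \<bar>ereal_integral (S \<Otimes>\<^sub>M lborel) F\<bar>
    \<le> \<kappa> * \<Lambda> * (\<integral>\<^sup>+ w. ennreal (norm (w - a) powr \<gamma> * \<Gamma> w) \<partial>lborel)"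
proof -
  interpret S: sigma_finite_measure S by (rule S)
  interpret P: pair_sigma_finite S "lborel :: 'w measure" ..
  have "e2ennreal \<bar>ereal_integral (S \<Otimes>\<^sub>M lborel) F\<bar>
    \<le> (\<integral>\<^sup>+ z. \<Lambda> * ennreal (\<Gamma> (snd z)) * k (snd z - a) (fst z) \<partial>(S \<Otimes>\<^sub>M lborel))"
    by (rule e2ennreal_abs_ereal_integral_le) (rule F)
  also have "\<dots> \<le> (\<integral>\<^sup>+ w. \<integral>\<^sup>+ \<omega>. \<Lambda> * ennreal (\<Gamma> w) * k (w - a) \<omega> \<partial>S \<partial>lborel)"
    by (rule order_trans[OF P.nn_integral_pair_le_iterated]) simp
  also have "\<dots> \<le> (\<integral>\<^sup>+ w. \<Lambda> * ennreal (\<Gamma> w) * (\<kappa> * ennreal (norm (w - a) powr \<gamma>)) \<partial>lborel)"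
  proof (rule nn_integral_mono)
    fix w
    have "(\<integral>\<^sup>+ \<omega>. \<Lambda> * ennreal (\<Gamma> w) * k (w - a) \<omega> \<partial>S) \<le> \<Lambda> * ennreal (\<Gamma> w) * (\<integral>\<^sup>+ \<omega>. k (w - a) \<omega> \<partial>S)"
      using \<Lambda> by (intro nn_integral_cmult_le) (auto simp: ennreal_mult_less_top)
    also have "\<dots> \<le> \<Lambda> * ennreal (\<Gamma> w) * (\<kappa> * ennreal (norm (w - a) powr \<gamma>))"
      by (intro mult_left_mono kernel) auto
    finally show "(\<integral>\<^sup>+ \<omega>. \<Lambda> * ennreal (\<Gamma> w) * k (w - a) \<omega> \<partial>S) \<le> \<dots>" .
  qed
  also have "\<dots> = (\<integral>\<^sup>+ w. \<kappa> * \<Lambda> * ennreal (norm (w - a) powr \<gamma> * \<Gamma> w) \<partial>lborel)"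
    using \<Gamma>_nonneg by (intro nn_integral_cong) (simp add: ennreal_mult mult_ac)
  also have "\<dots> = \<kappa> * \<Lambda> * (\<integral>\<^sup>+ w. ennreal (norm (w - a) powr \<gamma> * \<Gamma> w) \<partial>lborel)"
    by (rule nn_integral_cmult) measurable
  finally show ?thesis .
qed

section \<open>The surface measure on the sphere\<close>

lemma space_sphere_measure [simp]: "space sphere_measure = sphere 0 1"
  by (simp add: sphere_measure_def space_scale_measure space_restrict_space)

lemma measurable_normalize_sphere:
  "(\<lambda>x. x /\<^sub>R norm x) \<in> restrict_space lborel (ball 0 1 - {0}) \<rightarrow>\<^sub>M restrict_space borel (sphere (0::'a::euclidean_space) 1)"
  by (intro measurable_restrict_space1 measurable_restrict_space2) (auto simp: space_restrict_space intro!: measurable_restrict_space1)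

lemma sets_sphere_measure [measurable_cong]:
  "sets sphere_measure = sets (restrict_space borel (sphere 0 1))"
  by (simp add: sphere_measure_def)

lemma measurable_ident_sphere_measure:
  "(\<lambda>\<omega>. \<omega>) \<in> borel_measurable sphere_measure"
  by (subst measurable_cong_sets[OF sets_sphere_measure refl]) (rule measurable_restrict_space1, simp)

lemma finite_measure_sphere_measure: "finite_measure (sphere_measure :: 'a::euclidean_space measure)"
proof
  let ?R = "restrict_space lborel (ball (0::'a) 1 - {0})"
  have "emeasure ?R (space ?R) \<le> emeasure lborel (ball (0::'a) 1)"
    by (simp add: emeasure_restrict_space space_restrict_space) (rule emeasure_mono, auto)
  also have "\<dots> < \<infinity>" using emeasure_lborel_ball_finite by simp
  finally have "emeasure (distr ?R (restrict_space borel (sphere 0 1)) (\<lambda>x. x /\<^sub>R norm x))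
      (sphere 0 1) < \<infinity>"
    by (subst emeasure_distr[OF measurable_normalize_sphere])
      (auto intro: le_less_trans[OF emeasure_mono[OF _ sets.top]] simp: sets_restrict_space image_iff)
  then show "emeasure sphere_measure (space (sphere_measure :: 'a measure)) \<noteq> \<infinity>"
    by (simp only: space_sphere_measure) (simp add: sphere_measure_def ennreal_mult_eq_top_iff)
qed

section \<open>Almost everywhere bounds along collisions\<close>

lemma pred_AE:
  assumes "sigma_finite_measure N" and P: "Measurable.pred (M \<Otimes>\<^sub>M N) (\<lambda>z. P (fst z) (snd z))"
  shows "Measurable.pred M (\<lambda>x. AE y in N. P x y)"
proof -
  interpret sigma_finite_measure N by fact
  have [measurable]: "(\<lambda>z. if P (fst z) (snd z) then 0 else 1 :: ennreal) \<in> borel_measurable (M \<Otimes>\<^sub>M N)"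
    using P by measurable
  have "(AE y in N. P x y) \<longleftrightarrow> (\<integral>\<^sup>+ y. (if P x y then 0 else 1) \<partial>N) = 0" if "x \<in> space M" for x
  proof -
    have "(\<lambda>y. if P x y then 0 else 1 :: ennreal) \<in> borel_measurable N"
      using that measurable_compose[OF measurable_Pair1'[OF that]
        \<open>(\<lambda>z. if P (fst z) (snd z) then 0 else 1 :: ennreal) \<in> borel_measurable (M \<Otimes>\<^sub>M N)\<close>] by simp
    then show ?thesis by (subst nn_integral_0_iff_AE) (auto simp: if_split_eq1)
  qed
  note eq = this
  have [measurable]: "(\<lambda>x. \<integral>\<^sup>+ y. (if P x y then 0 else 1) \<partial>N) \<in> borel_measurable M"
    by (rule borel_measurable_nn_integral) (simp add: case_prod_beta')
  have "Measurable.pred M (\<lambda>x. (\<integral>\<^sup>+ y. (if P x y then 0 else 1) \<partial>N) = (0 :: ennreal))"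
    by measurable
  then show ?thesis
    by (rule iffD1[OF measurable_cong, rotated]) (rule eq[symmetric])
qed

text \<open>The preimage of a null set is its image under the inverse linear map, and linear maps preserve
  negligible sets.\<close>

lemma AE_lborel_linear_bij:
  fixes F :: "'a::euclidean_space \<Rightarrow> 'a"
  assumes F: "linear F" "inj F" and P: "AE y in lborel. P y"
  shows "AE x in lborel. P (F x)"
proof -
  obtain G where G: "linear G" "\<And>x. G (F x) = x" "\<And>x. F (G x) = x"
    using linear_injective_isomorphism[OF F] by auto
  from P obtain N where N: "{y. \<not> P y} \<subseteq> N" "N \<in> null_sets lborel"
    by (auto elim!: AE_E simp: null_sets_def)
  then have "negligible N" by (simp add: negligible_iff_null_sets null_sets_completionI)
  then have "negligible (G ` N)"
    using G by (intro negligible_differentiable_image_negligible linear_imp_differentiable_on) auto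
  then have "AE x in lborel. x \<notin> G ` N"
    using AE_not_in[of "G ` N" lebesgue]
    by (simp add: negligible_iff_null_sets AE_completion_iff)
  then show ?thesis
  proof (rule eventually_mono)
    fix x assume "x \<notin> G ` N"
    then have "F x \<notin> N" using G(2) by (metis image_eqI)
    then show "P (F x)" using N by auto
  qed
qed

text \<open>A property of almost all times and phase points is tested at the phase point
  \<open>(x + \<tau>v, v')\<close>, where \<open>v'\<close> is the velocity after a collision with parameter \<open>\<omega>\<close> of \<open>v\<close> with further
  particles of velocities \<open>w\<close>. For fixed \<open>\<tau>\<close> and \<open>\<omega>\<close> the map from \<open>(x, v, w)\<close> to that point, completed by
  the remaining velocities, is a linear bijection, so the exceptional set stays null. The order of
  the quantifiers is then exchanged, so that a single null set of \<open>(x, v)\<close> serves all \<open>\<tau>\<close>, \<open>\<omega>\<close>, \<open>w\<close>.\<close>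

lemma AE_along_collision:
  fixes S :: "'o measure" and T :: "'o \<Rightarrow> ('e::euclidean_space) \<times> ('w::euclidean_space) \<Rightarrow> 'e \<times> 'w"
  assumes S: "sigma_finite_measure S"
    and T: "\<And>\<omega>. \<omega> \<in> space S \<Longrightarrow> linear (T \<omega>)" "\<And>\<omega>. \<omega> \<in> space S \<Longrightarrow> inj (T \<omega>)"
    and T_meas: "(\<lambda>(\<omega>, z). fst (T \<omega> z)) \<in> borel_measurable (S \<Otimes>\<^sub>M borel)"
    and P: "AE q in lborel. P (fst q) (snd q)"
  shows "AE p in lborel. AE \<tau> in lborel. AE z in S \<Otimes>\<^sub>M lborel.
    P \<tau> (fst p + \<tau> *\<^sub>R snd p, fst (T (fst z) (snd p, snd z)))"
proof -
  interpret S: sigma_finite_measure S by (rule S)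
  interpret lS: pair_sigma_finite "lborel :: real measure" S ..
  interpret A: pair_sigma_finite "lborel \<Otimes>\<^sub>M S :: (real \<times> 'o) measure" "lborel :: (('e \<times> 'e) \<times> 'w) measure" ..
  interpret B: pair_sigma_finite "lborel \<Otimes>\<^sub>M S :: (real \<times> 'o) measure" "lborel :: 'w measure" ..
  interpret Sw: pair_sigma_finite S "lborel :: 'w measure" ..
  from P obtain N where N: "{q. \<not> P (fst q) (snd q)} \<subseteq> N" "N \<in> null_sets lborel"
    by (auto elim!: AE_E simp: null_sets_def)
  from N(1) have not_N: "P s y" if "(s, y) \<notin> N" for s y
    using N(1) that by (metis (mono_tags, lifting) fst_conv snd_conv mem_Collect_eq subsetD)
  from N have [measurable]: "N \<in> sets borel" by (auto dest: null_setsD2)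
  \<comment> \<open>The exchange of quantifiers needs measurable predicates, so \<open>P\<close> is replaced by membership in the
     complement of a Borel null set.\<close>
  define Q where "Q \<tau> \<omega> p w \<longleftrightarrow> (\<tau>, (fst p + \<tau> *\<^sub>R snd p, fst (T \<omega> (snd p, w)))) \<notin> N"
    for \<tau> \<omega> and p :: "'e \<times> 'e" and w :: 'w
  have Q_meas: "Measurable.pred M (\<lambda>z. Q (a z) (b z) (c z) (d z))"
    if [measurable]: "a \<in> borel_measurable M" "b \<in> M \<rightarrow>\<^sub>M S" "c \<in> borel_measurable M" "d \<in> borel_measurable M"
    for a b c d and M :: "'m measure"
  proof -
    have "(\<lambda>z. (b z, (snd (c z), d z))) \<in> M \<rightarrow>\<^sub>M S \<Otimes>\<^sub>M borel"
      using that unfolding borel_prod[symmetric] by measurable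
    then have [measurable]: "(\<lambda>z. fst (T (b z) (snd (c z), d z))) \<in> borel_measurable M"
      using measurable_compose[OF _ T_meas, of "\<lambda>z. (b z, (snd (c z), d z))" M] by simp
    have [measurable]: "(\<lambda>z. fst (c z)) \<in> borel_measurable M" "(\<lambda>z. snd (c z)) \<in> borel_measurable M"
      using that unfolding borel_prod[symmetric] by measurable
    then show ?thesis unfolding Q_def by measurable
  qed
  have "AE q in lborel \<Otimes>\<^sub>M lborel. q \<notin> N"
    unfolding lborel_prod by (rule AE_not_in[OF N(2)])
  then have "AE \<tau> in lborel. AE y in lborel. (\<tau>, y) \<notin> N"
    by (rule lborel_pair.AE_pair)
  then have "AE \<tau> in lborel. AE \<omega> in S. AE z in lborel. Q \<tau> \<omega> (fst z) (snd z)"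
  proof (rule eventually_mono, goal_cases)
    case (1 \<tau>)
    note ae = 1
    show ?case
    proof (rule AE_I2)
      fix \<omega> assume \<omega>: "\<omega> \<in> space S"
      interpret T: linear "T \<omega>" by (rule T) fact
      \<comment> \<open>The second component keeps the remaining velocities, which makes \<open>F\<close> injective.\<close>
      define F :: "('e \<times> 'e) \<times> 'w \<Rightarrow> ('e \<times> 'e) \<times> 'w"
        where "F z = ((fst (fst z) + \<tau> *\<^sub>R snd (fst z), fst (T \<omega> (snd (fst z), snd z))),
                      snd (T \<omega> (snd (fst z), snd z)))" for z
      have T_add: "T \<omega> (a + a', b + b') = T \<omega> (a, b) + T \<omega> (a', b')" for a a' b b'
        using T.add[of "(a, b)" "(a', b')"] by simp
      have T_scale: "T \<omega> (r *\<^sub>R a, r *\<^sub>R b) = r *\<^sub>R T \<omega> (a, b)" for r a b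
        using T.scale[of r "(a, b)"] by simp
      have linF: "linear F"
        by (rule linearI) (auto simp: F_def T_add T_scale algebra_simps prod_eq_iff)
      moreover have "inj F"
      proof (rule injI)
        fix z z' assume eq: "F z = F z'"
        then have "T \<omega> (snd (fst z), snd z) = T \<omega> (snd (fst z'), snd z')"
          by (auto simp: F_def prod_eq_iff)
        then have "snd (fst z) = snd (fst z') \<and> snd z = snd z'"
          using T(2)[OF \<omega>] by (auto dest: injD)
        with eq show "z = z'" by (auto simp: F_def prod_eq_iff)
      qed
      moreover have "AE z in (lborel :: (('e \<times> 'e) \<times> 'w) measure). (\<tau>, fst z) \<notin> N"
      proof -
        have "AE y in lborel. AE w in (lborel :: 'w measure). (\<tau>, y) \<notin> N"
          using ae by (rule eventually_mono) auto
        then have "AE z in lborel \<Otimes>\<^sub>M (lborel :: 'w measure). (\<tau>, fst z) \<notin> N"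
        proof (intro lborel_pair.AE_pair_measure)
          have "Measurable.pred (lborel \<Otimes>\<^sub>M (lborel :: 'w measure)) (\<lambda>z. (\<tau>, fst z) \<notin> N)"
            by measurable
          then show "{z \<in> space (lborel \<Otimes>\<^sub>M (lborel :: 'w measure)). (\<tau>, fst z) \<notin> N} \<in> sets (lborel \<Otimes>\<^sub>M lborel)"
            by (simp only: pred_def)
        qed simp
        then show ?thesis unfolding lborel_prod .
      qed
      ultimately have "AE z in lborel. (\<tau>, fst (F z)) \<notin> N"
        by (rule AE_lborel_linear_bij)
      then show "AE z in lborel. Q \<tau> \<omega> (fst z) (snd z)"
        by (simp add: F_def Q_def)
    qed
  qed
  note iterated = this
  have fst_snd: "(\<lambda>s. fst (snd s)) \<in> borel_measurable (K \<Otimes>\<^sub>M (lborel :: (('e \<times> 'e) \<times> 'w) measure))"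
    "(\<lambda>s. snd (snd s)) \<in> borel_measurable (K \<Otimes>\<^sub>M (lborel :: (('e \<times> 'e) \<times> 'w) measure))"
    for K :: "(real \<times> 'o) measure"
    by (rule measurable_compose[OF measurable_snd], simp,
        intro borel_measurable_continuous_onI continuous_intros)+
  have QA: "Measurable.pred ((lborel \<Otimes>\<^sub>M S) \<Otimes>\<^sub>M lborel)
      (\<lambda>z. Q (fst (fst z)) (snd (fst z)) (fst (snd z)) (snd (snd z)))"
    by (intro Q_meas fst_snd) measurable
  have QB: "Measurable.pred ((lborel \<Otimes>\<^sub>M S) \<Otimes>\<^sub>M lborel) (\<lambda>z. Q (fst (fst z)) (snd (fst z)) p (snd z))" for p
    by (intro Q_meas) measurable
  have QS: "Measurable.pred (S \<Otimes>\<^sub>M lborel) (\<lambda>z. Q \<tau> (fst z) p (snd z))" for p \<tau>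
    by (intro Q_meas) measurable
  have "AE s in lborel \<Otimes>\<^sub>M S. AE z in lborel. Q (fst s) (snd s) (fst z) (snd z)"
  proof (rule lS.AE_pair_measure)
    show "{s \<in> space (lborel \<Otimes>\<^sub>M S). AE z in lborel. Q (fst s) (snd s) (fst z) (snd z)} \<in> sets (lborel \<Otimes>\<^sub>M S)"
      using pred_AE[OF sigma_finite_lborel QA] by (simp add: pred_def)
  qed (use iterated in simp)
  then have "AE z in lborel. AE s in lborel \<Otimes>\<^sub>M S. Q (fst s) (snd s) (fst z) (snd z)"
    using QA by (subst A.AE_commute[symmetric]) (simp_all only: pred_def)
  then have "AE p in lborel. AE w in lborel. AE s in lborel \<Otimes>\<^sub>M S. Q (fst s) (snd s) p w"
    using lborel_pair.AE_pair[of "\<lambda>z. AE s in lborel \<Otimes>\<^sub>M S. Q (fst s) (snd s) (fst z) (snd z)"]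
    unfolding lborel_prod by simp
  then show ?thesis
  proof (rule eventually_mono)
    fix p assume "AE w in lborel. AE s in lborel \<Otimes>\<^sub>M S. Q (fst s) (snd s) p w"
    then have "AE s in lborel \<Otimes>\<^sub>M S. AE w in lborel. Q (fst s) (snd s) p w"
      using QB by (subst B.AE_commute) (simp_all only: pred_def)
    then have "AE \<tau> in lborel. AE \<omega> in S. AE w in lborel. Q \<tau> \<omega> p w"
      using lS.AE_pair[of "\<lambda>s. AE w in lborel. Q (fst s) (snd s) p w"] by simp
    then show "AE \<tau> in lborel. AE z in S \<Otimes>\<^sub>M lborel.
      P \<tau> (fst p + \<tau> *\<^sub>R snd p, fst (T (fst z) (snd p, snd z)))"
    proof (rule eventually_mono)
      fix \<tau> assume "AE \<omega> in S. AE w in lborel. Q \<tau> \<omega> p w"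
      then have "AE z in S \<Otimes>\<^sub>M lborel. Q \<tau> (fst z) p (snd z)"
        using QS by (intro Sw.AE_pair_measure) (simp_all add: pred_def)
      then show "AE z in S \<Otimes>\<^sub>M lborel. P \<tau> (fst p + \<tau> *\<^sub>R snd p, fst (T (fst z) (snd p, snd z)))"
        by (rule eventually_mono) (auto simp: Q_def intro: not_N)
    qed
  qed
qed

section \<open>Slicing the sphere\<close>

lemma nn_integral_sphere_measure:
  assumes [measurable]: "f \<in> borel_measurable borel"
  shows "(\<integral>\<^sup>+ \<omega>. f \<omega> \<partial>(sphere_measure :: 'a::euclidean_space measure))
    = of_nat DIM('a) * (\<integral>\<^sup>+ x. f (x /\<^sub>R norm x) * indicator (ball 0 1 - {0}) x \<partial>lborel)"
proof -
  have f: "f \<in> borel_measurable (restrict_space borel (sphere (0::'a) 1))"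
    by (intro measurable_restrict_space1) measurable
  show ?thesis
    unfolding sphere_measure_def using f
    by (simp add: nn_integral_scale_measure nn_integral_distr[OF measurable_normalize_sphere]
        nn_integral_restrict_space)
qed

text \<open>The usual uniqueness argument for Haar measure. The integral of \<open>f(T x) g(y + T x)\<close> over both
  variables is computed in two ways, using translation invariance of Lebesgue measure in
  \<open>y\<close> alone and in both variables; with \<open>f\<close> the indicator of the unit ball, which is invariant under \<open>T\<close> and \<open>x \<mapsto> -x\<close>, the
  volume of the ball cancels.\<close>

lemma nn_integral_lborel_isometry:
  fixes T :: "'a::euclidean_space \<Rightarrow> 'a"
  assumes T: "linear T" "\<And>x. norm (T x) = norm x" and [measurable]: "g \<in> borel_measurable borel"
  shows "(\<integral>\<^sup>+ x. g (T x) \<partial>lborel) = (\<integral>\<^sup>+ x. g x \<partial>lborel)"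
proof -
  interpret T: linear T by fact
  have T_meas[measurable]: "T \<in> borel_measurable borel"
    using T by (intro borel_measurable_continuous_onI linear_continuous_on linear_conv_bounded_linear[THEN iffD1])
  have "inj T" unfolding linear_injective_0[OF T(1)] using T(2) by (metis norm_eq_zero)
  then obtain G where G: "\<And>x. T (G x) = x" using linear_injective_isomorphism[OF T(1)] by blast
  have shift: "(\<integral>\<^sup>+ x. h (x + y) \<partial>lborel) = (\<integral>\<^sup>+ x. h x \<partial>lborel)"
    if "h \<in> borel_measurable borel" for h and y :: 'a
    using nn_integral_lborel_shift[OF that, of "- y"] by simp
  define f :: "'a \<Rightarrow> ennreal" where "f = indicator (ball 0 1)"
  have [measurable]: "f \<in> borel_measurable borel" unfolding f_def by (intro borel_measurable_indicator) auto
  have f_T: "f (T x) = f x" and f_minus: "f (- x) = f x" for x by (auto simp: f_def indicator_def T(2))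
  have f_int: "(\<integral>\<^sup>+ x. f x \<partial>lborel) = emeasure lborel (ball (0::'a) 1)" by (simp add: f_def)
  have "(\<integral>\<^sup>+ x. f x \<partial>lborel) * (\<integral>\<^sup>+ y. g y \<partial>lborel) = (\<integral>\<^sup>+ x. \<integral>\<^sup>+ y. f (T x) * g (y + T x) \<partial>lborel \<partial>lborel)"
    by (simp add: nn_integral_cmult nn_integral_multc f_T shift)
  also have "\<dots> = (\<integral>\<^sup>+ y. \<integral>\<^sup>+ x. f (T x) * g (y + T x) \<partial>lborel \<partial>lborel)"
    by (rule lborel_pair.Fubini') measurable
  also have "\<dots> = (\<integral>\<^sup>+ y. \<integral>\<^sup>+ x. f (T x - y) * g (T x) \<partial>lborel \<partial>lborel)"
  proof (rule nn_integral_cong)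
    fix y
    have "(\<integral>\<^sup>+ x. f (T x) * g (y + T x) \<partial>lborel) = (\<integral>\<^sup>+ x. f (T (x + G y) - y) * g (T (x + G y)) \<partial>lborel)"
      by (simp add: T.add G add.commute)
    also have "\<dots> = (\<integral>\<^sup>+ x. f (T x - y) * g (T x) \<partial>lborel)" by (rule shift) measurable
    finally show "(\<integral>\<^sup>+ x. f (T x) * g (y + T x) \<partial>lborel) = \<dots>" .
  qed
  also have "\<dots> = (\<integral>\<^sup>+ x. \<integral>\<^sup>+ y. f (T x - y) * g (T x) \<partial>lborel \<partial>lborel)"
    by (rule lborel_pair.Fubini') measurable
  also have "\<dots> = (\<integral>\<^sup>+ x. (\<integral>\<^sup>+ y. f (y + (- T x)) \<partial>lborel) * g (T x) \<partial>lborel)"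
  proof (rule nn_integral_cong)
    fix x
    have "f (T x - y) = f (y + (- T x))" for y using f_minus[of "T x - y"] by simp
    then show "(\<integral>\<^sup>+ y. f (T x - y) * g (T x) \<partial>lborel) = (\<integral>\<^sup>+ y. f (y + (- T x)) \<partial>lborel) * g (T x)"
      by (simp only:) (rule nn_integral_multc, rule measurable_compose[where N = borel and g = f], auto)
  qed
  also have "\<dots> = (\<integral>\<^sup>+ x. f x \<partial>lborel) * (\<integral>\<^sup>+ x. g (T x) \<partial>lborel)"
    by (subst shift) (auto simp: nn_integral_cmult)
  finally show ?thesis
    unfolding f_int using emeasure_lborel_ball_finite[of "0::'a" 1] content_ball_pos[of 1 "0::'a"]
    by (subst (asm) ennreal_mult_cancel_left) (auto simp: measure_def)
qed

lemma nn_integral_lborel_split_coordinate: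
  fixes e :: "'a::euclidean_space"
  assumes e: "e \<in> Basis" and [measurable]: "h \<in> borel_measurable borel"
  shows "(\<integral>\<^sup>+ x. h (x \<bullet> e, (norm x)\<^sup>2) \<partial>lborel)
    = (\<integral>\<^sup>+ y. \<integral>\<^sup>+ z. h (z, z\<^sup>2 + (\<Sum>b\<in>Basis - {e}. (y b)\<^sup>2)) \<partial>lborel \<partial>(\<Pi>\<^sub>M b\<in>Basis - {e}. lborel))"
proof -
  interpret product_sigma_finite "\<lambda>_ :: 'a. lborel :: real measure" ..
  let ?v = "\<lambda>f :: 'a \<Rightarrow> real. \<Sum>b\<in>Basis. f b *\<^sub>R b"
  have v: "?v f \<bullet> b = f b" if "b \<in> Basis" for f b
    using that by (simp add: inner_sum_left inner_Basis if_distrib cong: if_cong)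
  have norm_v: "(norm (?v f))\<^sup>2 = (\<Sum>b\<in>Basis. (f b)\<^sup>2)" for f
    unfolding power2_norm_eq_inner by (subst euclidean_inner) (simp add: v power2_eq_square)
  have ins: "insert e (Basis - {e}) = Basis" using e by auto
  have comp: "(\<lambda>f. f b) \<in> borel_measurable (\<Pi>\<^sub>M b\<in>Basis. lborel :: real measure)" if "b \<in> Basis" for b :: 'a
    using measurable_component_singleton[OF that, of "\<lambda>_. lborel :: real measure"] by simp
  then have v_meas: "?v \<in> borel_measurable (\<Pi>\<^sub>M b\<in>Basis. lborel :: real measure)"
    by (intro borel_measurable_sum borel_measurable_scaleR) auto
  have "(\<lambda>f. (f e, \<Sum>b\<in>Basis. (f b)\<^sup>2)) \<in> borel_measurable (\<Pi>\<^sub>M b\<in>(Basis :: 'a set). lborel :: real measure)"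
    using comp e by (intro borel_measurable_Pair borel_measurable_sum borel_measurable_power) auto
  from measurable_compose[OF this assms(2)]
  have h_meas: "(\<lambda>f. h (f e, \<Sum>b\<in>Basis. (f b)\<^sup>2)) \<in> borel_measurable (\<Pi>\<^sub>M b\<in>(Basis :: 'a set). lborel :: real measure)" .
  have "(\<integral>\<^sup>+ x. h (x \<bullet> e, (norm x)\<^sup>2) \<partial>lborel)
    = (\<integral>\<^sup>+ f. h (f e, \<Sum>b\<in>Basis. (f b)\<^sup>2) \<partial>(\<Pi>\<^sub>M b\<in>Basis. lborel))"
    using v_meas by (subst lborel_eq, subst nn_integral_distr) (simp_all add: v[OF e] norm_v)
  also have "\<dots> = (\<integral>\<^sup>+ y. \<integral>\<^sup>+ z. h ((y(e := z)) e, \<Sum>b\<in>Basis. ((y(e := z)) b)\<^sup>2) \<partial>lborel \<partial>(\<Pi>\<^sub>M b\<in>Basis - {e}. lborel))"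
    using product_nn_integral_insert[of "Basis - {e}" e "\<lambda>f. h (f e, \<Sum>b\<in>Basis. (f b)\<^sup>2)"] h_meas
    unfolding ins by simp
  also have "\<dots> = (\<integral>\<^sup>+ y. \<integral>\<^sup>+ z. h (z, z\<^sup>2 + (\<Sum>b\<in>Basis - {e}. (y b)\<^sup>2)) \<partial>lborel \<partial>(\<Pi>\<^sub>M b\<in>Basis - {e}. lborel))"
  proof -
    have "(\<Sum>b\<in>Basis. ((y(e := z)) b)\<^sup>2) = z\<^sup>2 + (\<Sum>b\<in>Basis - {e}. (y b)\<^sup>2)" for y :: "'a \<Rightarrow> real" and z
      using e by (subst sum.remove[of _ e]) (auto intro!: sum.cong)
    then show ?thesis by (simp only: fun_upd_same)
  qed
  finally show ?thesis .
qed

text \<open>Substitution \<open>s = z / (z\<^sup>2 + r\<^sup>2)\<^sup>1\<^sup>/\<^sup>2\<close>: 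
  on a line parallel to an axis at distance \<open>r > 0\<close>, with coordinate \<open>z\<close>, \<open>s\<close> is the cosine of the angle
  between the point and the axis. Since \<open>1 - s\<^sup>2 = r\<^sup>2 / (z\<^sup>2 + r\<^sup>2)\<close>, the inverse of the derivative is
  \<open>r (1 - s\<^sup>2)\<^sup>-\<^sup>3\<^sup>/\<^sup>2\<close>, and being in the unit ball forces \<open>r\<^sup>2 \<le> 1 - s\<^sup>2\<close>.\<close>

lemma nn_integral_direction_le:
  fixes b :: "real \<Rightarrow> ennreal" and r :: real
  assumes [measurable]: "b \<in> borel_measurable borel" and r: "0 < r"
  shows "(\<integral>\<^sup>+ z. b (z / sqrt (z\<^sup>2 + r\<^sup>2)) * indicator {..<1} (z\<^sup>2 + r\<^sup>2) \<partial>lborel)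
    \<le> (\<integral>\<^sup>+ s. b s * ennreal (r * (1 - s\<^sup>2) powr (- 3 / 2)) * indicator {s. r\<^sup>2 \<le> 1 - s\<^sup>2} s * indicator {-1..1} s \<partial>lborel)"
proof -
  define g where "g z = z / sqrt (z\<^sup>2 + r\<^sup>2)" for z
  define g' where "g' z = r\<^sup>2 * (z\<^sup>2 + r\<^sup>2) powr (- 3 / 2)" for z
  define F where "F s = b s * ennreal (r * (1 - s\<^sup>2) powr (- 3 / 2)) * indicator {s. r\<^sup>2 \<le> 1 - s\<^sup>2} s" for s
  have [measurable]: "F \<in> borel_measurable borel" unfolding F_def by measurable
  have pos: "0 < z\<^sup>2 + r\<^sup>2" for z using r by (simp add: add_nonneg_pos)
  have powr32: "q powr (- 3 / 2) = 1 / (q * sqrt q)" if "0 < q" for q :: real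
  proof -
    have "q powr (3 / 2) = q powr 1 * q powr (1 / 2)" by (subst powr_add[symmetric]) simp
    then have "q powr (3 / 2) = q * sqrt q" using that by (simp add: powr_half_sqrt)
    moreover have "q powr (- 3 / 2) = inverse (q powr (3 / 2))" using powr_minus[of q "3 / 2"] by simp
    ultimately show ?thesis by (simp only: inverse_eq_divide)
  qed
  have deriv: "(g has_real_derivative g' z) (at z)" for z
  proof -
    have "(g has_real_derivative (sqrt (z\<^sup>2 + r\<^sup>2) - z * (2 * z / (2 * sqrt (z\<^sup>2 + r\<^sup>2)))) / (sqrt (z\<^sup>2 + r\<^sup>2))\<^sup>2) (at z)"
      unfolding g_def using pos[of z]
      by (auto intro!: derivative_eq_intros simp: divide_simps power2_eq_square)
    moreover have "(sqrt (z\<^sup>2 + r\<^sup>2) - z * (2 * z / (2 * sqrt (z\<^sup>2 + r\<^sup>2)))) / (sqrt (z\<^sup>2 + r\<^sup>2))\<^sup>2 = g' z"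
    proof -
      define q where "q = sqrt (z\<^sup>2 + r\<^sup>2)"
      have q: "0 < q" "q\<^sup>2 = z\<^sup>2 + r\<^sup>2" using pos[of z] by (auto simp: q_def)
      have "(q - z * (2 * z / (2 * q))) / q\<^sup>2 = (q\<^sup>2 - z\<^sup>2) / (q\<^sup>2 * q)"
        using q(1) by (simp add: field_simps power2_eq_square)
      also have "\<dots> = r\<^sup>2 / (q\<^sup>2 * q)" using q(2) by simp
      finally show ?thesis using powr32[OF pos[of z]] q(2) by (simp add: g'_def q_def)
    qed
    ultimately show ?thesis by simp
  qed
  have cont: "continuous_on {-1..1} g'"
    unfolding g'_def using pos by (intro continuous_intros) (metis less_irrefl)
  have g'_nonneg: "0 \<le> g' z" for z by (simp add: g'_def)
  have g2: "1 - (g z)\<^sup>2 = r\<^sup>2 / (z\<^sup>2 + r\<^sup>2)" for z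
  proof -
    have "r\<^sup>2 / (z\<^sup>2 + r\<^sup>2) = ((z\<^sup>2 + r\<^sup>2) - z\<^sup>2) / (z\<^sup>2 + r\<^sup>2)" by simp
    also have "\<dots> = 1 - z\<^sup>2 / (z\<^sup>2 + r\<^sup>2)"
      using r by (subst diff_divide_distrib) simp
    also have "\<dots> = 1 - (g z)\<^sup>2" using pos[of z] by (simp add: g_def power_divide)
    finally show ?thesis by simp
  qed
  have F_g: "b (g z) * indicator {..<1} (z\<^sup>2 + r\<^sup>2) \<le> F (g z) * ennreal (g' z) * indicator {-1..1} z" for z
  proof (cases "z\<^sup>2 + r\<^sup>2 < 1")
    case True
    have "z\<^sup>2 \<le> 1" using True r by (smt (verit) zero_le_power2)
    then have z: "z \<in> {-1..1}" by (auto simp: abs_square_le_1 abs_le_iff)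
    have "r\<^sup>2 * (z\<^sup>2 + r\<^sup>2) \<le> r\<^sup>2 * 1" using True by (intro mult_left_mono) auto
    then have "r\<^sup>2 \<le> 1 - (g z)\<^sup>2" unfolding g2 using pos[of z] by (simp add: le_divide_eq)
    moreover have "r * (1 - (g z)\<^sup>2) powr (- 3 / 2) * g' z = 1"
    proof -
      have "(1 - (g z)\<^sup>2) powr (- 3 / 2) * (z\<^sup>2 + r\<^sup>2) powr (- 3 / 2) = (r\<^sup>2) powr (- 3 / 2)"
        unfolding g2 using pos[of z] r by (subst powr_mult[symmetric]) auto
      also have "\<dots> = 1 / (r\<^sup>2 * r)" using r powr32[of "r\<^sup>2"] by simp
      finally have *: "(1 - (g z)\<^sup>2) powr (- 3 / 2) * (z\<^sup>2 + r\<^sup>2) powr (- 3 / 2) = 1 / (r\<^sup>2 * r)" .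
      have "r * (1 - (g z)\<^sup>2) powr (- 3 / 2) * g' z
          = r * r\<^sup>2 * ((1 - (g z)\<^sup>2) powr (- 3 / 2) * (z\<^sup>2 + r\<^sup>2) powr (- 3 / 2))"
        by (simp add: g'_def mult_ac)
      also have "\<dots> = 1" unfolding * using r by simp
      finally show ?thesis .
    qed
    ultimately show ?thesis
      using z True r g'_nonneg[of z] by (simp add: F_def mult.assoc flip: ennreal_mult)
  qed simp
  have "(\<integral>\<^sup>+ z. b (g z) * indicator {..<1} (z\<^sup>2 + r\<^sup>2) \<partial>lborel)
    \<le> (\<integral>\<^sup>+ z. F (g z) * ennreal (g' z) * indicator {-1..1} z \<partial>lborel)"
    by (rule nn_integral_mono) (rule F_g)
  also have "\<dots> = (\<integral>\<^sup>+ s. F s * indicator {g (-1)..g 1} s \<partial>lborel)"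
    by (rule nn_integral_substitution_aux[symmetric]) (use deriv cont g'_nonneg in auto)
  also have "\<dots> \<le> (\<integral>\<^sup>+ s. F s * indicator {-1..1} s \<partial>lborel)"
  proof -
    have "1 \<le> sqrt (1 + r\<^sup>2)" by simp
    then have "1 / sqrt (1 + r\<^sup>2) \<le> 1" by (subst divide_le_eq_1_pos) (auto simp: add_pos_nonneg)
    then have "-1 \<le> g (-1)" "g 1 \<le> 1" by (simp_all add: g_def)
    then show ?thesis by (intro nn_integral_mono) (auto split: split_indicator)
  qed
  finally show ?thesis by (simp add: g_def F_def)
qed

lemma AE_PiM_lborel_sum_squares_pos:
  assumes "finite I" "I \<noteq> {}"
  shows "AE y in (\<Pi>\<^sub>M i\<in>I. lborel :: real measure). 0 < (\<Sum>i\<in>I. (y i)\<^sup>2)"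
proof -
  interpret product_sigma_finite "\<lambda>_. lborel :: real measure" ..
  have "emeasure (\<Pi>\<^sub>M i\<in>I. lborel :: real measure) (\<Pi>\<^sub>E i\<in>I. {0}) = 0"
    using assms by (subst emeasure_PiM) auto
  moreover have "(\<Pi>\<^sub>E i\<in>I. {0}) \<in> sets (\<Pi>\<^sub>M i\<in>I. lborel :: real measure)"
    using assms by (intro sets_PiM_I_finite) auto
  ultimately have "AE y in (\<Pi>\<^sub>M i\<in>I. lborel :: real measure). y \<notin> (\<Pi>\<^sub>E i\<in>I. {0})"
    by (intro AE_not_in) (auto simp: null_sets_def)
  with AE_space show ?thesis
  proof eventually_elim
    case (elim y)
    then obtain i where "i \<in> I" "y i \<noteq> 0" unfolding space_PiM PiE_iff by blast
    then show ?case using assms by (intro sum_pos2[of I i]) auto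
  qed
qed

text \<open>After the substitution in the coordinate along \<open>e\<close>, the transversal coordinates \<open>y\<close> of length \<open>r\<close> range over
  the ball of radius \<open>\<rho> = (1 - s\<^sup>2)\<^sup>1\<^sup>/\<^sup>2\<close> in dimension \<open>d - 1\<close>. Bounding \<open>r\<close> by \<open>\<rho>\<close> there gives the weight
  \<open>\<rho> \<cdot> \<rho>\<^sup>-\<^sup>3 \<cdot> \<rho>\<^sup>d\<^sup>-\<^sup>1 = (1 - s\<^sup>2)\<^sup>(\<^sup>d\<^sup>-\<^sup>3\<^sup>)\<^sup>/\<^sup>2\<close>.\<close>

lemma nn_integral_ball_direction_le:
  fixes b :: "real \<Rightarrow> ennreal" and e :: "'a::euclidean_space"
  assumes e: "e \<in> Basis" and d: "2 \<le> DIM('a)" and b[measurable]: "b \<in> borel_measurable borel"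
  shows "(\<integral>\<^sup>+ x. b ((x \<bullet> e) / norm x) * indicator (ball 0 1) x \<partial>lborel)
    \<le> ennreal (unit_ball_vol (real (DIM('a) - 1)))
      * (\<integral>\<^sup>+ s. b s * ennreal ((1 - s\<^sup>2) powr ((real DIM('a) - 3) / 2)) * indicator {-1..1} s \<partial>lborel)"
proof -
  define I where "I = (Basis :: 'a set) - {e}"
  have I: "finite I" "card I = DIM('a) - 1" using e by (auto simp: I_def)
  then have "I \<noteq> {}" using d by auto
  define PI where "PI = (\<Pi>\<^sub>M i\<in>I. lborel :: real measure)"
  define V where "V = unit_ball_vol (real (DIM('a) - 1))"
  have V: "0 \<le> V" by (simp add: V_def)
  interpret product_sigma_finite "\<lambda>_ :: 'a. lborel :: real measure" ..
  interpret PI: sigma_finite_measure PI unfolding PI_def using I(1) by (rule sigma_finite)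
  interpret P: pair_sigma_finite PI "lborel :: real measure" ..
  define r where "r y = sqrt (\<Sum>i\<in>I. (y i)\<^sup>2)" for y :: "'a \<Rightarrow> real"
  have "(\<lambda>y. y i) \<in> borel_measurable PI" if "i \<in> I" for i
    unfolding PI_def using measurable_component_singleton[OF that, of "\<lambda>_. lborel :: real measure"] by simp
  then have r_meas[measurable]: "r \<in> borel_measurable PI"
    unfolding r_def
    by (intro measurable_compose[OF _ borel_measurable_sqrt] borel_measurable_sum borel_measurable_power)
  have r_sq: "(r y)\<^sup>2 = (\<Sum>i\<in>I. (y i)\<^sup>2)" for y by (simp add: r_def sum_nonneg)
  have r_nonneg: "0 \<le> r y" for y by (simp add: r_def sum_nonneg)
  let ?k = "\<lambda>y s. b s * ennreal (r y * (1 - s\<^sup>2) powr (- 3 / 2)) * indicator {s. (r y)\<^sup>2 \<le> 1 - s\<^sup>2} s * indicator {-1..1} s"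
  have "(\<integral>\<^sup>+ x. b ((x \<bullet> e) / norm x) * indicator (ball 0 1) x \<partial>lborel)
    = (\<integral>\<^sup>+ x. b ((x \<bullet> e) / sqrt ((norm x)\<^sup>2)) * indicator {..<1} ((norm x)\<^sup>2) \<partial>lborel)"
    by (intro nn_integral_cong) (auto simp: indicator_def abs_square_less_1)
  also have "\<dots> = (\<integral>\<^sup>+ y. \<integral>\<^sup>+ z. b (z / sqrt (z\<^sup>2 + (r y)\<^sup>2)) * indicator {..<1} (z\<^sup>2 + (r y)\<^sup>2) \<partial>lborel \<partial>PI)"
    unfolding r_sq PI_def I_def
    using nn_integral_lborel_split_coordinate[OF e, of "\<lambda>(z, q). b (z / sqrt q) * indicator {..<1} q"]
    by (simp add: borel_prod[symmetric])
  also have "\<dots> \<le> (\<integral>\<^sup>+ y. \<integral>\<^sup>+ s. ?k y s \<partial>lborel \<partial>PI)"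
  proof (rule nn_integral_mono_AE)
    show "AE y in PI. (\<integral>\<^sup>+ z. b (z / sqrt (z\<^sup>2 + (r y)\<^sup>2)) * indicator {..<1} (z\<^sup>2 + (r y)\<^sup>2) \<partial>lborel) \<le> (\<integral>\<^sup>+ s. ?k y s \<partial>lborel)"
      using AE_PiM_lborel_sum_squares_pos[OF I(1) \<open>I \<noteq> {}\<close>] unfolding PI_def
    proof (rule eventually_mono)
      fix y :: "'a \<Rightarrow> real" assume "0 < (\<Sum>i\<in>I. (y i)\<^sup>2)"
      then have "0 < r y" by (simp add: r_def)
      then show "(\<integral>\<^sup>+ z. b (z / sqrt (z\<^sup>2 + (r y)\<^sup>2)) * indicator {..<1} (z\<^sup>2 + (r y)\<^sup>2) \<partial>lborel) \<le> (\<integral>\<^sup>+ s. ?k y s \<partial>lborel)"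
        by (rule nn_integral_direction_le[OF b])
    qed
  qed
  also have "\<dots> = (\<integral>\<^sup>+ s. \<integral>\<^sup>+ y. ?k y s \<partial>PI \<partial>lborel)"
  proof (rule P.Fubini'[symmetric])
    have "(\<lambda>z. b (snd z) * ennreal (r (fst z) * (1 - (snd z)\<^sup>2) powr (- 3 / 2))
        * indicator {z \<in> space (PI \<Otimes>\<^sub>M lborel). (r (fst z))\<^sup>2 \<le> 1 - (snd z)\<^sup>2} z * indicator {-1..1} (snd z)) \<in> borel_measurable (PI \<Otimes>\<^sub>M lborel)"
      by measurable
    also have "?this \<longleftrightarrow> case_prod ?k \<in> borel_measurable (PI \<Otimes>\<^sub>M lborel)"
      by (rule measurable_cong) (auto simp: indicator_def)
    finally show "case_prod ?k \<in> borel_measurable (PI \<Otimes>\<^sub>M lborel)" .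
  qed
  also have "\<dots> \<le> (\<integral>\<^sup>+ s. ennreal V * (b s * ennreal ((1 - s\<^sup>2) powr ((real DIM('a) - 3) / 2)) * indicator {-1..1} s) \<partial>lborel)"
  proof (rule nn_integral_mono)
    fix s :: real
    show "(\<integral>\<^sup>+ y. ?k y s \<partial>PI) \<le> ennreal V * (b s * ennreal ((1 - s\<^sup>2) powr ((real DIM('a) - 3) / 2)) * indicator {-1..1} s)"
    proof (cases "s \<in> {-1..1} \<and> s\<^sup>2 < 1")
      case True
      define \<rho> where "\<rho> = sqrt (1 - s\<^sup>2)"
      have \<rho>: "0 < \<rho>" "\<rho>\<^sup>2 = 1 - s\<^sup>2" using True by (auto simp: \<rho>_def)
      let ?B = "{f. sqrt (\<Sum>i\<in>I. (f i)\<^sup>2) \<le> \<rho>} \<inter> space PI"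
      have B_meas: "?B \<in> sets PI"
      proof -
        have "{y \<in> space PI. r y \<le> \<rho>} \<in> sets PI" by measurable
        also have "{y \<in> space PI. r y \<le> \<rho>} = ?B" by (auto simp: r_def)
        finally show ?thesis .
      qed
      have "(\<integral>\<^sup>+ y. ?k y s \<partial>PI) \<le> (\<integral>\<^sup>+ y. b s * ennreal (\<rho> * (1 - s\<^sup>2) powr (- 3 / 2)) * indicator ?B y \<partial>PI)"
      proof (rule nn_integral_mono)
        fix y assume y: "y \<in> space PI"
        show "?k y s \<le> b s * ennreal (\<rho> * (1 - s\<^sup>2) powr (- 3 / 2)) * indicator ?B y"
        proof (cases "(r y)\<^sup>2 \<le> 1 - s\<^sup>2")
          case True
          then have "r y \<le> \<rho>"
            using power2_le_imp_le[of "r y" \<rho>] \<rho>(1) unfolding \<rho>(2) by linarith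
          then have "y \<in> ?B" using y by (simp add: r_def)
          moreover have "ennreal (r y * (1 - s\<^sup>2) powr (- 3 / 2)) \<le> ennreal (\<rho> * (1 - s\<^sup>2) powr (- 3 / 2))"
            using \<open>r y \<le> \<rho>\<close> by (intro ennreal_leI mult_right_mono) auto
          ultimately show ?thesis by (auto simp: indicator_def intro!: mult_left_mono)
        qed simp
      qed
      also have "\<dots> = b s * ennreal (\<rho> * (1 - s\<^sup>2) powr (- 3 / 2)) * ennreal (V * \<rho> ^ (DIM('a) - 1))"
        using emeasure_cball_aux[OF I(1) \<rho>(1)] B_meas
        by (subst nn_integral_cmult_indicator) (simp_all add: PI_def V_def I(2))
      also have "\<dots> = ennreal V * (b s * ennreal (\<rho> * (1 - s\<^sup>2) powr (- 3 / 2) * \<rho> ^ (DIM('a) - 1)))"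
        using V \<rho>(1) by (simp add: ennreal_mult mult_ac)
      also have "\<rho> * (1 - s\<^sup>2) powr (- 3 / 2) * \<rho> ^ (DIM('a) - 1) = (1 - s\<^sup>2) powr ((real DIM('a) - 3) / 2)"
      proof -
        have pos: "0 < 1 - s\<^sup>2" using True by simp
        have "\<rho> * \<rho> ^ (DIM('a) - 1) = \<rho> ^ DIM('a)" using d by (cases "DIM('a)") auto
        also have "\<dots> = \<rho> powr real DIM('a)" using \<rho>(1) by (simp add: powr_realpow)
        also have "\<dots> = ((1 - s\<^sup>2) powr (1 / 2)) powr real DIM('a)"
          using pos by (simp add: \<rho>_def powr_half_sqrt)
        also have "\<dots> = (1 - s\<^sup>2) powr (real DIM('a) / 2)" by (simp add: powr_powr)
        finally have eq: "\<rho> * \<rho> ^ (DIM('a) - 1) = (1 - s\<^sup>2) powr (real DIM('a) / 2)" .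
        have "\<rho> * (1 - s\<^sup>2) powr (- 3 / 2) * \<rho> ^ (DIM('a) - 1)
            = (1 - s\<^sup>2) powr (- 3 / 2) * (\<rho> * \<rho> ^ (DIM('a) - 1))"
          by (simp only: mult_ac)
        also have "\<dots> = (1 - s\<^sup>2) powr (- 3 / 2) * (1 - s\<^sup>2) powr (real DIM('a) / 2)"
          by (simp only: eq)
        also have "\<dots> = (1 - s\<^sup>2) powr (- 3 / 2 + real DIM('a) / 2)" by (rule powr_add[symmetric])
        also have "- 3 / 2 + real DIM('a) / 2 = (real DIM('a) - 3) / 2" by (simp add: diff_divide_distrib)
        finally show ?thesis .
      qed
      finally show ?thesis using True by (simp add: mult_ac)
    next
      case False
      then have "s\<^sup>2 = 1 \<or> s \<notin> {-1..1}" by (auto simp: abs_square_less_1 power2_eq_1_iff abs_le_iff)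
      then have k_zero: "?k y s = 0" for y by auto
      show ?thesis unfolding k_zero by simp
    qed
  qed
  also have "\<dots> = ennreal V * (\<integral>\<^sup>+ s. b s * ennreal ((1 - s\<^sup>2) powr ((real DIM('a) - 3) / 2)) * indicator {-1..1} s \<partial>lborel)"
    by (rule nn_integral_cmult) measurable
  finally show ?thesis by (simp add: V_def)
qed

text \<open>A Lebesgue measurable function need not be Borel, and composing it with \<open>\<omega> \<mapsto> e \<bullet> \<omega>\<close> needs a Borel
  function. A majorant valid at every point, obtained by the value \<open>\<infinity>\<close> on a null set, avoids
  having to pull null sets back to the sphere.\<close>

lemma borel_majorant:
  fixes f :: "real \<Rightarrow> real"
  assumes "f \<in> borel_measurable (lebesgue_on S)" "S \<in> sets lebesgue"
  obtains b :: "real \<Rightarrow> ennreal" where "b \<in> borel_measurable borel" "\<And>x. x \<in> S \<Longrightarrow> ennreal (f x) \<le> b x"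
    "AE x in lborel. x \<in> S \<longrightarrow> b x = ennreal (f x)"
proof -
  have "(\<lambda>x. ennreal (f x)) \<in> borel_measurable (lebesgue_on S)" using assms(1) by measurable
  then have "(\<lambda>x. ennreal (f x) * indicator S x) \<in> borel_measurable lebesgue"
    using assms(2) by (simp add: borel_measurable_restrict_space_iff_ennreal)
  then obtain g where g: "g \<in> borel_measurable lborel" "AE x in lborel. ennreal (f x) * indicator S x = g x"
    using completion_ex_borel_measurable by blast
  from g(2) obtain N where N: "{x. ennreal (f x) * indicator S x \<noteq> g x} \<subseteq> N" "N \<in> null_sets lborel"
    by (auto elim!: AE_E simp: null_sets_def)
  then have [measurable]: "N \<in> sets borel" by (auto dest: null_setsD2)
  show thesis
  proof (rule that[of "\<lambda>x. if x \<in> N then top else g x"])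
    show "(\<lambda>x. if x \<in> N then top else g x) \<in> borel_measurable borel" using g(1) by measurable
    have eq: "g x = ennreal (f x)" if "x \<in> S" "x \<notin> N" for x
    proof -
      have "ennreal (f x) * indicator S x = g x" using N(1) that(2) by blast
      then show ?thesis using that(1) by simp
    qed
    show "ennreal (f x) \<le> (if x \<in> N then top else g x)" if "x \<in> S" for x
      using eq[OF that] by auto
    show "AE x in lborel. x \<in> S \<longrightarrow> (if x \<in> N then top else g x) = ennreal (f x)"
      using AE_not_in[OF N(2)] by (rule eventually_mono) (auto simp: eq)
  qed
qed

text \<open>A rotation moves \<open>e\<close> to a coordinate axis. The factor \<open>2\<close> bounds \<open>d / (d - 1)\<close>, the price of replacing
  \<open>r\<close> by \<open>\<rho>\<close> in the slices.\<close>

lemma nn_integral_sphere_direction_le: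
  fixes e :: "real ^ 'n::finite" and f :: "real \<Rightarrow> real"
  assumes d: "2 \<le> CARD('n)" and f: "f \<in> borel_measurable (lebesgue_on {-1..1})" and e: "norm e = 1"
  shows "(\<integral>\<^sup>+ \<omega>. ennreal (f (e \<bullet> \<omega>)) \<partial>sphere_measure) \<le> 2 * b2_norm CARD('n) f"
proof -
  obtain b :: "real \<Rightarrow> ennreal" where b[measurable]: "b \<in> borel_measurable borel"
    and f_le: "\<And>x. x \<in> {-1..1} \<Longrightarrow> ennreal (f x) \<le> b x"
    and b_eq: "AE x in lborel. x \<in> {-1..1} \<longrightarrow> b x = ennreal (f x)"
    using borel_majorant[OF f] by auto
  obtain e' :: "real ^ 'n" where e': "e' \<in> Basis" using nonempty_Basis by blast
  have "norm e' = norm e" using e e' by simp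
  then obtain T where T: "orthogonal_transformation T" "T e' = e"
    using orthogonal_transformation_exists by blast
  have norm_T: "norm (T x) = norm x" for x using T(1) by (simp add: orthogonal_transformation)
  have inner_T: "e \<bullet> T x = x \<bullet> e'" for x
    using T by (metis orthogonal_transformation_def inner_commute)
  have "(\<integral>\<^sup>+ \<omega>. ennreal (f (e \<bullet> \<omega>)) \<partial>sphere_measure) \<le> (\<integral>\<^sup>+ \<omega>. b (e \<bullet> \<omega>) \<partial>sphere_measure)"
  proof (rule nn_integral_mono)
    fix \<omega> :: "real ^ 'n" assume "\<omega> \<in> space sphere_measure"
    then have "\<bar>e \<bullet> \<omega>\<bar> \<le> 1" using Cauchy_Schwarz_ineq2[of e \<omega>] e by simp
    then show "ennreal (f (e \<bullet> \<omega>)) \<le> b (e \<bullet> \<omega>)" by (intro f_le) (auto simp: abs_le_iff)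
  qed
  also have "\<dots> = of_nat CARD('n) * (\<integral>\<^sup>+ x. b (e \<bullet> (x /\<^sub>R norm x)) * indicator (ball 0 1 - {0}) x \<partial>lborel)"
    using nn_integral_sphere_measure[of "\<lambda>\<omega>. b (e \<bullet> \<omega>)"] by simp
  also have "\<dots> \<le> of_nat CARD('n) * (\<integral>\<^sup>+ x. b (e \<bullet> (x /\<^sub>R norm x)) * indicator (ball 0 1) x \<partial>lborel)"
    by (intro mult_left_mono nn_integral_mono) (auto split: split_indicator)
  also have "(\<integral>\<^sup>+ x. b (e \<bullet> (x /\<^sub>R norm x)) * indicator (ball 0 1) x \<partial>lborel)
    = (\<integral>\<^sup>+ x. b (e \<bullet> (T x /\<^sub>R norm (T x))) * indicator (ball 0 1) (T x) \<partial>lborel)"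
    using T(1) norm_T
    by (intro nn_integral_lborel_isometry[symmetric] borel_measurable_times_ennreal borel_measurable_indicator)
       (auto simp: orthogonal_transformation_linear)
  also have "\<dots> = (\<integral>\<^sup>+ x. b ((x \<bullet> e') / norm x) * indicator (ball 0 1) x \<partial>lborel)"
    by (intro nn_integral_cong) (simp add: inner_T norm_T divide_inverse_commute indicator_def)
  also have "\<dots> \<le> ennreal (unit_ball_vol (real (CARD('n) - 1)))
      * (\<integral>\<^sup>+ s. b s * ennreal ((1 - s\<^sup>2) powr ((real CARD('n) - 3) / 2)) * indicator {-1..1} s \<partial>lborel)"
    using nn_integral_ball_direction_le[OF e' _ b] d by simp
  also have "(\<integral>\<^sup>+ s. b s * ennreal ((1 - s\<^sup>2) powr ((real CARD('n) - 3) / 2)) * indicator {-1..1} s \<partial>lborel)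
    = (\<integral>\<^sup>+ s\<in>{-1..1}. ennreal (f s * (1 - s\<^sup>2) powr ((real CARD('n) - 3) / 2)) \<partial>lborel)"
    using b_eq by (intro nn_integral_cong_AE) (auto elim!: eventually_mono simp: indicator_def ennreal_mult'')
  also have "of_nat CARD('n) * (ennreal (unit_ball_vol (real (CARD('n) - 1))) * \<dots>)
    \<le> 2 * b2_norm CARD('n) f"
  proof -
    define J where "J = (\<integral>\<^sup>+ s\<in>{-1..1}. ennreal (f s * (1 - s\<^sup>2) powr ((real CARD('n) - 3) / 2)) \<partial>lborel)"
    define V where "V = unit_ball_vol (real (CARD('n) - 1))"
    have "real CARD('n) * V \<le> 2 * (real (CARD('n) - 1) * V)"
      using d by (simp add: V_def flip: mult.assoc)
    then have "ennreal (real CARD('n) * V) \<le> ennreal (2 * (real (CARD('n) - 1) * V))"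
      by (rule ennreal_leI)
    also have "\<dots> = 2 * ennreal (real (CARD('n) - 1) * V)"
      by (subst ennreal_mult) (auto simp: V_def)
    also have "ennreal (real CARD('n) * V) = ennreal (real CARD('n)) * ennreal V"
      by (rule ennreal_mult) (auto simp: V_def)
    finally have "ennreal (real CARD('n)) * ennreal V * J \<le> 2 * ennreal (real (CARD('n) - 1) * V) * J"
      by (rule mult_right_mono) simp
    then show ?thesis
      unfolding b2_norm_def sphere_area_def J_def V_def
      by (simp only: mult.assoc ennreal_of_nat_eq_real_of_nat)
  qed
  finally show ?thesis by (simp add: mult_left_mono)
qed

section \<open>Functions bounded by transported Maxwellians\<close>

lemma e2ennreal_abs_mult: "e2ennreal \<bar>x * y\<bar> = e2ennreal \<bar>x\<bar> * e2ennreal \<bar>y\<bar>"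
proof -
  have "\<bar>x\<bar> = enn2ereal (e2ennreal \<bar>x\<bar>)" "\<bar>y\<bar> = enn2ereal (e2ennreal \<bar>y\<bar>)"
    by (simp_all add: enn2ereal_e2ennreal)
  moreover have "\<bar>x * y\<bar> = \<bar>x\<bar> * \<bar>y\<bar>" by (cases x; cases y; simp add: abs_mult)
  ultimately have "\<bar>x * y\<bar> = enn2ereal (e2ennreal \<bar>x\<bar> * e2ennreal \<bar>y\<bar>)"
    by (simp add: times_ennreal.rep_eq)
  then show ?thesis by simp
qed

lemma e2ennreal_abs_add_le: "e2ennreal \<bar>x + y\<bar> \<le> e2ennreal \<bar>x\<bar> + e2ennreal \<bar>y\<bar>"
proof -
  have "\<bar>x + y\<bar> \<le> \<bar>x\<bar> + \<bar>y\<bar>" by (cases x; cases y; simp)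
  then have "e2ennreal \<bar>x + y\<bar> \<le> e2ennreal (\<bar>x\<bar> + \<bar>y\<bar>)" by (rule e2ennreal_mono)
  also have "\<bar>x\<bar> + \<bar>y\<bar> = enn2ereal (e2ennreal \<bar>x\<bar> + e2ennreal \<bar>y\<bar>)"
    by (simp add: enn2ereal_e2ennreal plus_ennreal.rep_eq)
  finally show ?thesis by simp
qed

lemma maxwellian_pos: "0 < maxwellian \<alpha> \<beta> p"
  by (simp add: maxwellian_def split: prod.split)

text \<open>The bound on \<open>f\<^sup>#\<close> rewritten for \<open>f\<close>, holding almost everywhere in \<open>(t, x, v)\<close> jointly rather than in
  \<open>(x, v)\<close> for each \<open>t\<close>.\<close>

definition maxwellian_bounded :: "ereal \<Rightarrow> real \<Rightarrow> real \<Rightarrow> ('n::finite) evolution \<Rightarrow> ennreal \<Rightarrow> bool" where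
  "maxwellian_bounded T \<alpha> \<beta> f \<Lambda> \<longleftrightarrow> \<Lambda> < \<infinity> \<and>
     (AE q in lborel. fst q \<in> time_interval T \<longrightarrow>
        e2ennreal \<bar>f (fst q) (snd q)\<bar>
          \<le> \<Lambda> * ennreal (maxwellian \<alpha> \<beta> (fst (snd q) - fst q *\<^sub>R snd (snd q), snd (snd q))))"

lemma time_interval_borel [measurable]: "time_interval T \<in> sets borel"
proof -
  have "{t. 0 \<le> t \<and> ereal t < T} \<in> sets borel" by measurable
  then show ?thesis by (simp add: time_interval_def)
qed

text \<open>For each \<open>t\<close> the set of \<open>(x, v)\<close> violating the bound is null. Joint measurability of \<open>f\<close> makes the union
  of these sets Lebesgue measurable in \<open>(t, x, v)\<close>, up to a null set even Borel, and then Fubini shows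
  that it is null.\<close>

lemma maxwellian_bounded_sup_norm:
  fixes f :: "('n::finite) evolution"
  assumes meas: "jointly_measurable T f" and Linf: "transport f \<in> Linf_M T \<alpha> \<beta>"
  shows "maxwellian_bounded T \<alpha> \<beta> f (sup_norm T \<alpha> \<beta> (transport f))"
proof -
  define I where "I = time_interval T"
  define \<Lambda> where "\<Lambda> = sup_norm T \<alpha> \<beta> (transport f)"
  define h where "h q = \<Lambda> * ennreal (maxwellian \<alpha> \<beta> (fst (snd q) - fst q *\<^sub>R snd (snd q), snd (snd q)))"
    for q :: "real \<times> 'n vec2"
  have slice: "AE p in lborel. e2ennreal \<bar>f t p\<bar> \<le> h (t, p)" if t: "t \<in> I" for t
  proof -
    have ess: "AE p in lebesgue. e2ennreal \<bar>transport f t p * ereal (inverse (maxwellian \<alpha> \<beta> p))\<bar>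
        \<le> M_norm \<alpha> \<beta> (transport f t)"
      unfolding M_norm_def by (rule esssup_AE)
    have M_le: "M_norm \<alpha> \<beta> (transport f t) \<le> \<Lambda>"
      unfolding \<Lambda>_def sup_norm_def using t by (intro SUP_upper) (simp add: I_def)
    from ess have "AE p in lebesgue. e2ennreal \<bar>transport f t p\<bar> \<le> \<Lambda> * ennreal (maxwellian \<alpha> \<beta> p)"
    proof (rule eventually_mono)
      show "e2ennreal \<bar>transport f t p\<bar> \<le> \<Lambda> * ennreal (maxwellian \<alpha> \<beta> p)"
        if "e2ennreal \<bar>transport f t p * ereal (inverse (maxwellian \<alpha> \<beta> p))\<bar> \<le> M_norm \<alpha> \<beta> (transport f t)" for p
      proof -
        have m: "0 < maxwellian \<alpha> \<beta> p" by (rule maxwellian_pos)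
        have "e2ennreal \<bar>transport f t p\<bar> * ennreal (inverse (maxwellian \<alpha> \<beta> p)) \<le> \<Lambda>"
          using order_trans[OF that M_le] m
          by (simp add: e2ennreal_abs_mult e2ennreal_ereal)
        then have "e2ennreal \<bar>transport f t p\<bar> * ennreal (inverse (maxwellian \<alpha> \<beta> p)) * ennreal (maxwellian \<alpha> \<beta> p)
            \<le> \<Lambda> * ennreal (maxwellian \<alpha> \<beta> p)"
          by (rule mult_right_mono) simp
        then show ?thesis using m by (simp add: mult.assoc flip: ennreal_mult)
      qed
    qed
    then have ae: "AE p in lborel. e2ennreal \<bar>transport f t p\<bar> \<le> \<Lambda> * ennreal (maxwellian \<alpha> \<beta> p)"
      by (simp add: AE_completion_iff)
    \<comment> \<open>The shear inverse to transport by time \<open>t\<close> carries the bound from \<open>f\<^sup>#\<close> back to \<open>f\<close>.\<close>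
    define F :: "'n vec2 \<Rightarrow> 'n vec2" where "F p = (fst p - t *\<^sub>R snd p, snd p)" for p
    have "linear F" by (rule linearI) (auto simp: F_def algebra_simps)
    moreover have "inj F" by (rule injI) (auto simp: F_def prod_eq_iff)
    ultimately have "AE p in lborel. e2ennreal \<bar>transport f t (F p)\<bar> \<le> \<Lambda> * ennreal (maxwellian \<alpha> \<beta> (F p))"
      by (rule AE_lborel_linear_bij[OF _ _ ae])
    then show ?thesis by (simp add: F_def transport_def h_def)
  qed
  define Bad where "Bad = {q \<in> I \<times> UNIV. h q < e2ennreal \<bar>f (fst q) (snd q)\<bar>}"
  have Bad_meas: "Bad \<in> sets lebesgue"
  proof -
    have IU: "I \<times> (UNIV :: 'n vec2 set) \<in> sets borel"
    proof -
      have "I \<times> (UNIV :: 'n vec2 set) \<in> sets (borel \<Otimes>\<^sub>M borel)"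
        by (intro pair_measureI) (auto simp: I_def)
      then show ?thesis by (simp only: borel_prod)
    qed
    have "(\<lambda>(t, p). f t p) \<in> borel_measurable (lebesgue_on (I \<times> UNIV))"
      using meas by (simp add: jointly_measurable_def I_def)
    then have 1: "(\<lambda>q. e2ennreal \<bar>f (fst q) (snd q)\<bar>) \<in> borel_measurable (lebesgue_on (I \<times> UNIV))"
      by (intro measurable_compose[OF _ measurable_e2ennreal] borel_measurable_ereal_abs) (simp add: case_prod_beta')
    have "(\<lambda>q :: real \<times> 'n vec2. maxwellian \<alpha> \<beta> (fst (snd q) - fst q *\<^sub>R snd (snd q), snd (snd q))) \<in> borel_measurable borel"
      unfolding maxwellian_def prod.case
      by (intro borel_measurable_continuous_onI continuous_intros)
    then have "h \<in> borel_measurable borel" unfolding h_def by measurable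
    then have 2: "h \<in> borel_measurable (lebesgue_on (I \<times> UNIV))"
      by (intro measurable_restrict_space1 measurable_completion) simp
    have "Bad = {q \<in> space (lebesgue_on (I \<times> UNIV)). h q < e2ennreal \<bar>f (fst q) (snd q)\<bar>}"
      by (auto simp: Bad_def)
    also have "\<dots> \<in> sets (lebesgue_on (I \<times> UNIV))"
      using 1 2 by (rule borel_measurable_less[rotated])
    finally show ?thesis
      using IU by (subst (asm) sets_restrict_space_iff) auto
  qed
  have main_part_sub: "main_part lborel Bad \<subseteq> Bad"
    using main_part_null_part_Un[OF Bad_meas] by blast
  have "AE q in lborel. q \<notin> main_part lborel Bad"
  proof -
    have "Measurable.pred (lborel \<Otimes>\<^sub>M lborel) (\<lambda>q. q \<notin> main_part lborel Bad)"
      unfolding lborel_prod using main_part_sets[OF Bad_meas] by measurable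
    moreover have "AE t in lborel. AE p in lborel. (t, p) \<notin> main_part lborel Bad"
    proof (rule AE_I2)
      fix t
      show "AE p in lborel. (t, p) \<notin> main_part lborel Bad"
      proof (cases "t \<in> I")
        case True
        from slice[OF True] show ?thesis
        proof (rule eventually_mono)
          fix p assume "e2ennreal \<bar>f t p\<bar> \<le> h (t, p)"
          then have "(t, p) \<notin> Bad" by (simp add: Bad_def not_less)
          then show "(t, p) \<notin> main_part lborel Bad" using main_part_sub by blast
        qed
      next
        case False
        then have "(t, p) \<notin> Bad" for p by (simp add: Bad_def)
        then show ?thesis using main_part_sub by (intro AE_I2) blast
      qed
    qed
    ultimately have "AE q in lborel \<Otimes>\<^sub>M lborel. q \<notin> main_part lborel Bad"
      by (intro lborel_pair.AE_pair_measure) (simp_all only: pred_def)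
    then show ?thesis unfolding lborel_prod .
  qed
  moreover have "AE q in lborel. q \<notin> null_part lborel Bad"
    by (rule AE_notin_null_part[OF Bad_meas])
  ultimately have "AE q in lborel. q \<notin> Bad"
    by eventually_elim (use main_part_null_part_Un[OF Bad_meas] in blast)
  then have "AE q in lborel. fst q \<in> I \<longrightarrow> e2ennreal \<bar>f (fst q) (snd q)\<bar> \<le> h q"
    by (rule eventually_mono) (auto simp: Bad_def not_less)
  moreover have "\<Lambda> < \<infinity>" using Linf by (simp add: Linf_M_def \<Lambda>_def)
  ultimately show ?thesis unfolding maxwellian_bounded_def h_def \<Lambda>_def I_def by simp
qed

section \<open>Collision maps\<close>

text \<open>The first factor \<open>'e\<close> is the velocity at which a distribution function is evaluated, the second
  one collects all other velocities. Composing with a permutation of the velocities brings any of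
  them to the front; the identity covers the loss terms.\<close>

definition velocity_map :: "('o::euclidean_space \<Rightarrow> ('e::euclidean_space) \<times> ('w::euclidean_space) \<Rightarrow> 'e \<times> 'w) \<Rightarrow> bool" where
  "velocity_map T \<longleftrightarrow> (\<forall>\<omega>. norm \<omega> = 1 \<longrightarrow> linear (T \<omega>) \<and> inj (T \<omega>)) \<and>
     (\<lambda>(\<omega>, z). T \<omega> z) \<in> borel_measurable (sphere_measure \<Otimes>\<^sub>M borel)"

lemma velocity_map_comp:
  assumes T: "velocity_map T" and \<pi>: "linear \<pi>" "inj \<pi>"
  shows "velocity_map (\<lambda>\<omega> z. \<pi> (T \<omega> z))"
proof -
  have "linear (\<lambda>z. \<pi> (T \<omega> z))" "inj (\<lambda>z. \<pi> (T \<omega> z))" if "norm \<omega> = 1" for \<omega>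
    using T \<pi> that linear_compose[of "T \<omega>" \<pi>] inj_compose[of \<pi> "T \<omega>"] by (auto simp: velocity_map_def comp_def)
  moreover have \<pi>_meas: "\<pi> \<in> borel_measurable borel"
    using \<pi>(1) by (intro borel_measurable_continuous_onI linear_continuous_on linear_conv_bounded_linear[THEN iffD1])
  moreover have "(\<lambda>(\<omega>, z). T \<omega> z) \<in> borel_measurable (sphere_measure \<Otimes>\<^sub>M borel)"
    using T by (simp add: velocity_map_def)
  from measurable_compose[OF this \<pi>_meas]
  have "(\<lambda>(\<omega>, z). \<pi> (T \<omega> z)) \<in> borel_measurable (sphere_measure \<Otimes>\<^sub>M borel)"
    by (simp add: case_prod_beta')
  ultimately show ?thesis by (simp add: velocity_map_def)
qed

lemma velocity_map_ident: "velocity_map (\<lambda>\<omega> z. z)"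
  by (auto simp: velocity_map_def linear_id[unfolded id_def])

lemma AE_velocity_map:
  fixes T :: "('o::euclidean_space) \<Rightarrow> (real ^ 'n::finite) \<times> ('w::euclidean_space) \<Rightarrow> (real ^ 'n) \<times> 'w"
  assumes T: "velocity_map T" and f: "maxwellian_bounded \<T> \<alpha> \<beta> f \<Lambda>"
  shows "AE p in lborel. AE \<tau> in lborel. AE z in sphere_measure \<Otimes>\<^sub>M lborel. \<tau> \<in> time_interval \<T> \<longrightarrow>
    e2ennreal \<bar>f \<tau> (fst p + \<tau> *\<^sub>R snd p, fst (T (fst z) (snd p, snd z)))\<bar>
      \<le> \<Lambda> * ennreal (maxwellian \<alpha> \<beta> (fst p + \<tau> *\<^sub>R snd p - \<tau> *\<^sub>R fst (T (fst z) (snd p, snd z)),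
              fst (T (fst z) (snd p, snd z))))"
proof -
  interpret S: finite_measure "sphere_measure :: 'o measure" by (rule finite_measure_sphere_measure)
  have "(\<lambda>(\<omega>, z). fst (T \<omega> z)) \<in> borel_measurable (sphere_measure \<Otimes>\<^sub>M borel)"
    using measurable_compose[of "\<lambda>(\<omega>, z). T \<omega> z" _ borel fst borel] T
    by (simp add: velocity_map_def case_prod_beta' borel_measurable_continuous_onI continuous_on_fst)
  from AE_along_collision[OF S.sigma_finite_measure_axioms _ _ this,
      where P = "\<lambda>\<tau> y. \<tau> \<in> time_interval \<T> \<longrightarrow> e2ennreal \<bar>f \<tau> y\<bar>
          \<le> \<Lambda> * ennreal (maxwellian \<alpha> \<beta> (fst y - \<tau> *\<^sub>R snd y, snd y))"]
  show ?thesis using T f by (simp add: velocity_map_def maxwellian_bounded_def)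
qed

definition binary_collision :: "real ^ 'n::finite \<Rightarrow> 'n vec2 \<Rightarrow> 'n vec2" where
  "binary_collision \<omega> = (\<lambda>(v, v1). (v + (\<omega> \<bullet> (v1 - v)) *\<^sub>R \<omega>, v1 - (\<omega> \<bullet> (v1 - v)) *\<^sub>R \<omega>))"

definition ternary_collision :: "'n::finite vec2 \<Rightarrow> (real ^ 'n) \<times> 'n vec2 \<Rightarrow> (real ^ 'n) \<times> 'n vec2" where
  "ternary_collision \<omega> = (\<lambda>(v, v1, v2). (v + ternary_c \<omega> v v1 v2 *\<^sub>R (fst \<omega> + snd \<omega>),
     v1 - ternary_c \<omega> v v1 v2 *\<^sub>R fst \<omega>, v2 - ternary_c \<omega> v v1 v2 *\<^sub>R snd \<omega>))"

lemma velocity_map_involution: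
  assumes "\<And>\<omega>. norm \<omega> = 1 \<Longrightarrow> linear (T \<omega>)" "\<And>\<omega> z. norm \<omega> = 1 \<Longrightarrow> T \<omega> (T \<omega> z) = z"
    "(\<lambda>(\<omega>, z). T \<omega> z) \<in> borel_measurable (borel \<Otimes>\<^sub>M borel)"
  shows "velocity_map T"
proof -
  have "inj (T \<omega>)" if "norm \<omega> = 1" for \<omega>
    using assms(2)[OF that] by (metis injI)
  moreover have "(\<lambda>z. (fst z, snd z)) \<in> sphere_measure \<Otimes>\<^sub>M borel \<rightarrow>\<^sub>M borel \<Otimes>\<^sub>M borel"
    by (intro measurable_Pair measurable_compose[OF measurable_fst measurable_ident_sphere_measure] measurable_snd)
  from measurable_compose[OF this assms(3)]
  have "(\<lambda>(\<omega>, z). T \<omega> z) \<in> borel_measurable (sphere_measure \<Otimes>\<^sub>M borel)"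
    by (simp add: case_prod_beta')
  ultimately show ?thesis using assms(1) by (simp add: velocity_map_def)
qed

text \<open>Both collisions are involutions, since the component of the relative velocity along the impact
  direction changes sign; hence they are bijective.\<close>

lemma velocity_map_binary_collision: "velocity_map binary_collision"
proof (rule velocity_map_involution)
  fix \<omega> :: "real ^ 'n" and z assume \<omega>: "norm \<omega> = 1"
  show "linear (binary_collision \<omega>)"
    by (rule linearI) (auto simp: binary_collision_def algebra_simps inner_simps)
  have "\<omega> \<bullet> \<omega> = 1" using \<omega> by (simp add: power2_norm_eq_inner[symmetric])
  then show "binary_collision \<omega> (binary_collision \<omega> z) = z"
    by (cases z) (simp add: binary_collision_def inner_simps, simp add: algebra_simps)
next
  show "(\<lambda>(\<omega>, z). binary_collision \<omega> z) \<in> borel_measurable (borel \<Otimes>\<^sub>M borel)"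
    unfolding binary_collision_def case_prod_beta' borel_prod
    by (intro borel_measurable_continuous_onI continuous_intros)
qed

text \<open>In particular the denominator \<open>1 + \<omega>\<^sub>1 \<bullet> \<omega>\<^sub>2\<close> of the ternary collision law is at least \<open>1/2\<close>.\<close>

lemma abs_inner_components_le_half:
  fixes \<omega> :: "('a::real_inner) \<times> 'a"
  assumes "norm \<omega> = 1"
  shows "\<bar>fst \<omega> \<bullet> snd \<omega>\<bar> \<le> 1 / 2"
proof -
  have "(norm (fst \<omega>))\<^sup>2 + (norm (snd \<omega>))\<^sup>2 = 1"
    using assms by (metis norm_prod_def prod.collapse norm_Pair power_one real_sqrt_eq_1_iff)
  moreover have "2 * (norm (fst \<omega>) * norm (snd \<omega>)) \<le> (norm (fst \<omega>))\<^sup>2 + (norm (snd \<omega>))\<^sup>2"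
    using sum_squares_bound[of "norm (fst \<omega>)" "norm (snd \<omega>)"] by simp
  ultimately show ?thesis using Cauchy_Schwarz_ineq2[of "fst \<omega>" "snd \<omega>"] by linarith
qed

lemma velocity_map_ternary_collision: "velocity_map (ternary_collision :: 'n::finite vec2 \<Rightarrow> _)"
proof (rule velocity_map_involution)
  fix \<omega> :: "'n vec2" and z :: "(real ^ 'n) \<times> 'n vec2" assume \<omega>: "norm \<omega> = 1"
  obtain a b where ab: "\<omega> = (a, b)" by (cases \<omega>)
  obtain v v1 v2 where z: "z = (v, v1, v2)" by (cases z) auto
  have lin: "ternary_c \<omega> (v + v') (v1 + v1') (v2 + v2') = ternary_c \<omega> v v1 v2 + ternary_c \<omega> v' v1' v2'"
    "ternary_c \<omega> (r *\<^sub>R v) (r *\<^sub>R v1) (r *\<^sub>R v2) = r * ternary_c \<omega> v v1 v2" for v v1 v2 v' v1' v2' r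
    by (simp_all add: ternary_c_def inner_simps add_divide_distrib[symmetric]) (simp_all add: algebra_simps)
  show "linear (ternary_collision \<omega>)"
    by (rule linearI) (auto simp: ternary_collision_def lin algebra_simps)
  have norm1: "a \<bullet> a + b \<bullet> b = 1"
    using \<omega> by (simp add: ab norm_eq_1)
  have pos: "0 < 1 + a \<bullet> b" using abs_inner_components_le_half[OF \<omega>] by (simp add: ab abs_le_iff)
  define c where "c = ternary_c \<omega> v v1 v2"
  have c: "c * (1 + a \<bullet> b) = a \<bullet> (v1 - v) + b \<bullet> (v2 - v)"
    using pos by (simp add: c_def ternary_c_def ab)
  \<comment> \<open>The collision reverses the sign of \<open>c\<close>.\<close>
  have "a \<bullet> (v1 - c *\<^sub>R a - (v + c *\<^sub>R (a + b))) + b \<bullet> (v2 - c *\<^sub>R b - (v + c *\<^sub>R (a + b)))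
      = (a \<bullet> (v1 - v) + b \<bullet> (v2 - v)) - 2 * c * (a \<bullet> a + b \<bullet> b) - 2 * c * (a \<bullet> b)"
    by (simp add: inner_simps inner_commute[of b a]) (simp add: algebra_simps)
  also have "\<dots> = - c * (1 + a \<bullet> b)"
    unfolding norm1 c[symmetric] by (simp add: algebra_simps)
  finally have "ternary_c \<omega> (v + c *\<^sub>R (a + b)) (v1 - c *\<^sub>R a) (v2 - c *\<^sub>R b) = - c"
    using pos by (simp add: ternary_c_def ab)
  moreover have "ternary_collision \<omega> z = (v + c *\<^sub>R (a + b), v1 - c *\<^sub>R a, v2 - c *\<^sub>R b)"
    unfolding c_def by (simp add: z ternary_collision_def ab)
  ultimately show "ternary_collision \<omega> (ternary_collision \<omega> z) = z"
    by (simp add: z ternary_collision_def[of \<omega>]) (simp add: ab)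
next
  show "(\<lambda>(\<omega>, z). ternary_collision \<omega> z) \<in> borel_measurable (borel \<Otimes>\<^sub>M borel)"
    unfolding ternary_collision_def ternary_c_def case_prod_beta' borel_prod
    by (intro borel_measurable_Pair borel_measurable_add borel_measurable_diff borel_measurable_scaleR
          borel_measurable_divide) (intro borel_measurable_continuous_onI continuous_intros)+
qed

lemma binary_collision_conserves:
  assumes "norm \<omega> = 1"
  shows "fst (binary_collision \<omega> (v, v1)) + snd (binary_collision \<omega> (v, v1)) = v + v1"
    "(norm (fst (binary_collision \<omega> (v, v1))))\<^sup>2 + (norm (snd (binary_collision \<omega> (v, v1))))\<^sup>2
      = (norm v)\<^sup>2 + (norm v1)\<^sup>2"
proof -
  have "\<omega> \<bullet> \<omega> = 1" using assms by (simp add: power2_norm_eq_inner[symmetric])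
  then show "(norm (fst (binary_collision \<omega> (v, v1))))\<^sup>2 + (norm (snd (binary_collision \<omega> (v, v1))))\<^sup>2
      = (norm v)\<^sup>2 + (norm v1)\<^sup>2"
    unfolding power2_norm_eq_inner
    by (simp add: binary_collision_def inner_simps inner_commute power2_eq_square) (simp add: algebra_simps)
qed (simp add: binary_collision_def)


lemma ternary_collision_conserves:
  fixes \<omega> :: "'n::finite vec2"
  assumes \<omega>: "norm \<omega> = 1" and z': "ternary_collision \<omega> (v, v1, v2) = (v', v1', v2')"
  shows "v' + v1' + v2' = v + v1 + v2"
    "(norm v')\<^sup>2 + (norm v1')\<^sup>2 + (norm v2')\<^sup>2 = (norm v)\<^sup>2 + (norm v1)\<^sup>2 + (norm v2)\<^sup>2"
proof -
  obtain a b where ab: "\<omega> = (a, b)" by (cases \<omega>)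
  define c where "c = ternary_c \<omega> v v1 v2"
  have norm1: "a \<bullet> a + b \<bullet> b = 1" using \<omega> by (simp add: ab norm_eq_1)
  have pos: "0 < 1 + a \<bullet> b" using abs_inner_components_le_half[OF \<omega>] by (simp add: ab abs_le_iff)
  have c: "c * (1 + a \<bullet> b) = a \<bullet> (v1 - v) + b \<bullet> (v2 - v)"
    using pos by (simp add: c_def ternary_c_def ab)
  have z'_eq: "v' = v + c *\<^sub>R (a + b)" "v1' = v1 - c *\<^sub>R a" "v2' = v2 - c *\<^sub>R b"
    using z' by (auto simp: ternary_collision_def c_def ab)
  show "v' + v1' + v2' = v + v1 + v2" unfolding z'_eq by (simp add: algebra_simps)
  have "v' \<bullet> v' + v1' \<bullet> v1' + v2' \<bullet> v2' = v \<bullet> v + v1 \<bullet> v1 + v2 \<bullet> v2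
      + c * (2 * c * (a \<bullet> a + b \<bullet> b) + 2 * (c * (a \<bullet> b)) - 2 * (a \<bullet> (v1 - v) + b \<bullet> (v2 - v)))"
    unfolding z'_eq
    by (simp add: inner_simps inner_commute algebra_simps)
  also have "2 * c * (a \<bullet> a + b \<bullet> b) + 2 * (c * (a \<bullet> b)) - 2 * (a \<bullet> (v1 - v) + b \<bullet> (v2 - v)) = 0"
    unfolding norm1 c[symmetric] by (simp add: algebra_simps)
  finally show "(norm v')\<^sup>2 + (norm v1')\<^sup>2 + (norm v2')\<^sup>2 = (norm v)\<^sup>2 + (norm v1)\<^sup>2 + (norm v2)\<^sup>2"
    by (simp add: power2_norm_eq_inner)
qed

section \<open>Conservation laws and the common majorant\<close>

lemma norm_diff_scaleR_sq:
  fixes y u :: "'a::real_inner"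
  shows "(norm (y - \<tau> *\<^sub>R u))\<^sup>2 = (norm y)\<^sup>2 - 2 * \<tau> * (y \<bullet> u) + \<tau>\<^sup>2 * (norm u)\<^sup>2"
  unfolding power2_norm_eq_inner by (simp add: inner_commute power2_eq_square algebra_simps)

text \<open>With \<open>y = x + \<tau>v\<close>, expanding the squares shows that \<open>\<Sum>|y - \<tau>v\<^sub>i|\<^sup>2\<close> is a function of the total momentum
  and energy, so the primed velocities may be replaced by the unprimed ones. The particle with
  velocity \<open>v\<close> then contributes \<open>M\<^sub>\<alpha>\<^sub>,\<^sub>\<beta>(x, v)\<close>.\<close>

lemma maxwellian_binary_conserved:
  fixes v v1 v' v1' :: "real ^ 'n::finite"
  assumes mom: "v' + v1' = v + v1" and en: "(norm v')\<^sup>2 + (norm v1')\<^sup>2 = (norm v)\<^sup>2 + (norm v1)\<^sup>2"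
  shows "maxwellian \<alpha> \<beta> (x + \<tau> *\<^sub>R v - \<tau> *\<^sub>R v', v') * maxwellian \<alpha> \<beta> (x + \<tau> *\<^sub>R v - \<tau> *\<^sub>R v1', v1')
    = maxwellian \<alpha> \<beta> (x, v) * exp (- \<alpha> * (norm (x - \<tau> *\<^sub>R (v1 - v)))\<^sup>2 - \<beta> * (norm v1)\<^sup>2)"
proof -
  define y where "y = x + \<tau> *\<^sub>R v"
  have xs: "x = y - \<tau> *\<^sub>R v" "x - \<tau> *\<^sub>R (v1 - v) = y - \<tau> *\<^sub>R v1" by (simp_all add: y_def algebra_simps)
  have "(norm (y - \<tau> *\<^sub>R v'))\<^sup>2 + (norm (y - \<tau> *\<^sub>R v1'))\<^sup>2
      = 2 * (norm y)\<^sup>2 - 2 * \<tau> * (y \<bullet> (v' + v1')) + \<tau>\<^sup>2 * ((norm v')\<^sup>2 + (norm v1')\<^sup>2)"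
    by (simp add: norm_diff_scaleR_sq inner_add_right algebra_simps)
  also have "\<dots> = (norm (y - \<tau> *\<^sub>R v))\<^sup>2 + (norm (y - \<tau> *\<^sub>R v1))\<^sup>2"
    unfolding mom en by (simp add: norm_diff_scaleR_sq inner_add_right algebra_simps)
  finally have pos: "(norm (y - \<tau> *\<^sub>R v'))\<^sup>2 + (norm (y - \<tau> *\<^sub>R v1'))\<^sup>2
      = (norm x)\<^sup>2 + (norm (x - \<tau> *\<^sub>R (v1 - v)))\<^sup>2" unfolding xs(2) unfolding xs(1) .
  have "- \<alpha> * (norm (y - \<tau> *\<^sub>R v'))\<^sup>2 - \<beta> * (norm v')\<^sup>2 + (- \<alpha> * (norm (y - \<tau> *\<^sub>R v1'))\<^sup>2 - \<beta> * (norm v1')\<^sup>2)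
    = - \<alpha> * ((norm (y - \<tau> *\<^sub>R v'))\<^sup>2 + (norm (y - \<tau> *\<^sub>R v1'))\<^sup>2) - \<beta> * ((norm v')\<^sup>2 + (norm v1')\<^sup>2)"
    by (simp add: algebra_simps)
  also have "\<dots> = - \<alpha> * (norm x)\<^sup>2 - \<beta> * (norm v)\<^sup>2 + (- \<alpha> * (norm (x - \<tau> *\<^sub>R (v1 - v)))\<^sup>2 - \<beta> * (norm v1)\<^sup>2)"
    unfolding pos en by (simp add: algebra_simps)
  finally show ?thesis unfolding maxwellian_def y_def[symmetric] prod.case exp_add[symmetric] by (rule arg_cong)
qed

lemma maxwellian_ternary_conserved:
  fixes v v1 v2 v' v1' v2' :: "real ^ 'n::finite"
  assumes mom: "v' + v1' + v2' = v + v1 + v2"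
    and en: "(norm v')\<^sup>2 + (norm v1')\<^sup>2 + (norm v2')\<^sup>2 = (norm v)\<^sup>2 + (norm v1)\<^sup>2 + (norm v2)\<^sup>2"
  shows "maxwellian \<alpha> \<beta> (x + \<tau> *\<^sub>R v - \<tau> *\<^sub>R v', v') * maxwellian \<alpha> \<beta> (x + \<tau> *\<^sub>R v - \<tau> *\<^sub>R v1', v1')
      * maxwellian \<alpha> \<beta> (x + \<tau> *\<^sub>R v - \<tau> *\<^sub>R v2', v2')
    = maxwellian \<alpha> \<beta> (x, v) * exp (- \<alpha> * (norm ((x, x) - \<tau> *\<^sub>R ((v1, v2) - (v, v))))\<^sup>2 - \<beta> * (norm (v1, v2))\<^sup>2)"
proof -
  define y where "y = x + \<tau> *\<^sub>R v"
  have xs: "x = y - \<tau> *\<^sub>R v" "x - \<tau> *\<^sub>R (v1 - v) = y - \<tau> *\<^sub>R v1" "x - \<tau> *\<^sub>R (v2 - v) = y - \<tau> *\<^sub>R v2"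
    by (simp_all add: y_def algebra_simps)
  have pair: "(norm ((x, x) - \<tau> *\<^sub>R ((v1, v2) - (v, v))))\<^sup>2
      = (norm (x - \<tau> *\<^sub>R (v1 - v)))\<^sup>2 + (norm (x - \<tau> *\<^sub>R (v2 - v)))\<^sup>2"
      "(norm (v1, v2))\<^sup>2 = (norm v1)\<^sup>2 + (norm v2)\<^sup>2"
    by (simp_all add: norm_Pair)
  have "(norm (y - \<tau> *\<^sub>R v'))\<^sup>2 + (norm (y - \<tau> *\<^sub>R v1'))\<^sup>2 + (norm (y - \<tau> *\<^sub>R v2'))\<^sup>2
      = 3 * (norm y)\<^sup>2 - 2 * \<tau> * (y \<bullet> (v' + v1' + v2')) + \<tau>\<^sup>2 * ((norm v')\<^sup>2 + (norm v1')\<^sup>2 + (norm v2')\<^sup>2)"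
    by (simp add: norm_diff_scaleR_sq inner_add_right algebra_simps)
  also have "\<dots> = (norm (y - \<tau> *\<^sub>R v))\<^sup>2 + (norm (y - \<tau> *\<^sub>R v1))\<^sup>2 + (norm (y - \<tau> *\<^sub>R v2))\<^sup>2"
    unfolding mom en by (simp add: norm_diff_scaleR_sq inner_add_right algebra_simps)
  finally have pos: "(norm (y - \<tau> *\<^sub>R v'))\<^sup>2 + (norm (y - \<tau> *\<^sub>R v1'))\<^sup>2 + (norm (y - \<tau> *\<^sub>R v2'))\<^sup>2
      = (norm x)\<^sup>2 + (norm (x - \<tau> *\<^sub>R (v1 - v)))\<^sup>2 + (norm (x - \<tau> *\<^sub>R (v2 - v)))\<^sup>2" unfolding xs(2,3) unfolding xs(1) .
  have "- \<alpha> * (norm (y - \<tau> *\<^sub>R v'))\<^sup>2 - \<beta> * (norm v')\<^sup>2 + (- \<alpha> * (norm (y - \<tau> *\<^sub>R v1'))\<^sup>2 - \<beta> * (norm v1')\<^sup>2)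
      + (- \<alpha> * (norm (y - \<tau> *\<^sub>R v2'))\<^sup>2 - \<beta> * (norm v2')\<^sup>2)
    = - \<alpha> * ((norm (y - \<tau> *\<^sub>R v'))\<^sup>2 + (norm (y - \<tau> *\<^sub>R v1'))\<^sup>2 + (norm (y - \<tau> *\<^sub>R v2'))\<^sup>2)
      - \<beta> * ((norm v')\<^sup>2 + (norm v1')\<^sup>2 + (norm v2')\<^sup>2)"
    by (simp add: algebra_simps)
  also have "\<dots> = - \<alpha> * (norm x)\<^sup>2 - \<beta> * (norm v)\<^sup>2
      + (- \<alpha> * (norm ((x, x) - \<tau> *\<^sub>R ((v1, v2) - (v, v))))\<^sup>2 - \<beta> * (norm (v1, v2))\<^sup>2)"
    unfolding pos en pair by (simp add: algebra_simps)
  finally show ?thesis unfolding maxwellian_def y_def[symmetric] prod.case exp_add[symmetric] by (rule arg_cong)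
qed

section \<open>Angular integrals of the collision kernels\<close>

lemma B2_nonneg:
  assumes "binary_density d b" "norm \<omega> = 1"
  shows "0 \<le> B2 \<gamma> b u \<omega>"
proof -
  have "\<bar>(u /\<^sub>R norm u) \<bullet> \<omega>\<bar> \<le> norm (u /\<^sub>R norm u) * norm \<omega>" by (rule Cauchy_Schwarz_ineq2)
  also have "\<dots> \<le> 1" using assms(2) by (cases "u = 0") auto
  finally have "(u /\<^sub>R norm u) \<bullet> \<omega> \<in> {-1..1}" by (auto simp: abs_le_iff)
  then show ?thesis using assms(1) unfolding B2_def binary_density_def by simp
qed

lemma nn_integral_B2_le:
  fixes u :: "real ^ 'n::finite"
  assumes d: "2 \<le> CARD('n)" and b: "binary_density CARD('n) b"
  shows "(\<integral>\<^sup>+ \<omega>. ennreal (B2 \<gamma> b u \<omega>) \<partial>sphere_measure) \<le> 2 * b2_norm CARD('n) b * ennreal (norm u powr \<gamma>)"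
proof (cases "u = 0")
  case False
  have "(\<integral>\<^sup>+ \<omega>. ennreal (B2 \<gamma> b u \<omega>) \<partial>sphere_measure)
    = (\<integral>\<^sup>+ \<omega>. ennreal (norm u powr \<gamma>) * ennreal (b ((u /\<^sub>R norm u) \<bullet> \<omega>)) \<partial>sphere_measure)"
    by (simp add: B2_def ennreal_mult')
  also have "\<dots> \<le> ennreal (norm u powr \<gamma>) * (\<integral>\<^sup>+ \<omega>. ennreal (b ((u /\<^sub>R norm u) \<bullet> \<omega>)) \<partial>sphere_measure)"
    by (rule nn_integral_cmult_le) simp
  also have "\<dots> \<le> ennreal (norm u powr \<gamma>) * (2 * b2_norm CARD('n) b)"
    using b False by (intro mult_left_mono nn_integral_sphere_direction_le d) (auto simp: binary_density_def)
  finally show ?thesis by (simp add: mult_ac)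
qed (simp add: B2_def)

text \<open>The ternary kernel is expressed through \<^const>\<open>utilde_norm\<close>, while the dispersive estimate uses the Euclidean norm
  of the pair of relative velocities; the two are equivalent.\<close>

lemma utilde_norm_bounds:
  shows "norm u \<le> utilde_norm u" "utilde_norm u \<le> sqrt 3 * norm u"
proof -
  obtain a b where u: "u = (a, b)" by (cases u)
  show "norm u \<le> utilde_norm u"
    by (simp add: u utilde_norm_def norm_Pair)
  have "(norm (a - b))\<^sup>2 \<le> (norm a + norm b)\<^sup>2"
    by (intro power_mono norm_triangle_ineq4) simp
  also have "\<dots> \<le> 2 * (norm a)\<^sup>2 + 2 * (norm b)\<^sup>2"
    using sum_squares_bound[of "norm a" "norm b"] by (simp add: power2_sum)
  finally show "utilde_norm u \<le> sqrt 3 * norm u"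
    by (simp add: u utilde_norm_def norm_Pair flip: real_sqrt_mult)
qed

lemma normalized_in_ellipsoid:
  assumes "u \<noteq> 0"
  shows "u /\<^sub>R utilde_norm u \<in> ellipsoid"
proof -
  obtain a b where u: "u = (a, b)" by (cases u)
  define N where "N = utilde_norm u"
  have N: "0 < N" using utilde_norm_bounds(1)[of u] assms by (simp add: N_def) (metis less_le_trans zero_less_norm_iff)
  have N2: "N\<^sup>2 = (norm a)\<^sup>2 + (norm b)\<^sup>2 + (norm (a - b))\<^sup>2" by (simp add: N_def utilde_norm_def u)
  have "(norm (a /\<^sub>R N))\<^sup>2 + (norm (b /\<^sub>R N))\<^sup>2 + (norm (a /\<^sub>R N - b /\<^sub>R N))\<^sup>2
    = ((norm a)\<^sup>2 + (norm b)\<^sup>2 + (norm (a - b))\<^sup>2) / N\<^sup>2"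
    using N by (simp add: scaleR_diff_right[symmetric] power_mult_distrib power_inverse divide_inverse distrib_right)
  also have "\<dots> = 1" using N unfolding N2[symmetric] by simp
  finally show ?thesis by (simp add: ellipsoid_def u N_def)
qed

text \<open>For \<open>\<gamma> \<ge> 0\<close> the upper bound on \<^const>\<open>utilde_norm\<close> is used, with \<open>3\<^sup>\<gamma>\<^sup>/\<^sup>2 \<le> 3\<^sup>1\<^sup>/\<^sup>2\<close>; for \<open>\<gamma> < 0\<close> the lower one.\<close>

lemma utilde_norm_powr_le:
  assumes "\<gamma> \<le> 1"
  shows "utilde_norm u powr \<gamma> \<le> sqrt 3 * norm u powr \<gamma>"
proof (cases "u = 0")
  case True
  then show ?thesis by (simp add: utilde_norm_def)
next
  case False
  then have u: "0 < norm u" by simp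
  show ?thesis
  proof (cases "0 \<le> \<gamma>")
    case True
    have "utilde_norm u powr \<gamma> \<le> (sqrt 3 * norm u) powr \<gamma>"
      using True utilde_norm_bounds[of u] order_trans[OF norm_ge_zero utilde_norm_bounds(1)]
      by (intro powr_mono2)
    also have "\<dots> = sqrt 3 powr \<gamma> * norm u powr \<gamma>" by (simp add: powr_mult)
    also have "\<dots> \<le> sqrt 3 powr 1 * norm u powr \<gamma>"
      using assms by (intro mult_right_mono powr_mono) auto
    finally show ?thesis by simp
  next
    case False
    then have "utilde_norm u powr \<gamma> \<le> norm u powr \<gamma>"
      using utilde_norm_bounds[of u] u by (intro powr_mono2') auto
    also have "\<dots> \<le> sqrt 3 * norm u powr \<gamma>"
      using mult_right_mono[of 1 "sqrt 3" "norm u powr \<gamma>"] by simp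
    finally show ?thesis .
  qed
qed

lemma B3_nonneg:
  fixes \<omega> :: "'n::finite vec2"
  assumes b: "ternary_density TYPE('n) b" and \<omega>: "norm \<omega> = 1"
  shows "0 \<le> B3 \<gamma> b u \<omega>"
proof -
  have "norm (u /\<^sub>R utilde_norm u) \<le> 1"
    using utilde_norm_bounds(1)[of u] norm_ge_zero[of u] by (auto simp: inverse_eq_divide divide_le_eq_1)
  moreover have "\<bar>(u /\<^sub>R utilde_norm u) \<bullet> \<omega>\<bar> \<le> norm (u /\<^sub>R utilde_norm u) * norm \<omega>" by (rule Cauchy_Schwarz_ineq2)
  ultimately have "\<bar>(u /\<^sub>R utilde_norm u) \<bullet> \<omega>\<bar> \<le> 1" using \<omega> by simp
  then have "(u /\<^sub>R utilde_norm u) \<bullet> \<omega> \<in> {-1..1}" by (auto simp: abs_le_iff)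
  moreover have "fst \<omega> \<bullet> snd \<omega> \<in> {-1/2..1/2}" using abs_inner_components_le_half[OF \<omega>] by (auto simp: abs_le_iff)
  ultimately show ?thesis using b unfolding B3_def ternary_density_def by simp
qed

text \<open>For \<open>u \<noteq> 0\<close> the normalized relative velocity is one of the points \<open>\<nu>\<close> of the ellipsoid over which
  the norm of \<open>b\<^sub>3\<close> takes the supremum; for \<open>u = 0\<close> the kernel vanishes, \<open>0\<close> to any real power being \<open>0\<close>.\<close>

lemma nn_integral_B3_le:
  fixes u :: "'n::finite vec2"
  assumes "\<gamma> \<le> 1"
  shows "(\<integral>\<^sup>+ \<omega>. ennreal (B3 \<gamma> b u \<omega>) \<partial>sphere_measure)
    \<le> ennreal (sqrt 3) * b3_norm TYPE('n) b * ennreal (norm u powr \<gamma>)"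
proof (cases "u = 0")
  case True
  then show ?thesis by (simp add: B3_def utilde_norm_def)
next
  case False
  let ?c = "ennreal (utilde_norm u powr \<gamma>)"
  have "(\<integral>\<^sup>+ \<omega>. ennreal (B3 \<gamma> b u \<omega>) \<partial>sphere_measure)
    = (\<integral>\<^sup>+ \<omega>. ?c * ennreal (b ((u /\<^sub>R utilde_norm u) \<bullet> \<omega>) (fst \<omega> \<bullet> snd \<omega>)) \<partial>sphere_measure)"
    by (simp add: B3_def ennreal_mult')
  also have "\<dots> \<le> ?c * (\<integral>\<^sup>+ \<omega>. ennreal (b ((u /\<^sub>R utilde_norm u) \<bullet> \<omega>) (fst \<omega> \<bullet> snd \<omega>)) \<partial>sphere_measure)"
    by (rule nn_integral_cmult_le) simp
  also have "\<dots> \<le> ?c * b3_norm TYPE('n) b"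
    unfolding b3_norm_def by (intro mult_left_mono SUP_upper normalized_in_ellipsoid False) simp
  also have "\<dots> \<le> ennreal (sqrt 3 * norm u powr \<gamma>) * b3_norm TYPE('n) b"
    using assms by (intro mult_right_mono ennreal_leI utilde_norm_powr_le) auto
  finally show ?thesis by (simp add: ennreal_mult mult_ac)
qed

section \<open>Pointwise bounds for the transported operators\<close>

text \<open>What remains at time \<open>\<tau>\<close> of the common majorant of gain and loss terms once the kernel is integrated
  over the angles and the factor \<open>M\<^sub>\<alpha>\<^sub>,\<^sub>\<beta>(x, v)\<close> is taken out.\<close>

definition dispersed_mass :: "real \<Rightarrow> real \<Rightarrow> real \<Rightarrow> 'w::euclidean_space \<Rightarrow> 'w \<Rightarrow> real \<Rightarrow> ennreal" where
  "dispersed_mass \<gamma> \<alpha> \<beta> X a \<tau> = (\<integral>\<^sup>+ w. ennreal (norm (w - a) powr \<gamma> *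
     exp (- \<alpha> * (norm (X - \<tau> *\<^sub>R (w - a)))\<^sup>2 - \<beta> * (norm w)\<^sup>2)) \<partial>lborel)"

lemma dispersed_mass_measurable [measurable]: "dispersed_mass \<gamma> \<alpha> \<beta> X a \<in> borel_measurable borel"
  unfolding dispersed_mass_def by measurable

text \<open>Gain and loss operators differ only in the velocities at which the distribution functions are
  evaluated; \<open>T\<close> is the collision for the gain term and the identity for the loss term.\<close>

definition binary_operator where
  "binary_operator \<gamma> b T f g = (\<lambda>t (x, v). ereal_integral (sphere_measure \<Otimes>\<^sub>M lborel)
     (\<lambda>(\<omega>, v1). ereal (B2 \<gamma> b (v1 - v) \<omega>) * f t (x, fst (T \<omega> (v, v1))) * g t (x, snd (T \<omega> (v, v1)))))"

definition ternary_operator where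
  "ternary_operator \<gamma> b T f g h = (\<lambda>t (x, v). ereal_integral (sphere_measure \<Otimes>\<^sub>M lborel)
     (\<lambda>(\<omega>, (v1, v2)). ereal (B3 \<gamma> b (v1 - v, v2 - v) \<omega>)
        * f t (x, fst (T \<omega> (v, v1, v2)))
        * g t (x, fst (snd (T \<omega> (v, v1, v2))))
        * h t (x, snd (snd (T \<omega> (v, v1, v2))))))"

lemma collision_operators_eq:
  "L2 \<gamma> b f g = binary_operator \<gamma> b (\<lambda>\<omega> z. z) f g"
  "G2 \<gamma> b f g = binary_operator \<gamma> b binary_collision f g"
  "L3 \<gamma> b' f g h = ternary_operator \<gamma> b' (\<lambda>\<omega> z. z) f g h"
  "G3 \<gamma> b' f g h = ternary_operator \<gamma> b' ternary_collision f g h"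
  by (simp_all add: L2_def G2_def L3_def G3_def binary_operator_def ternary_operator_def
      binary_collision_def ternary_collision_def)

lemma transport_eq: "transport F \<tau> p = F \<tau> (fst p + \<tau> *\<^sub>R snd p, snd p)"
  by (simp add: transport_def case_prod_beta')

text \<open>The product of Maxwellians sees the collision through its conservation laws alone, so that gain and
  loss terms are treated at once.\<close>

lemma binary_operator_transport_le:
  fixes f g :: "'n::finite evolution"
  assumes d: "2 \<le> CARD('n)" and b: "binary_density CARD('n) b"
    and T: "velocity_map T"
    and mom: "\<And>\<omega> v v1. norm \<omega> = 1 \<Longrightarrow> fst (T \<omega> (v, v1)) + snd (T \<omega> (v, v1)) = v + v1"
    and en: "\<And>\<omega> v v1. norm \<omega> = 1 \<Longrightarrow>
      (norm (fst (T \<omega> (v, v1))))\<^sup>2 + (norm (snd (T \<omega> (v, v1))))\<^sup>2 = (norm v)\<^sup>2 + (norm v1)\<^sup>2"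
    and f: "maxwellian_bounded \<T> \<alpha> \<beta> f \<Lambda>f" and g: "maxwellian_bounded \<T> \<alpha> \<beta> g \<Lambda>g"
  shows "AE p in lborel. AE \<tau> in lborel. \<tau> \<in> time_interval \<T> \<longrightarrow>
    e2ennreal \<bar>transport (binary_operator \<gamma> b T f g) \<tau> p\<bar>
      \<le> 2 * b2_norm CARD('n) b * (\<Lambda>f * \<Lambda>g * ennreal (maxwellian \<alpha> \<beta> p))
        * dispersed_mass \<gamma> \<alpha> \<beta> (fst p) (snd p) \<tau>"
proof -
  interpret S: finite_measure "sphere_measure :: (real ^ 'n) measure" by (rule finite_measure_sphere_measure)
  have T': "velocity_map (\<lambda>\<omega> z. prod.swap (T \<omega> z))"
    using T by (rule velocity_map_comp) (auto intro!: linearI)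
  from AE_velocity_map[OF T f] AE_velocity_map[OF T' g] show ?thesis
  proof eventually_elim
    case (elim p)
    obtain x v where p: "p = (x, v)" by (cases p)
    from elim show ?case
    proof eventually_elim
      case (elim \<tau>)
      show ?case
      proof
        assume \<tau>: "\<tau> \<in> time_interval \<T>"
        let ?y = "x + \<tau> *\<^sub>R v"
        have "e2ennreal \<bar>ereal_integral (sphere_measure \<Otimes>\<^sub>M lborel) (\<lambda>(\<omega>, v1). ereal (B2 \<gamma> b (v1 - v) \<omega>)
            * f \<tau> (?y, fst (T \<omega> (v, v1))) * g \<tau> (?y, snd (T \<omega> (v, v1))))\<bar>
          \<le> 2 * b2_norm CARD('n) b * (\<Lambda>f * \<Lambda>g * ennreal (maxwellian \<alpha> \<beta> p))
            * (\<integral>\<^sup>+ w. ennreal (norm (w - v) powr \<gamma> *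
                exp (- \<alpha> * (norm (x - \<tau> *\<^sub>R (w - v)))\<^sup>2 - \<beta> * (norm w)\<^sup>2)) \<partial>lborel)"
        proof (rule collision_integral_le[OF S.sigma_finite_measure_axioms,
              where k = "\<lambda>u \<omega>. ennreal (B2 \<gamma> b u \<omega>)"])
          show "(\<integral>\<^sup>+ \<omega>. ennreal (B2 \<gamma> b u \<omega>) \<partial>sphere_measure) \<le> 2 * b2_norm CARD('n) b * ennreal (norm u powr \<gamma>)"
            for u :: "real ^ 'n" by (rule nn_integral_B2_le[OF d b])
          show "\<Lambda>f * \<Lambda>g * ennreal (maxwellian \<alpha> \<beta> p) < top"
            using f g by (auto simp: maxwellian_bounded_def ennreal_mult_less_top)
          from elim AE_space show "AE z in sphere_measure \<Otimes>\<^sub>M lborel.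
            e2ennreal \<bar>case z of (\<omega>, v1) \<Rightarrow> ereal (B2 \<gamma> b (v1 - v) \<omega>)
              * f \<tau> (?y, fst (T \<omega> (v, v1))) * g \<tau> (?y, snd (T \<omega> (v, v1)))\<bar>
            \<le> \<Lambda>f * \<Lambda>g * ennreal (maxwellian \<alpha> \<beta> p)
              * ennreal (exp (- \<alpha> * (norm (x - \<tau> *\<^sub>R (snd z - v)))\<^sup>2 - \<beta> * (norm (snd z))\<^sup>2))
              * ennreal (B2 \<gamma> b (snd z - v) (fst z))"
          proof eventually_elim
            case (elim z)
            obtain \<omega> v1 where z: "z = (\<omega>, v1)" by (cases z)
            have \<omega>: "norm \<omega> = 1" using elim(3) by (simp add: z space_pair_measure)
            obtain v' v1' where T_eq: "T \<omega> (v, v1) = (v', v1')" by fastforce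
            have f_le: "e2ennreal \<bar>f \<tau> (?y, v')\<bar> \<le> \<Lambda>f * ennreal (maxwellian \<alpha> \<beta> (?y - \<tau> *\<^sub>R v', v'))"
              and g_le: "e2ennreal \<bar>g \<tau> (?y, v1')\<bar> \<le> \<Lambda>g * ennreal (maxwellian \<alpha> \<beta> (?y - \<tau> *\<^sub>R v1', v1'))"
              using elim(1,2) \<tau> by (simp_all add: p z T_eq)
            have "v' + v1' = v + v1" "(norm v')\<^sup>2 + (norm v1')\<^sup>2 = (norm v)\<^sup>2 + (norm v1)\<^sup>2"
              using mom[OF \<omega>, of v v1] en[OF \<omega>, of v v1] by (simp_all add: T_eq)
            note M = maxwellian_binary_conserved[OF this, of \<alpha> \<beta> x \<tau>]
            have "e2ennreal \<bar>ereal (B2 \<gamma> b (v1 - v) \<omega>) * f \<tau> (?y, v') * g \<tau> (?y, v1')\<bar>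
              = ennreal (B2 \<gamma> b (v1 - v) \<omega>) * (e2ennreal \<bar>f \<tau> (?y, v')\<bar> * e2ennreal \<bar>g \<tau> (?y, v1')\<bar>)"
              using B2_nonneg[OF b \<omega>, of \<gamma> "v1 - v"] by (simp add: e2ennreal_abs_mult mult.assoc)
            also have "\<dots> \<le> ennreal (B2 \<gamma> b (v1 - v) \<omega>)
                * ((\<Lambda>f * ennreal (maxwellian \<alpha> \<beta> (?y - \<tau> *\<^sub>R v', v')))
                  * (\<Lambda>g * ennreal (maxwellian \<alpha> \<beta> (?y - \<tau> *\<^sub>R v1', v1'))))"
              by (intro mult_left_mono mult_mono f_le g_le) auto
            also have "\<dots> = ennreal (B2 \<gamma> b (v1 - v) \<omega>) * (\<Lambda>f * \<Lambda>g
                * ennreal (maxwellian \<alpha> \<beta> (?y - \<tau> *\<^sub>R v', v') * maxwellian \<alpha> \<beta> (?y - \<tau> *\<^sub>R v1', v1')))"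
              by (simp add: ennreal_mult less_imp_le[OF maxwellian_pos] mult_ac)
            also have "\<dots> = \<Lambda>f * \<Lambda>g * ennreal (maxwellian \<alpha> \<beta> p)
              * ennreal (exp (- \<alpha> * (norm (x - \<tau> *\<^sub>R (v1 - v)))\<^sup>2 - \<beta> * (norm v1)\<^sup>2))
              * ennreal (B2 \<gamma> b (v1 - v) \<omega>)"
              unfolding M p by (simp add: ennreal_mult less_imp_le[OF maxwellian_pos] mult_ac)
            finally show ?case by (simp add: z T_eq)
          qed
        qed auto
        then show "e2ennreal \<bar>transport (binary_operator \<gamma> b T f g) \<tau> p\<bar>
          \<le> 2 * b2_norm CARD('n) b * (\<Lambda>f * \<Lambda>g * ennreal (maxwellian \<alpha> \<beta> p))
            * dispersed_mass \<gamma> \<alpha> \<beta> (fst p) (snd p) \<tau>"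
          by (simp add: transport_eq binary_operator_def dispersed_mass_def p)
      qed
    qed
  qed
qed

lemma ternary_operator_transport_le:
  fixes f g h :: "'n::finite evolution"
  assumes \<gamma>: "\<gamma> \<le> 1" and b: "ternary_density TYPE('n) b"
    and T: "velocity_map T"
    and mom: "\<And>\<omega> v v1 v2 v' v1' v2'. norm \<omega> = 1 \<Longrightarrow> T \<omega> (v, v1, v2) = (v', v1', v2') \<Longrightarrow> v' + v1' + v2' = v + v1 + v2"
    and en: "\<And>\<omega> v v1 v2 v' v1' v2'. norm \<omega> = 1 \<Longrightarrow> T \<omega> (v, v1, v2) = (v', v1', v2') \<Longrightarrow>
      (norm v')\<^sup>2 + (norm v1')\<^sup>2 + (norm v2')\<^sup>2 = (norm v)\<^sup>2 + (norm v1)\<^sup>2 + (norm v2)\<^sup>2"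
    and f: "maxwellian_bounded \<T> \<alpha> \<beta> f \<Lambda>f" and g: "maxwellian_bounded \<T> \<alpha> \<beta> g \<Lambda>g"
    and h: "maxwellian_bounded \<T> \<alpha> \<beta> h \<Lambda>h"
  shows "AE p in lborel. AE \<tau> in lborel. \<tau> \<in> time_interval \<T> \<longrightarrow>
    e2ennreal \<bar>transport (ternary_operator \<gamma> b T f g h) \<tau> p\<bar>
      \<le> ennreal (sqrt 3) * b3_norm TYPE('n) b * (\<Lambda>f * \<Lambda>g * \<Lambda>h * ennreal (maxwellian \<alpha> \<beta> p))
        * dispersed_mass \<gamma> \<alpha> \<beta> (fst p, fst p) (snd p, snd p) \<tau>"
proof -
  interpret S: finite_measure "sphere_measure :: ('n vec2) measure" by (rule finite_measure_sphere_measure)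
  \<comment> \<open>Permutations that bring the velocities seen by \<open>g\<close> and \<open>h\<close> to the front.\<close>
  have T1: "velocity_map (\<lambda>\<omega> z. (\<lambda>(v, v1, v2). (v1, v, v2)) (T \<omega> z))"
    using T by (rule velocity_map_comp) (auto intro!: linearI injI)
  have T2: "velocity_map (\<lambda>\<omega> z. (\<lambda>(v, v1, v2). (v2, v, v1)) (T \<omega> z))"
    using T by (rule velocity_map_comp) (auto intro!: linearI injI)
  from AE_velocity_map[OF T f] AE_velocity_map[OF T1 g] AE_velocity_map[OF T2 h] show ?thesis
  proof eventually_elim
    case (elim p)
    obtain x v where p: "p = (x, v)" by (cases p)
    from elim show ?case
    proof eventually_elim
      case (elim \<tau>)
      show ?case
      proof
        assume \<tau>: "\<tau> \<in> time_interval \<T>"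
        let ?y = "x + \<tau> *\<^sub>R v"
        have "e2ennreal \<bar>ereal_integral (sphere_measure \<Otimes>\<^sub>M lborel) (\<lambda>(\<omega>, (v1, v2)). ereal (B3 \<gamma> b (v1 - v, v2 - v) \<omega>)
            * f \<tau> (?y, fst (T \<omega> (v, v1, v2))) * g \<tau> (?y, fst (snd (T \<omega> (v, v1, v2))))
            * h \<tau> (?y, snd (snd (T \<omega> (v, v1, v2)))))\<bar>
          \<le> ennreal (sqrt 3) * b3_norm TYPE('n) b * (\<Lambda>f * \<Lambda>g * \<Lambda>h * ennreal (maxwellian \<alpha> \<beta> p))
            * (\<integral>\<^sup>+ w. ennreal (norm (w - (v, v)) powr \<gamma> *
                exp (- \<alpha> * (norm ((x, x) - \<tau> *\<^sub>R (w - (v, v))))\<^sup>2 - \<beta> * (norm w)\<^sup>2)) \<partial>lborel)"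
        proof (rule collision_integral_le[OF S.sigma_finite_measure_axioms,
              where k = "\<lambda>u \<omega>. ennreal (B3 \<gamma> b u \<omega>)"])
          show "(\<integral>\<^sup>+ \<omega>. ennreal (B3 \<gamma> b u \<omega>) \<partial>sphere_measure)
              \<le> ennreal (sqrt 3) * b3_norm TYPE('n) b * ennreal (norm u powr \<gamma>)"
            for u :: "'n vec2" by (rule nn_integral_B3_le[OF \<gamma>])
          show "\<Lambda>f * \<Lambda>g * \<Lambda>h * ennreal (maxwellian \<alpha> \<beta> p) < top"
            using f g h by (auto simp: maxwellian_bounded_def ennreal_mult_less_top)
          from elim AE_space show "AE z in sphere_measure \<Otimes>\<^sub>M lborel.
            e2ennreal \<bar>case z of (\<omega>, (v1, v2)) \<Rightarrow> ereal (B3 \<gamma> b (v1 - v, v2 - v) \<omega>)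
              * f \<tau> (?y, fst (T \<omega> (v, v1, v2))) * g \<tau> (?y, fst (snd (T \<omega> (v, v1, v2))))
              * h \<tau> (?y, snd (snd (T \<omega> (v, v1, v2))))\<bar>
            \<le> \<Lambda>f * \<Lambda>g * \<Lambda>h * ennreal (maxwellian \<alpha> \<beta> p)
              * ennreal (exp (- \<alpha> * (norm ((x, x) - \<tau> *\<^sub>R (snd z - (v, v))))\<^sup>2 - \<beta> * (norm (snd z))\<^sup>2))
              * ennreal (B3 \<gamma> b (snd z - (v, v)) (fst z))"
          proof eventually_elim
            case (elim z)
            obtain \<omega> v1 v2 where z: "z = (\<omega>, v1, v2)" by (cases z) auto
            have \<omega>: "norm \<omega> = 1" using elim(4) by (simp add: z space_pair_measure)
            obtain v' v1' v2' where T_eq: "T \<omega> (v, v1, v2) = (v', v1', v2')" using prod_cases3 by blast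
            let ?M = "\<lambda>w. maxwellian \<alpha> \<beta> (?y - \<tau> *\<^sub>R w, w)"
            have f_le: "e2ennreal \<bar>f \<tau> (?y, v')\<bar> \<le> \<Lambda>f * ennreal (?M v')"
              and g_le: "e2ennreal \<bar>g \<tau> (?y, v1')\<bar> \<le> \<Lambda>g * ennreal (?M v1')"
              and h_le: "e2ennreal \<bar>h \<tau> (?y, v2')\<bar> \<le> \<Lambda>h * ennreal (?M v2')"
              using elim(1,2,3) \<tau> by (simp_all add: p z T_eq)
            note M = maxwellian_ternary_conserved[OF mom[OF \<omega> T_eq] en[OF \<omega> T_eq], of \<alpha> \<beta> x \<tau>]
            let ?B = "B3 \<gamma> b (v1 - v, v2 - v) \<omega>"
            have "e2ennreal \<bar>ereal ?B * f \<tau> (?y, v') * g \<tau> (?y, v1') * h \<tau> (?y, v2')\<bar>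
              = ennreal ?B * (e2ennreal \<bar>f \<tau> (?y, v')\<bar> * e2ennreal \<bar>g \<tau> (?y, v1')\<bar> * e2ennreal \<bar>h \<tau> (?y, v2')\<bar>)"
              using B3_nonneg[OF b \<omega>, of \<gamma> "(v1 - v, v2 - v)"] by (simp add: e2ennreal_abs_mult mult.assoc)
            also have "\<dots> \<le> ennreal ?B * ((\<Lambda>f * ennreal (?M v')) * (\<Lambda>g * ennreal (?M v1')) * (\<Lambda>h * ennreal (?M v2')))"
              by (intro mult_left_mono mult_mono f_le g_le h_le) auto
            also have "\<dots> = ennreal ?B * (\<Lambda>f * \<Lambda>g * \<Lambda>h * ennreal (?M v' * ?M v1' * ?M v2'))"
              by (simp add: ennreal_mult less_imp_le[OF maxwellian_pos] mult_ac)
            also have "\<dots> = \<Lambda>f * \<Lambda>g * \<Lambda>h * ennreal (maxwellian \<alpha> \<beta> p)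
              * ennreal (exp (- \<alpha> * (norm ((x, x) - \<tau> *\<^sub>R ((v1, v2) - (v, v))))\<^sup>2 - \<beta> * (norm (v1, v2))\<^sup>2))
              * ennreal ?B"
              unfolding M p
              by (subst ennreal_mult) (simp_all only: less_imp_le[OF maxwellian_pos] exp_ge_zero mult_ac)
            finally show ?case by (simp add: z T_eq)
          qed
        qed auto
        then show "e2ennreal \<bar>transport (ternary_operator \<gamma> b T f g h) \<tau> p\<bar>
          \<le> ennreal (sqrt 3) * b3_norm TYPE('n) b * (\<Lambda>f * \<Lambda>g * \<Lambda>h * ennreal (maxwellian \<alpha> \<beta> p))
            * dispersed_mass \<gamma> \<alpha> \<beta> (fst p, fst p) (snd p, snd p) \<tau>"
          by (simp add: transport_eq ternary_operator_def dispersed_mass_def p)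
      qed
    qed
  qed
qed

section \<open>Integration in time\<close>

lemma time_integral_le:
  assumes t: "t \<in> time_interval T"
    and F: "AE \<tau> in lborel. \<tau> \<in> time_interval T \<longrightarrow> e2ennreal \<bar>F \<tau> p\<bar> \<le> R \<tau>"
  shows "time_integral t F p \<le> integral\<^sup>N lborel R"
  unfolding time_integral_def
proof (rule nn_integral_mono_AE)
  have sub: "\<tau> \<in> time_interval T" if "\<tau> \<in> {0..t}" for \<tau>
    using that t by (auto simp: time_interval_def intro: le_less_trans[of "ereal \<tau>" "ereal t"])
  from F show "AE \<tau> in lborel. e2ennreal \<bar>F \<tau> p\<bar> * indicator {0..t} \<tau> \<le> R \<tau>"
  proof (rule eventually_mono)
    fix \<tau> assume "\<tau> \<in> time_interval T \<longrightarrow> e2ennreal \<bar>F \<tau> p\<bar> \<le> R \<tau>"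
    then show "e2ennreal \<bar>F \<tau> p\<bar> * indicator {0..t} \<tau> \<le> R \<tau>"
      using sub[of \<tau>] by (cases "\<tau> \<in> {0..t}") auto
  qed
qed

lemma time_integral_dispersed_le:
  assumes t: "t \<in> time_interval T"
    and F: "AE \<tau> in lborel. \<tau> \<in> time_interval T \<longrightarrow> e2ennreal \<bar>F \<tau> p\<bar> \<le> c * dispersed_mass \<gamma> \<alpha> \<beta> X a \<tau>"
    and D: "(\<integral>\<^sup>+ \<tau>. dispersed_mass \<gamma> \<alpha> \<beta> X a \<tau> \<partial>lborel) \<le> D"
  shows "time_integral t F p \<le> c * D"
proof -
  have "time_integral t F p \<le> (\<integral>\<^sup>+ \<tau>. c * dispersed_mass \<gamma> \<alpha> \<beta> X a \<tau> \<partial>lborel)"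
    by (rule time_integral_le[OF t]) (rule F)
  also have "\<dots> = c * (\<integral>\<^sup>+ \<tau>. dispersed_mass \<gamma> \<alpha> \<beta> X a \<tau> \<partial>lborel)"
    by (rule nn_integral_cmult) measurable
  also have "\<dots> \<le> c * D" by (intro mult_left_mono D) auto
  finally show ?thesis .
qed

text \<open>The mixed operators need their own version: the two summands need not be measurable in time, and
  lower integrals are not subadditive, so the measurable majorants are added instead of the
  time integrals.\<close>

lemma time_integral_add_dispersed_le:
  assumes t: "t \<in> time_interval T"
    and F: "AE \<tau> in lborel. \<tau> \<in> time_interval T \<longrightarrow> e2ennreal \<bar>F \<tau> p\<bar> \<le> c * dispersed_mass \<gamma> \<alpha> \<beta> X a \<tau>"
    and G: "AE \<tau> in lborel. \<tau> \<in> time_interval T \<longrightarrow> e2ennreal \<bar>G \<tau> p\<bar> \<le> c' * dispersed_mass \<gamma>' \<alpha> \<beta> X' a' \<tau>"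
    and D: "(\<integral>\<^sup>+ \<tau>. dispersed_mass \<gamma> \<alpha> \<beta> X a \<tau> \<partial>lborel) \<le> D"
      "(\<integral>\<^sup>+ \<tau>. dispersed_mass \<gamma>' \<alpha> \<beta> X' a' \<tau> \<partial>lborel) \<le> D'"
    and H: "\<And>\<tau>. H \<tau> p = F \<tau> p + G \<tau> p"
  shows "time_integral t H p \<le> c * D + c' * D'"
proof -
  have "time_integral t H p
      \<le> (\<integral>\<^sup>+ \<tau>. c * dispersed_mass \<gamma> \<alpha> \<beta> X a \<tau> + c' * dispersed_mass \<gamma>' \<alpha> \<beta> X' a' \<tau> \<partial>lborel)"
  proof (rule time_integral_le[OF t])
    from F G show "AE \<tau> in lborel. \<tau> \<in> time_interval T \<longrightarrow> e2ennreal \<bar>H \<tau> p\<bar>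
        \<le> c * dispersed_mass \<gamma> \<alpha> \<beta> X a \<tau> + c' * dispersed_mass \<gamma>' \<alpha> \<beta> X' a' \<tau>"
      by eventually_elim (auto simp: H intro: order_trans[OF e2ennreal_abs_add_le] add_mono)
  qed
  also have "\<dots> = c * (\<integral>\<^sup>+ \<tau>. dispersed_mass \<gamma> \<alpha> \<beta> X a \<tau> \<partial>lborel)
      + c' * (\<integral>\<^sup>+ \<tau>. dispersed_mass \<gamma>' \<alpha> \<beta> X' a' \<tau> \<partial>lborel)"
    by (simp add: nn_integral_add nn_integral_cmult)
  also have "\<dots> \<le> c * D + c' * D'" by (intro add_mono mult_left_mono D) auto
  finally show ?thesis .
qed

theorem proposition3p7:
  assumes "2 \<le> CARD('n::finite)"
  shows "\<exists>C>0. \<forall>\<gamma>2 \<gamma>3 b2 b3 T \<alpha> \<beta>. \<forall>f g h :: 'n evolution.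
    collision_data TYPE('n) \<gamma>2 \<gamma>3 b2 b3 \<longrightarrow>
    0 < T \<longrightarrow> 0 < \<alpha> \<longrightarrow> 0 < \<beta> \<longrightarrow>
    f \<in> F_T T \<longrightarrow> g \<in> F_T T \<longrightarrow> h \<in> F_T T \<longrightarrow>
    jointly_measurable T f \<longrightarrow> jointly_measurable T g \<longrightarrow> jointly_measurable T h \<longrightarrow>
    transport f \<in> Linf_M T \<alpha> \<beta> \<longrightarrow> transport g \<in> Linf_M T \<alpha> \<beta> \<longrightarrow>
    transport h \<in> Linf_M T \<alpha> \<beta> \<longrightarrow>
    (let A = K_const TYPE('n) C \<gamma>2 \<gamma>3 b2 b3 \<beta> * ennreal (\<alpha> powr (- 1 / 2));
         M = (\<lambda>p. ennreal (maxwellian \<alpha> \<beta> p));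
         nf = sup_norm T \<alpha> \<beta> (transport f);
         ng = sup_norm T \<alpha> \<beta> (transport g);
         nh = sup_norm T \<alpha> \<beta> (transport h)
     in \<forall>t\<in>time_interval T.
       (AE p in lebesgue. time_integral t (transport (L2 \<gamma>2 b2 f g)) p
          \<le> A * M p * nf * ng) \<and>
       (AE p in lebesgue. time_integral t (transport (G2 \<gamma>2 b2 f g)) p
          \<le> A * M p * nf * ng) \<and>
       (AE p in lebesgue. time_integral t (transport (L3 \<gamma>3 b3 f g h)) p
          \<le> A * M p * nf * ng * nh) \<and>
       (AE p in lebesgue. time_integral t (transport (G3 \<gamma>3 b3 f g h)) p
          \<le> A * M p * nf * ng * nh) \<and>
       (AE p in lebesgue. time_integral t (transport (L_mixed \<gamma>2 \<gamma>3 b2 b3 f g h)) p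
          \<le> A * M p * nf * ng * (1 + nh)) \<and>
       (AE p in lebesgue. time_integral t (transport (G_mixed \<gamma>2 \<gamma>3 b2 b3 f g h)) p
          \<le> A * M p * nf * ng * (1 + nh)))"
proof -
  let ?d = "real CARD('n)"
  obtain C2 where C2: "0 < C2" and dispersed2: "\<And>\<alpha> \<beta> \<gamma> (X :: real ^ 'n) a.
      0 < \<alpha> \<Longrightarrow> 0 < \<beta> \<Longrightarrow> - ?d + 1 < \<gamma> \<Longrightarrow> \<gamma> \<le> 1 \<Longrightarrow>
      (\<integral>\<^sup>+ \<tau>. dispersed_mass \<gamma> \<alpha> \<beta> X a \<tau> \<partial>lborel)
        \<le> ennreal C2 * ennreal (\<beta> powr (- ?d / 2) + 1 / (?d + \<gamma> - 1)) * ennreal (\<alpha> powr (- 1 / 2))"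
    using nn_integral_spacetime_gaussian_le[where 'w = "real ^ 'n"]
    unfolding dispersed_mass_def by (auto simp del: One_nat_def)
  obtain C3 where C3: "0 < C3" and dispersed3: "\<And>\<alpha> \<beta> \<gamma> (X :: 'n vec2) a.
      0 < \<alpha> \<Longrightarrow> 0 < \<beta> \<Longrightarrow> - 2 * ?d + 1 < \<gamma> \<Longrightarrow> \<gamma> \<le> 1 \<Longrightarrow>
      (\<integral>\<^sup>+ \<tau>. dispersed_mass \<gamma> \<alpha> \<beta> X a \<tau> \<partial>lborel)
        \<le> ennreal C3 * ennreal (\<beta> powr (- ?d) + 1 / (2 * ?d + \<gamma> - 1)) * ennreal (\<alpha> powr (- 1 / 2))"
  proof -
    have dim: "real DIM('n vec2) = 2 * ?d" "- real DIM('n vec2) / 2 = - ?d" by simp_all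
    obtain C where C: "0 < C" and bound: "\<And>\<alpha> \<beta> \<gamma> (X :: 'n vec2) a.
      0 < \<alpha> \<Longrightarrow> 0 < \<beta> \<Longrightarrow> - real DIM('n vec2) + 1 < \<gamma> \<Longrightarrow> \<gamma> \<le> 1 \<Longrightarrow>
      (\<integral>\<^sup>+ \<tau>. dispersed_mass \<gamma> \<alpha> \<beta> X a \<tau> \<partial>lborel)
        \<le> ennreal C * ennreal (\<beta> powr (- real DIM('n vec2) / 2) + 1 / (real DIM('n vec2) + \<gamma> - 1))
          * ennreal (\<alpha> powr (- 1 / 2))"
      using nn_integral_spacetime_gaussian_le[where 'w = "'n vec2"]
      unfolding dispersed_mass_def by blast
    show thesis
    proof (rule that[OF C])
      fix \<alpha> \<beta> \<gamma> :: real and X a :: "'n vec2"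
      assume "0 < \<alpha>" "0 < \<beta>" "- 2 * ?d + 1 < \<gamma>" "\<gamma> \<le> 1"
      then show "(\<integral>\<^sup>+ \<tau>. dispersed_mass \<gamma> \<alpha> \<beta> X a \<tau> \<partial>lborel)
        \<le> ennreal C * ennreal (\<beta> powr (- ?d) + 1 / (2 * ?d + \<gamma> - 1)) * ennreal (\<alpha> powr (- 1 / 2))"
        using bound[of \<alpha> \<beta> \<gamma> X a] unfolding dim(2) unfolding dim(1) by simp
    qed
  qed
  \<comment> \<open>The factors \<open>2\<close> and \<open>\<surd>3\<close> come from the angular integrals of the two kernels.\<close>
  define C where "C = 2 * C2 + sqrt 3 * C3"
  show ?thesis
  proof (intro exI[of _ C] conjI allI impI)
    show "0 < C" using C2 C3 by (simp add: C_def add_pos_pos)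
    fix \<gamma>2 \<gamma>3 b2 b3 T \<alpha> \<beta> and f g h :: "'n evolution"
    assume data: "collision_data TYPE('n) \<gamma>2 \<gamma>3 b2 b3" and \<alpha>: "0 < \<alpha>" and \<beta>: "0 < \<beta>"
      and meas: "jointly_measurable T f" "jointly_measurable T g" "jointly_measurable T h"
      and Linf: "transport f \<in> Linf_M T \<alpha> \<beta>" "transport g \<in> Linf_M T \<alpha> \<beta>" "transport h \<in> Linf_M T \<alpha> \<beta>"
    have \<gamma>: "- ?d + 1 < \<gamma>2" "\<gamma>2 \<le> 1" "- 2 * ?d + 1 < \<gamma>3" "\<gamma>3 \<le> 1"
      and b2: "binary_density CARD('n) b2" and b3: "ternary_density TYPE('n) b3"
      using data by (auto simp: collision_data_def)
    define nf where "nf = sup_norm T \<alpha> \<beta> (transport f)"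
    define ng where "ng = sup_norm T \<alpha> \<beta> (transport g)"
    define nh where "nh = sup_norm T \<alpha> \<beta> (transport h)"
    define M where "M p = ennreal (maxwellian \<alpha> \<beta> p)" for p :: "'n vec2"
    define A where "A = K_const TYPE('n) C \<gamma>2 \<gamma>3 b2 b3 \<beta> * ennreal (\<alpha> powr (- 1 / 2))"
    define D2 where "D2 = ennreal C2 * ennreal (\<beta> powr (- ?d / 2) + 1 / (?d + \<gamma>2 - 1)) * ennreal (\<alpha> powr (- 1 / 2))"
    define D3 where "D3 = ennreal C3 * ennreal (\<beta> powr (- ?d) + 1 / (2 * ?d + \<gamma>3 - 1)) * ennreal (\<alpha> powr (- 1 / 2))"
    define c2 where "c2 p = 2 * b2_norm CARD('n) b2 * (nf * ng * M p)" for p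
    define c3 where "c3 p = ennreal (sqrt 3) * b3_norm TYPE('n) b3 * (nf * ng * nh * M p)" for p
    note bounded = maxwellian_bounded_sup_norm[OF meas(1) Linf(1), folded nf_def]
      maxwellian_bounded_sup_norm[OF meas(2) Linf(2), folded ng_def]
      maxwellian_bounded_sup_norm[OF meas(3) Linf(3), folded nh_def]
    have L2: "AE p in lborel. AE \<tau> in lborel. \<tau> \<in> time_interval T \<longrightarrow>
        e2ennreal \<bar>transport (L2 \<gamma>2 b2 f g) \<tau> p\<bar> \<le> c2 p * dispersed_mass \<gamma>2 \<alpha> \<beta> (fst p) (snd p) \<tau>"
      unfolding collision_operators_eq c2_def M_def
      by (rule binary_operator_transport_le[OF assms b2 velocity_map_ident _ _ bounded(1,2)]) auto
    have G2: "AE p in lborel. AE \<tau> in lborel. \<tau> \<in> time_interval T \<longrightarrow>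
        e2ennreal \<bar>transport (G2 \<gamma>2 b2 f g) \<tau> p\<bar> \<le> c2 p * dispersed_mass \<gamma>2 \<alpha> \<beta> (fst p) (snd p) \<tau>"
      unfolding collision_operators_eq c2_def M_def
      by (rule binary_operator_transport_le[OF assms b2 velocity_map_binary_collision
            binary_collision_conserves bounded(1,2)])
    have L3: "AE p in lborel. AE \<tau> in lborel. \<tau> \<in> time_interval T \<longrightarrow>
        e2ennreal \<bar>transport (L3 \<gamma>3 b3 f g h) \<tau> p\<bar>
          \<le> c3 p * dispersed_mass \<gamma>3 \<alpha> \<beta> (fst p, fst p) (snd p, snd p) \<tau>"
      unfolding collision_operators_eq c3_def M_def
      by (rule ternary_operator_transport_le[OF \<gamma>(4) b3 velocity_map_ident _ _ bounded]) auto
    have G3: "AE p in lborel. AE \<tau> in lborel. \<tau> \<in> time_interval T \<longrightarrow>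
        e2ennreal \<bar>transport (G3 \<gamma>3 b3 f g h) \<tau> p\<bar>
          \<le> c3 p * dispersed_mass \<gamma>3 \<alpha> \<beta> (fst p, fst p) (snd p, snd p) \<tau>"
      unfolding collision_operators_eq c3_def M_def
      by (rule ternary_operator_transport_le[OF \<gamma>(4) b3 velocity_map_ternary_collision
            ternary_collision_conserves bounded])
    have D2: "(\<integral>\<^sup>+ \<tau>. dispersed_mass \<gamma>2 \<alpha> \<beta> X a \<tau> \<partial>lborel) \<le> D2" for X a :: "real ^ 'n"
      unfolding D2_def by (rule dispersed2[OF \<alpha> \<beta> \<gamma>(1,2)])
    have D3: "(\<integral>\<^sup>+ \<tau>. dispersed_mass \<gamma>3 \<alpha> \<beta> X a \<tau> \<partial>lborel) \<le> D3" for X a :: "'n vec2"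
      unfolding D3_def by (rule dispersed3[OF \<alpha> \<beta> \<gamma>(3,4)])
    let ?k2 = "b2_norm CARD('n) b2 * ennreal (\<beta> powr (- ?d / 2) + 1 / (?d + \<gamma>2 - 1))"
    let ?k3 = "b3_norm TYPE('n) b3 * ennreal (\<beta> powr (- ?d) + 1 / (2 * ?d + \<gamma>3 - 1))"
    let ?a = "ennreal (\<alpha> powr (- 1 / 2))"
    have A_eq: "A = ennreal C * (?k2 + ?k3) * ?a" by (simp add: A_def K_const_def)
    have le2: "c2 p * D2 \<le> A * M p * nf * ng" for p
    proof -
      have "2 * ennreal C2 = ennreal (2 * C2)" using C2 by (simp add: ennreal_mult)
      also have "\<dots> \<le> ennreal C" using C3 by (intro ennreal_leI) (simp add: C_def)
      finally have "2 * ennreal C2 * ?k2 * ?a * (M p * nf * ng) \<le> ennreal C * (?k2 + ?k3) * ?a * (M p * nf * ng)"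
        by (intro mult_right_mono mult_mono) (auto intro: add_increasing2)
      then show ?thesis by (simp add: A_eq c2_def D2_def mult_ac)
    qed
    have le3: "c3 p * D3 \<le> A * M p * nf * ng * nh" for p
    proof -
      have "ennreal (sqrt 3) * ennreal C3 = ennreal (sqrt 3 * C3)" using C3 by (simp add: ennreal_mult)
      also have "\<dots> \<le> ennreal C" using C2 by (intro ennreal_leI) (simp add: C_def)
      finally have "ennreal (sqrt 3) * ennreal C3 * ?k3 * ?a * (M p * nf * ng * nh)
          \<le> ennreal C * (?k2 + ?k3) * ?a * (M p * nf * ng * nh)"
        by (intro mult_right_mono mult_mono) (auto intro: add_increasing)
      then show ?thesis by (simp add: A_eq c3_def D3_def mult_ac)
    qed
    have le_sum: "c2 p * D2 + c3 p * D3 \<le> A * M p * nf * ng * (1 + nh)" for p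
      using add_mono[OF le2 le3, of p p] by (simp add: distrib_left)
    have mixed: "transport (L_mixed \<gamma>2 \<gamma>3 b2 b3 f g h) \<tau> p = transport (L2 \<gamma>2 b2 f g) \<tau> p + transport (L3 \<gamma>3 b3 f g h) \<tau> p"
      "transport (G_mixed \<gamma>2 \<gamma>3 b2 b3 f g h) \<tau> p = transport (G2 \<gamma>2 b2 f g) \<tau> p + transport (G3 \<gamma>3 b3 f g h) \<tau> p"
      for \<tau> p by (simp_all add: transport_eq L_mixed_def G_mixed_def)
    have "(AE p in lborel. time_integral t (transport (L2 \<gamma>2 b2 f g)) p \<le> A * M p * nf * ng) \<and>
       (AE p in lborel. time_integral t (transport (G2 \<gamma>2 b2 f g)) p \<le> A * M p * nf * ng) \<and>
       (AE p in lborel. time_integral t (transport (L3 \<gamma>3 b3 f g h)) p \<le> A * M p * nf * ng * nh) \<and>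
       (AE p in lborel. time_integral t (transport (G3 \<gamma>3 b3 f g h)) p \<le> A * M p * nf * ng * nh) \<and>
       (AE p in lborel. time_integral t (transport (L_mixed \<gamma>2 \<gamma>3 b2 b3 f g h)) p
          \<le> A * M p * nf * ng * (1 + nh)) \<and>
       (AE p in lborel. time_integral t (transport (G_mixed \<gamma>2 \<gamma>3 b2 b3 f g h)) p
          \<le> A * M p * nf * ng * (1 + nh))"
      if t: "t \<in> time_interval T" for t
    proof (intro conjI)
      show "AE p in lborel. time_integral t (transport (L2 \<gamma>2 b2 f g)) p \<le> A * M p * nf * ng"
        using L2 by eventually_elim (rule order_trans[OF time_integral_dispersed_le[OF t _ D2] le2])
      show "AE p in lborel. time_integral t (transport (G2 \<gamma>2 b2 f g)) p \<le> A * M p * nf * ng"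
        using G2 by eventually_elim (rule order_trans[OF time_integral_dispersed_le[OF t _ D2] le2])
      show "AE p in lborel. time_integral t (transport (L3 \<gamma>3 b3 f g h)) p \<le> A * M p * nf * ng * nh"
        using L3 by eventually_elim (rule order_trans[OF time_integral_dispersed_le[OF t _ D3] le3])
      show "AE p in lborel. time_integral t (transport (G3 \<gamma>3 b3 f g h)) p \<le> A * M p * nf * ng * nh"
        using G3 by eventually_elim (rule order_trans[OF time_integral_dispersed_le[OF t _ D3] le3])
      show "AE p in lborel. time_integral t (transport (L_mixed \<gamma>2 \<gamma>3 b2 b3 f g h)) p
          \<le> A * M p * nf * ng * (1 + nh)"
        using L2 L3 by eventually_elim
          (rule order_trans[OF time_integral_add_dispersed_le[OF t _ _ D2 D3 mixed(1)] le_sum])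
      show "AE p in lborel. time_integral t (transport (G_mixed \<gamma>2 \<gamma>3 b2 b3 f g h)) p
          \<le> A * M p * nf * ng * (1 + nh)"
        using G2 G3 by eventually_elim
          (rule order_trans[OF time_integral_add_dispersed_le[OF t _ _ D2 D3 mixed(2)] le_sum])
    qed
    then show "let A = K_const TYPE('n) C \<gamma>2 \<gamma>3 b2 b3 \<beta> * ennreal (\<alpha> powr (- 1 / 2));
         M = (\<lambda>p. ennreal (maxwellian \<alpha> \<beta> p));
         nf = sup_norm T \<alpha> \<beta> (transport f);
         ng = sup_norm T \<alpha> \<beta> (transport g);
         nh = sup_norm T \<alpha> \<beta> (transport h)
     in \<forall>t\<in>time_interval T.
       (AE p in lebesgue. time_integral t (transport (L2 \<gamma>2 b2 f g)) p
          \<le> A * M p * nf * ng) \<and>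
       (AE p in lebesgue. time_integral t (transport (G2 \<gamma>2 b2 f g)) p
          \<le> A * M p * nf * ng) \<and>
       (AE p in lebesgue. time_integral t (transport (L3 \<gamma>3 b3 f g h)) p
          \<le> A * M p * nf * ng * nh) \<and>
       (AE p in lebesgue. time_integral t (transport (G3 \<gamma>3 b3 f g h)) p
          \<le> A * M p * nf * ng * nh) \<and>
       (AE p in lebesgue. time_integral t (transport (L_mixed \<gamma>2 \<gamma>3 b2 b3 f g h)) p
          \<le> A * M p * nf * ng * (1 + nh)) \<and>
       (AE p in lebesgue. time_integral t (transport (G_mixed \<gamma>2 \<gamma>3 b2 b3 f g h)) p
          \<le> A * M p * nf * ng * (1 + nh))"
      unfolding Let_def A_def M_def nf_def ng_def nh_def AE_completion_iff by blast
  qed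
qed

end
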